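(* Let $(K,\delta)$ be a differentially closed field of characteristic zero. Then there exists an infinite set $T$ such that for an arbitrary $c$-filter $\varOmega$ in $\mathbb{C}^T$ there is a family $g=(g_t\in\mathcal{N}^{\mathbb{C}}_{\varOmega}:t\in T)$ for which $(K,\delta)$ is $\mathbb{Q}$-differentially isomorphic to $(\mathcal{N}^{\mathbb{C}}_{\varOmega},\delta_g)$, where $\delta_g(f)=\sum_{t\in T}g_t\frac{\partial f}{\partial\Lambda_t}$ for $f\in\mathcal{N}^{\mathbb{C}}_{\varOmega}$.
   Context: All differential fields are ordinary: a differential field $(K,\delta)$ is a field of characteristic zero with one derivation $\delta$. The ring of differential polynomials is $K\{y\}=K[y_{\delta^0},y_{\delta},y_{\delta^2},\ldots]$, with $y=y_{\delta^0}$; $p(a)$ is obtained by substituting $\delta^j(a)$ for $y_{\delta^j}$; $\operatorname{ord}p$ is the largest $n$ such that $y_{\delta^n}$ occurs in $p$, and $\operatorname{ord}p=-1$ if $p\in K$. $(K,\delta)$ is differentially closed if for each pair $p,q\in K\{y\}$ with $\operatorname{ord}q<\operatorname{ord}p$ and $q\neq0$ there is $a\in K$ with $p(a)=0$ and $q(a)\neq0$. A $\mathbb{Q}$-differential isomorphism is a field isomorphism commuting with the derivations. Let $T$ be a nonempty set, $\Lambda_T=(\Lambda_t:t\in T)$ a system of independent variables, and $\mathbb{C}^T$ the set of functions $T\to\mathbb{C}$ with the product topology. A subset of $\mathbb{C}^T$ is $\mathbb{Q}$-algebraic if it is defined by a finite system of equations $P=0$, $P\in\mathbb{Q}[\Lambda_T]$.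 It is $\mathbb{Q}$-semialgebraic if, identifying $\mathbb{C}^T$ with $(\mathbb{R}^T)^2$, it is defined by a finite boolean combination of inequalities $P>0$ or $P\ge0$, where $P$ is a polynomial with rational coefficients in the real and imaginary parts of (finitely many) coordinates. A $c$-filter in $\mathbb{C}^T$ is a family $\varOmega$ of subsets of $\mathbb{C}^T$ such that: (i) any $U\in\varOmega$ is a nonempty open connected $\mathbb{Q}$-semialgebraic set; (ii) for any $\mathbb{Q}$-algebraic set $V\subsetneq\mathbb{C}^T$ there is $U\in\varOmega$ with $V\cap U=\emptyset$; (iii) for any $U_1,U_2\in\varOmega$ there is $U_3\in\varOmega$ with $U_3\subset U_1\cap U_2$; (iv) for any $U\in\varOmega$ there exist an open connected and simply connected $\mathbb{Q}$-semialgebraic set $U_0\subset\mathbb{C}^T$ and $U'\in\varOmega$ with $U'\subset U_0\subset U$. For an open $\mathbb{Q}$-semialgebraic $U\subset\mathbb{C}^T$, $\mathcal{N}^{\mathbb{C}}(U)$ is the ring of $\mathbb{C}$-$\mathbb{Q}$-Nash functions on $U$, i.e. holomorphic $f:U\to\mathbb{C}$ for which there is a nonzero $P\in\mathbb{Q}[\Lambda_T,Z]$ with $P(\lambda,f(\lambda))=0$ on $U$ (such functions depend on finitely many variables only). $\mathcal{N}^{\mathbb{C}}_{\varOmega}$ is the set of equivalence classes of elements of $\bigcup_{U\in\varOmega}\mathcal{N}^{\mathbb{C}}(U)$ under $(f_1:U_1\to\mathbb{C})\sim(f_2:U_2\to\mathbb{C})$ iff $f_1|_{U_3}=f_2|_{U_3}$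 for some $U_3\in\varOmega$; with pointwise addition and multiplication it is a field (the field of Nash functions), and the coordinate functions $\Lambda_t$ are elements of it. For each $f$ the sum defining $\delta_g(f)$ has finitely many nonzero terms, and $\delta_g$ is a derivation. *)

theory Defs
  imports
    "HOL-Analysis.Analysis"
    "HOL-Algebra.Algebra"
    "HOL-Algebra.Indexed_Polynomials"
    "HOL-Algebra.Free_Abelian_Groups"
    "HOL-Library.Poly_Mapping"
begin

section \<open>Differential fields\<close>

locale differential_field = field R for R (structure) +
  fixes \<delta> :: "'a \<Rightarrow> 'a"
  assumes char_zero: "0 < (n::nat) \<Longrightarrow> [n] \<cdot> \<one> \<noteq> \<zero>"
    and deriv_closed: "x \<in> carrier R \<Longrightarrow> \<delta> x \<in> carrier R"
    and deriv_add: "\<lbrakk>x \<in> carrier R; y \<in> carrier R\<rbrakk> \<Longrightarrow> \<delta> (x \<oplus> y) = \<delta> x \<oplus> \<delta> y"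
    and deriv_mult: "\<lbrakk>x \<in> carrier R; y \<in> carrier R\<rbrakk> \<Longrightarrow> \<delta> (x \<otimes> y) = \<delta> x \<otimes> y \<oplus> x \<otimes> \<delta> y"
begin

text \<open>The letter with index \<open>j\<close> stands for the \<open>j\<close>-th derivative of \<open>y\<close>; a polynomial is the
  function sending a monomial (a multiset of letters) to its coefficient.\<close>

definition diff_polys :: "(nat multiset \<Rightarrow> 'a) set"
  where "diff_polys = indexed_pset UNIV (carrier R)"

definition diff_eval :: "(nat multiset \<Rightarrow> 'a) \<Rightarrow> 'a \<Rightarrow> 'a"
  where "diff_eval p a =
    (\<Oplus>m\<in>{m. p m \<noteq> \<zero>}. p m \<otimes> (\<Otimes>j\<in>set_mset m. ((\<delta> ^^ j) a) [^] count m j))"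

definition diff_ord :: "(nat multiset \<Rightarrow> 'a) \<Rightarrow> int"
  where "diff_ord p =
    (if \<forall>n. index_free p n then -1 else int (Max {n. \<not> index_free p n}))"

end

locale differentially_closed_field = differential_field +
  assumes diff_closed:
    "\<lbrakk>p \<in> diff_polys; q \<in> diff_polys; diff_ord q < diff_ord p; q \<noteq> indexed_const \<zero>\<rbrakk>
      \<Longrightarrow> \<exists>a\<in>carrier R. diff_eval p a = \<zero> \<and> diff_eval q a \<noteq> \<zero>"

definition differential_iso ::
    "('a, 'm) ring_scheme \<Rightarrow> ('a \<Rightarrow> 'a) \<Rightarrow> ('b, 'n) ring_scheme \<Rightarrow> ('b \<Rightarrow> 'b) \<Rightarrow> ('a \<Rightarrow> 'b) set"
  where "differential_iso R \<delta> S \<epsilon> =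
    {\<phi> \<in> ring_iso R S. \<forall>a\<in>carrier R. \<phi> (\<delta> a) = \<epsilon> (\<phi> a)}"


section \<open>Algebraic and semialgebraic sets in powers of the complex line\<close>

abbreviation powertop_complex :: "'t set \<Rightarrow> ('t \<Rightarrow> complex) topology"
  where "powertop_complex \<equiv> product_topology (\<lambda>_. euclidean)"

text \<open>Polynomials with rational coefficients, as finitely supported functions on monomials.\<close>

type_synonym 'v qpoly = "'v multiset \<Rightarrow>\<^sub>0 rat"

definition qpoly_vars :: "'v qpoly \<Rightarrow> 'v set"
  where "qpoly_vars P = (\<Union>m\<in>Poly_Mapping.keys P. set_mset m)"

definition qpoly_eval :: "'v qpoly \<Rightarrow> ('v \<Rightarrow> 'c::field_char_0) \<Rightarrow> 'c"
  where "qpoly_eval P x = (\<Sum>m\<in>Poly_Mapping.keys P. of_rat (Poly_Mapping.lookup P m) * (\<Prod>v\<in>#m. x v))"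

definition Q_algebraic :: "'t set \<Rightarrow> ('t \<Rightarrow> complex) set \<Rightarrow> bool"
  where "Q_algebraic T V \<longleftrightarrow>
    (\<exists>F::'t qpoly set. finite F \<and> (\<forall>P\<in>F. qpoly_vars P \<subseteq> T) \<and>
      V = {x \<in> topspace (powertop_complex T). \<forall>P\<in>F. qpoly_eval P x = 0})"

text \<open>In the real polynomials below, \<open>Inl t\<close> and \<open>Inr t\<close> are the real and imaginary part of the
  coordinate with index \<open>t\<close>.\<close>

definition real_coords :: "('t \<Rightarrow> complex) \<Rightarrow> 't + 't \<Rightarrow> real"
  where "real_coords x = case_sum (\<lambda>t. Re (x t)) (\<lambda>t. Im (x t))"

inductive Q_semialgebraic :: "'t set \<Rightarrow> ('t \<Rightarrow> complex) set \<Rightarrow> bool"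
  for T :: "'t set"
  where
    gt: "qpoly_vars P \<subseteq> T <+> T \<Longrightarrow>
      Q_semialgebraic T {x \<in> topspace (powertop_complex T). qpoly_eval P (real_coords x) > 0}"
  | ge: "qpoly_vars P \<subseteq> T <+> T \<Longrightarrow>
      Q_semialgebraic T {x \<in> topspace (powertop_complex T). qpoly_eval P (real_coords x) \<ge> 0}"
  | compl: "Q_semialgebraic T A \<Longrightarrow> Q_semialgebraic T (topspace (powertop_complex T) - A)"
  | union: "\<lbrakk>Q_semialgebraic T A; Q_semialgebraic T B\<rbrakk> \<Longrightarrow> Q_semialgebraic T (A \<union> B)"
  | inter: "\<lbrakk>Q_semialgebraic T A; Q_semialgebraic T B\<rbrakk> \<Longrightarrow> Q_semialgebraic T (A \<inter> B)"


section \<open>Filters of open sets\<close>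

text \<open>The library's \<^const>\<open>simply_connected\<close>, transferred from type classes to explicit topologies.\<close>

definition simply_connectedin :: "'x topology \<Rightarrow> 'x set \<Rightarrow> bool"
  where "simply_connectedin M S \<longleftrightarrow> S \<subseteq> topspace M \<and>
    (\<forall>p q. pathin (subtopology M S) p \<and> p 1 = p 0 \<and> pathin (subtopology M S) q \<and> q 1 = q 0
      \<longrightarrow> homotopic_with (\<lambda>r. r 1 = r 0) (top_of_set {0..1::real}) (subtopology M S) p q)"

lemma simply_connectedin_euclidean:
  "simply_connectedin euclidean S \<longleftrightarrow> simply_connected S"
  unfolding simply_connectedin_def simply_connected_def homotopic_loops_def
    pathin_canon_iff path_image_def pathstart_def pathfinish_def
  by (auto simp: image_subset_iff Pi_iff)

definition c_filter :: "'t set \<Rightarrow> ('t \<Rightarrow> complex) set set \<Rightarrow> bool"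
  where "c_filter T \<Omega> \<longleftrightarrow>
    (\<forall>U\<in>\<Omega>. U \<noteq> {} \<and> openin (powertop_complex T) U \<and> connectedin (powertop_complex T) U \<and>
      Q_semialgebraic T U) \<and>
    (\<forall>V. Q_algebraic T V \<and> V \<subset> topspace (powertop_complex T) \<longrightarrow> (\<exists>U\<in>\<Omega>. V \<inter> U = {})) \<and>
    (\<forall>U1\<in>\<Omega>. \<forall>U2\<in>\<Omega>. \<exists>U3\<in>\<Omega>. U3 \<subseteq> U1 \<inter> U2) \<and>
    (\<forall>U\<in>\<Omega>. \<exists>U0. openin (powertop_complex T) U0 \<and> connectedin (powertop_complex T) U0 \<and>
      simply_connectedin (powertop_complex T) U0 \<and> Q_semialgebraic T U0 \<and>
      (\<exists>U'\<in>\<Omega>. U' \<subseteq> U0 \<and> U0 \<subseteq> U))"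


section \<open>Nash functions\<close>

text \<open>Holomorphy on an open subset of a complex topological vector space: continuity together with
  complex differentiability along every complex line.\<close>

definition power_holomorphic_on ::
    "(('t \<Rightarrow> complex) \<Rightarrow> complex) \<Rightarrow> 't set \<Rightarrow> ('t \<Rightarrow> complex) set \<Rightarrow> bool"
  where "power_holomorphic_on f T U \<longleftrightarrow>
    continuous_map (subtopology (powertop_complex T) U) euclidean f \<and>
    (\<forall>x\<in>U. \<forall>h\<in>topspace (powertop_complex T).
      (\<lambda>z. f (\<lambda>t\<in>T. x t + z * h t)) field_differentiable at 0)"

text \<open>A function on \<open>U\<close> is represented by its extension that is \<^const>\<open>undefined\<close> outside \<open>U\<close>.
  In the polynomial, \<open>None\<close> is the variable for the function value and \<open>Some t\<close> the coordinate
  with index \<open>t\<close>.\<close>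

definition nash_functions ::
    "'t set \<Rightarrow> ('t \<Rightarrow> complex) set \<Rightarrow> (('t \<Rightarrow> complex) \<Rightarrow> complex) set"
  where "nash_functions T U =
    {f \<in> extensional U. power_holomorphic_on f T U \<and>
      (\<exists>P::'t option qpoly. P \<noteq> 0 \<and> qpoly_vars P \<subseteq> insert None (Some ` T) \<and>
        (\<forall>x\<in>U. qpoly_eval P (case_option (f x) x) = 0))}"

type_synonym 't local_fun = "('t \<Rightarrow> complex) set \<times> (('t \<Rightarrow> complex) \<Rightarrow> complex)"

definition nash_rel ::
    "'t set \<Rightarrow> ('t \<Rightarrow> complex) set set \<Rightarrow> ('t local_fun \<times> 't local_fun) set"
  where "nash_rel T \<Omega> =
    {((U1, f1), (U2, f2)). U1 \<in> \<Omega> \<and> f1 \<in> nash_functions T U1 \<and>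
      U2 \<in> \<Omega> \<and> f2 \<in> nash_functions T U2 \<and>
      (\<exists>U3\<in>\<Omega>. U3 \<subseteq> U1 \<inter> U2 \<and> (\<forall>x\<in>U3. f1 x = f2 x))}"

definition nash_germ ::
    "'t set \<Rightarrow> ('t \<Rightarrow> complex) set set \<Rightarrow> ('t \<Rightarrow> complex) set \<Rightarrow>
      (('t \<Rightarrow> complex) \<Rightarrow> complex) \<Rightarrow> 't local_fun set"
  where "nash_germ T \<Omega> U f = nash_rel T \<Omega> `` {(U, restrict f U)}"

text \<open>Operations on germs are unions over all representatives; all members of such a union
  are the same class.\<close>

definition nash_lift2 ::
    "(complex \<Rightarrow> complex \<Rightarrow> complex) \<Rightarrow> 't set \<Rightarrow> ('t \<Rightarrow> complex) set set \<Rightarrow>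
      't local_fun set \<Rightarrow> 't local_fun set \<Rightarrow> 't local_fun set"
  where "nash_lift2 op T \<Omega> \<xi> \<eta> =
    (\<Union>(U1, f1)\<in>\<xi>. \<Union>(U2, f2)\<in>\<eta>. \<Union>U3\<in>{U3 \<in> \<Omega>. U3 \<subseteq> U1 \<inter> U2}.
      nash_germ T \<Omega> U3 (\<lambda>x. op (f1 x) (f2 x)))"

definition nash_field :: "'t set \<Rightarrow> ('t \<Rightarrow> complex) set set \<Rightarrow> 't local_fun set ring"
  where "nash_field T \<Omega> =
    \<lparr>carrier = (SIGMA U:\<Omega>. nash_functions T U) // nash_rel T \<Omega>,
     monoid.mult = nash_lift2 (*) T \<Omega>,
     monoid.one = (\<Union>U\<in>\<Omega>. nash_germ T \<Omega> U (\<lambda>_. 1)),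
     ring.zero = (\<Union>U\<in>\<Omega>. nash_germ T \<Omega> U (\<lambda>_. 0)),
     ring.add = nash_lift2 (+) T \<Omega>\<rparr>"

definition nash_partial ::
    "'t set \<Rightarrow> ('t \<Rightarrow> complex) set set \<Rightarrow> 't \<Rightarrow> 't local_fun set \<Rightarrow> 't local_fun set"
  where "nash_partial T \<Omega> t \<xi> =
    (\<Union>(U, f)\<in>\<xi>. nash_germ T \<Omega> U (\<lambda>x. deriv (\<lambda>z. f (x(t := z))) (x t)))"

text \<open>\<^const>\<open>gfinprod\<close> over the additive monoid is the sum over the indices with nonzero term;
  \<^const>\<open>finsum\<close> over an infinite \<open>T\<close> would be zero by convention.\<close>

definition nash_derivation ::
    "'t set \<Rightarrow> ('t \<Rightarrow> complex) set set \<Rightarrow> ('t \<Rightarrow> 't local_fun set) \<Rightarrow>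
      't local_fun set \<Rightarrow> 't local_fun set"
  where "nash_derivation T \<Omega> g f =
    gfinprod (add_monoid (nash_field T \<Omega>))
      (\<lambda>t. g t \<otimes>\<^bsub>nash_field T \<Omega>\<^esub> nash_partial T \<Omega> t f) T"

end

theory Submission
  imports Defs
    "HOL-Computational_Algebra.Fundamental_Theorem_Algebra"
    "HOL-Analysis.Finite_Function_Topology"
begin

text \<open>Take for \<open>T\<close> a transcendence basis of \<open>K\<close>; it is infinite because a
  differentially closed field contains an element \<open>x\<close> with derivative 1, and nonzero solutions
  \<open>y\<^sub>n\<close> of \<open>\<delta> y = x\<^sup>n y\<close> for all \<open>n\<close> are
  algebraically independent. Both \<open>K\<close> and the field of Nash functions are algebraically closed:
  a polynomial over the latter can be made separable, and on a simply connected set between two members of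
  the filter that avoids its discriminant its roots are holomorphic functions. As the field of Nash
  functions is algebraic over the polynomials in the independent coordinates, matching \<open>t \<in>
  T\<close> with \<open>\<Lambda>\<^sub>t\<close> extends to a field isomorphism \<open>\<phi>\<close>. With
  \<open>g\<^sub>t = \<phi> (\<delta> t)\<close>, the derivation \<open>\<delta>\<^sub>g\<close> and the
  transport of \<open>\<delta>\<close> along \<open>\<phi>\<close> agree on all
  \<open>\<Lambda>\<^sub>t\<close>; in characteristic zero a derivation is determined by its values on a
  transcendence basis, so they are equal.\<close>

section \<open>Integer polynomials in many variables\<close>

text \<open>\<open>T\<close> is found inside \<open>K\<close> alone, so that one choice serves every
  c-filter. Coefficients are integers because integer polynomials can be evaluated in any
  commutative ring; characteristic zero makes the passage from rational coefficients harmless.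
  Functions on a member of the filter form a ring with zero divisors, so sums and products of
  algebraic functions cannot be treated by counting dimensions over the rational functions; instead
  there is linear algebra over integer polynomials in which denominators are collected and never
  inverted. No discriminant is computed either. A monic polynomial over the Nash functions is split
  by induction on the degree, after its derivative: either a root of the derivative is also a root
  of the polynomial, or on a smaller member of the filter the polynomial is separable at every
  point. Such a dichotomy is always available because a Nash function vanishes identically or
  nowhere on a small enough member. The isomorphism is built as a subring of the product of both
  fields, a symmetric object that can be extended from either side.\<close>

type_synonym 'v ipoly = "'v multiset \<Rightarrow>\<^sub>0 int"

abbreviation "isingle \<equiv> Poly_Mapping.single"
abbreviation "icoeff \<equiv> Poly_Mapping.lookup"

definition ipoly_vars :: "'v ipoly \<Rightarrow> 'v set"
  where "ipoly_vars P = (\<Union>m\<in>Poly_Mapping.keys P. set_mset m)"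

definition ipoly_eval :: "'v ipoly \<Rightarrow> ('v \<Rightarrow> 'c::comm_ring_1) \<Rightarrow> 'c"
  where "ipoly_eval P x = (\<Sum>m\<in>Poly_Mapping.keys P. of_int (icoeff P m) * (\<Prod>v\<in>#m. x v))"

lemma poly_mapping_sum_singles:
  "P = (\<Sum>m\<in>Poly_Mapping.keys P. isingle m (icoeff P m))"
proof (rule poly_mapping_eqI)
  fix k
  have "icoeff (\<Sum>m\<in>Poly_Mapping.keys P. isingle m (icoeff P m)) k =
      (\<Sum>m\<in>Poly_Mapping.keys P. if m = k then icoeff P m else 0)"
    by (simp add: lookup_sum lookup_single when_def)
  also have "\<dots> = icoeff P k"
    by (simp add: in_keys_iff)
  finally show "icoeff P k = icoeff (\<Sum>m\<in>Poly_Mapping.keys P. isingle m (icoeff P m)) k" ..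
qed

text \<open>Evaluation is additive in the polynomial, so this induction reduces its identities to
  single monomials.\<close>

lemma poly_mapping_single_induct [case_names zero single add]:
  fixes P :: "'k \<Rightarrow>\<^sub>0 'c::comm_monoid_add"
  assumes "Q 0" "\<And>m c. Q (isingle m c)" "\<And>P P'. Q P \<Longrightarrow> Q P' \<Longrightarrow> Q (P + P')"
  shows "Q P"
proof -
  have "Q (\<Sum>m\<in>A. isingle m (icoeff P m))" if "finite A" for A
    using that by (induct A) (auto intro: assms)
  then show ?thesis
    by (metis finite_keys poly_mapping_sum_singles)
qed

lemma finite_ipoly_vars [simp]: "finite (ipoly_vars P)"
  by (simp add: ipoly_vars_def)

lemma ipoly_vars_zero [simp]: "ipoly_vars 0 = {}"
  by (simp add: ipoly_vars_def)

lemma ipoly_vars_single: "ipoly_vars (isingle m c) \<subseteq> set_mset m"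
  by (simp add: ipoly_vars_def)

lemma ipoly_vars_add: "ipoly_vars (P + Q) \<subseteq> ipoly_vars P \<union> ipoly_vars Q"
  using Poly_Mapping.keys_add[of P Q] by (auto simp: ipoly_vars_def)

lemma ipoly_vars_uminus [simp]: "ipoly_vars (- P) = ipoly_vars P"
  by (simp add: ipoly_vars_def)

lemma ipoly_vars_mult: "ipoly_vars (P * Q) \<subseteq> ipoly_vars P \<union> ipoly_vars Q"
  using keys_mult[of P Q] by (fastforce simp: ipoly_vars_def)

lemma ipoly_vars_sum: "finite A \<Longrightarrow> ipoly_vars (sum F A) \<subseteq> (\<Union>i\<in>A. ipoly_vars (F i))"
proof (induct A rule: finite_induct)
  case (insert a A)
  then show ?case using ipoly_vars_add[of "F a" "sum F A"] by auto
qed auto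

lemma ipoly_eval_superset:
  assumes "finite A" "Poly_Mapping.keys P \<subseteq> A"
  shows "ipoly_eval P x = (\<Sum>m\<in>A. of_int (icoeff P m) * (\<Prod>v\<in>#m. x v))"
  unfolding ipoly_eval_def using assms
  by (intro sum.mono_neutral_left) (auto simp: in_keys_iff)

lemma ipoly_eval_zero [simp]: "ipoly_eval 0 x = 0"
  by (simp add: ipoly_eval_def)

lemma ipoly_eval_single [simp]: "ipoly_eval (isingle m c) x = of_int c * (\<Prod>v\<in>#m. x v)"
  by (simp add: ipoly_eval_superset[of "{m}"])

lemma ipoly_eval_add [simp]: "ipoly_eval (P + Q) x = ipoly_eval P x + ipoly_eval Q x"
proof -
  let ?A = "Poly_Mapping.keys P \<union> Poly_Mapping.keys Q"
  have "ipoly_eval F x = (\<Sum>m\<in>?A. of_int (icoeff F m) * (\<Prod>v\<in>#m. x v))"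
    if "F \<in> {P, Q, P + Q}" for F
    using that Poly_Mapping.keys_add[of P Q] by (intro ipoly_eval_superset) auto
  then show ?thesis
    by (simp add: lookup_add algebra_simps sum.distrib)
qed

lemma ipoly_eval_sum: "ipoly_eval (sum F A) x = (\<Sum>i\<in>A. ipoly_eval (F i) x)"
  by (induct A rule: infinite_finite_induct) auto

lemma ipoly_eval_mult [simp]: "ipoly_eval (P * Q) x = ipoly_eval P x * ipoly_eval Q x"
proof (induct P rule: poly_mapping_single_induct)
  case (single m c)
  show ?case
    by (induct Q rule: poly_mapping_single_induct) (auto simp: mult_single algebra_simps)
qed (auto simp: algebra_simps)

lemma ipoly_eval_one [simp]: "ipoly_eval 1 x = 1"
  using ipoly_eval_single[of 0 1 x] by simp

lemma ipoly_eval_uminus [simp]: "ipoly_eval (- P) x = - ipoly_eval P x"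
  by (metis ab_left_minus add_eq_0_iff ipoly_eval_add ipoly_eval_zero)

lemma ipoly_eval_cong:
  assumes "\<And>v. v \<in> ipoly_vars P \<Longrightarrow> x v = y v"
  shows "ipoly_eval P x = ipoly_eval P y"
  unfolding ipoly_eval_def using assms
  by (intro sum.cong refl arg_cong2[of _ _ _ _ "(*)"] arg_cong[of _ _ prod_mset] image_mset_cong)
    (auto simp: ipoly_vars_def)

text \<open>Collecting the monomials by their exponent in \<open>v\<close> makes \<open>P\<close>
  univariate over the other variables. Inductions on the number of variables and algebraic relations
  for a single element both start from this form.\<close>

lemma ipoly_split_at:
  fixes P :: "'v ipoly"
  shows "\<exists>n C. P = (\<Sum>i\<le>n. C i * isingle (replicate_mset i v) 1) \<and>
    (\<forall>i. ipoly_vars (C i) \<subseteq> ipoly_vars P - {v})"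
proof -
  \<comment> \<open>A crude degree bound, the sum of all exponents of \<open>v\<close>; it avoids a
    maximum over a possibly empty set.\<close>
  define n where "n = (\<Sum>m\<in>Poly_Mapping.keys P. count m v)"
  define C where "C i = (\<Sum>m\<in>{m \<in> Poly_Mapping.keys P. count m v = i}.
      isingle (filter_mset (\<lambda>w. w \<noteq> v) m) (icoeff P m))" for i
  have m: "m = filter_mset (\<lambda>w. w \<noteq> v) m + replicate_mset (count m v) v" for m
    by (rule multiset_eqI) (auto simp: not_in_iff[symmetric])
  have "P = (\<Sum>m\<in>Poly_Mapping.keys P. isingle m (icoeff P m))"
    by (rule poly_mapping_sum_singles)
  also have "\<dots> = (\<Sum>i\<le>n. \<Sum>m\<in>{m \<in> Poly_Mapping.keys P. count m v = i}. isingle m (icoeff P m))"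
    by (rule sum.group[symmetric]) (auto simp: n_def intro: member_le_sum)
  also have "\<dots> = (\<Sum>i\<le>n. C i * isingle (replicate_mset i v) 1)"
  proof (rule sum.cong[OF refl])
    fix i
    have "isingle m (icoeff P m) = isingle (filter_mset (\<lambda>w. w \<noteq> v) m) (icoeff P m) * isingle (replicate_mset i v) 1"
      if "count m v = i" for m
      using m[of m] that by (simp add: mult_single)
    then show "(\<Sum>m\<in>{m \<in> Poly_Mapping.keys P. count m v = i}. isingle m (icoeff P m)) =
        C i * isingle (replicate_mset i v) 1"
      unfolding C_def sum_distrib_right by (intro sum.cong) auto
  qed
  finally have "P = (\<Sum>i\<le>n. C i * isingle (replicate_mset i v) 1)" .
  moreover have "ipoly_vars (C i) \<subseteq> ipoly_vars P - {v}" for i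
  proof -
    have "ipoly_vars (C i) \<subseteq> (\<Union>m\<in>{m \<in> Poly_Mapping.keys P. count m v = i}.
        ipoly_vars (isingle (filter_mset (\<lambda>w. w \<noteq> v) m) (icoeff P m)))"
      unfolding C_def by (rule ipoly_vars_sum) auto
    also have "\<dots> \<subseteq> (\<Union>m\<in>Poly_Mapping.keys P. set_mset (filter_mset (\<lambda>w. w \<noteq> v) m))"
      using ipoly_vars_single by fastforce
    also have "\<dots> \<subseteq> ipoly_vars P - {v}" by (auto simp: ipoly_vars_def)
    finally show ?thesis .
  qed
  ultimately show ?thesis by blast
qed

lemma nonzero_polynomial_point:
  fixes a :: "nat \<Rightarrow> complex"
  assumes "i \<le> n" "a i \<noteq> 0"
  shows "\<exists>w. (\<Sum>i\<le>n. a i * w ^ i) \<noteq> 0"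
proof -
  have "finite {w. (\<Sum>i\<le>n. a i * w ^ i) = 0}"
    using assms by (intro polyfun_rootbound_finite) auto
  then show ?thesis
    using infinite_UNIV_char_0[where 'a=complex] by (metis (mono_tags, lifting) UNIV_eq_I mem_Collect_eq)
qed

text \<open>By induction on the number of variables some coefficient with respect to
  \<open>v\<close> is nonzero at a point, and then only finitely many values of \<open>v\<close> are
  roots. The lemma lets identities of polynomials be tested on complex points.\<close>

lemma ipoly_nonzero_point:
  fixes P :: "'v ipoly"
  assumes "P \<noteq> 0"
  shows "\<exists>x::'v \<Rightarrow> complex. ipoly_eval P x \<noteq> 0"
  using assms
proof (induct "card (ipoly_vars P)" arbitrary: P rule: less_induct)
  case less
  show ?case
  proof (cases "ipoly_vars P = {}")
    case True
    then have "Poly_Mapping.keys P \<subseteq> {{#}}" by (auto simp: ipoly_vars_def)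
    then have "ipoly_eval P (\<lambda>_. 0) = (of_int (icoeff P {#}) :: complex)"
      by (subst ipoly_eval_superset[of "{{#}}"]) auto
    moreover have "icoeff P {#} \<noteq> 0"
      using \<open>Poly_Mapping.keys P \<subseteq> {{#}}\<close> less.prems
      by (metis keys_eq_empty lookup_not_eq_zero_eq_in_keys subset_singletonD insertI1)
    ultimately show ?thesis by (metis of_int_eq_0_iff)
  next
    case False
    then obtain v where v: "v \<in> ipoly_vars P" by blast
    obtain n C where P: "P = (\<Sum>i\<le>n. C i * isingle (replicate_mset i v) 1)"
      and C: "\<And>i. ipoly_vars (C i) \<subseteq> ipoly_vars P - {v}"
      using ipoly_split_at[of P v] by blast
    obtain i where i: "i \<le> n" "C i \<noteq> 0"
      using less.prems P by (metis (no_types, lifting) atMost_iff mult_zero_left sum.neutral)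
    have "card (ipoly_vars (C i)) < card (ipoly_vars P)"
      using C[of i] v by (intro psubset_card_mono) auto
    then obtain x :: "'v \<Rightarrow> complex" where x: "ipoly_eval (C i) x \<noteq> 0"
      using less.hyps i by blast
    obtain w where w: "(\<Sum>i\<le>n. ipoly_eval (C i) x * w ^ i) \<noteq> 0"
      using nonzero_polynomial_point[of i n "\<lambda>i. ipoly_eval (C i) x"] i x by blast
    have "ipoly_eval (C j) (x(v := w)) = ipoly_eval (C j) x" for j
      by (rule ipoly_eval_cong) (use C[of j] in auto)
    then have "ipoly_eval P (x(v := w)) = (\<Sum>i\<le>n. ipoly_eval (C i) x * w ^ i)"
      unfolding P by (simp add: ipoly_eval_sum)
    then show ?thesis using w by metis
  qed
qed

text \<open>On the complex line from a point where \<open>P\<close> is nonzero to one where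
  \<open>Q\<close> is nonzero, both factors become nonzero univariate polynomials, and so does their
  product.\<close>

lemma ipoly_no_zero_divisors:
  fixes P Q :: "'v ipoly"
  assumes "P * Q = 0"
  shows "P = 0 \<or> Q = 0"
proof (rule ccontr)
  assume "\<not> ?thesis"
  then have "P \<noteq> 0" "Q \<noteq> 0" by auto
  then obtain x y :: "'v \<Rightarrow> complex" where xy: "ipoly_eval P x \<noteq> 0" "ipoly_eval Q y \<noteq> 0"
    using ipoly_nonzero_point by metis
  define l where "l z = (\<lambda>v. x v + z * (y v - x v))" for z
  have pol: "\<exists>p. \<forall>z. poly p z = ipoly_eval F (l z)" for F
  proof (induct F rule: poly_mapping_single_induct)
    case (single m c)
    have "\<exists>p. \<forall>z. poly p z = (\<Prod>v\<in>#m. l z v)"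
    proof (induct m)
      case (add v m)
      then obtain p where "\<forall>z. poly p z = (\<Prod>v\<in>#m. l z v)" by blast
      then have "\<forall>z. poly ([:x v, y v - x v:] * p) z = (\<Prod>v\<in>#add_mset v m. l z v)"
        by (simp add: l_def algebra_simps)
      then show ?case by blast
    qed (auto intro!: exI[of _ 1])
    then obtain p where "\<forall>z. poly p z = (\<Prod>v\<in>#m. l z v)" by blast
    then show ?case by (intro exI[of _ "Polynomial.smult (of_int c) p"]) simp
  next
    case (add F G)
    then obtain p q where "\<forall>z. poly p z = ipoly_eval F (l z)" "\<forall>z. poly q z = ipoly_eval G (l z)"
      by blast
    then show ?case by (intro exI[of _ "p + q"]) simp
  qed (auto intro!: exI[of _ 0])
  obtain p q where p: "\<And>z. poly p z = ipoly_eval P (l z)" and q: "\<And>z. poly q z = ipoly_eval Q (l z)"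
    using pol by metis
  have "poly p 0 \<noteq> 0" "poly q 1 \<noteq> 0" using xy by (auto simp: p q l_def)
  then have "p * q \<noteq> 0" by auto
  then obtain z where "poly (p * q) z \<noteq> 0" using poly_all_0_iff_0 by blast
  then show False using assms by (metis p q ipoly_eval_mult ipoly_eval_zero poly_mult)
qed

section \<open>Renaming of variables and passage between rational and integer coefficients\<close>

definition ipoly_rename :: "('v \<Rightarrow> 'w) \<Rightarrow> 'v ipoly \<Rightarrow> 'w ipoly"
  where "ipoly_rename f P = (\<Sum>m\<in>Poly_Mapping.keys P. isingle (image_mset f m) (icoeff P m))"

lemma ipoly_eval_rename [simp]: "ipoly_eval (ipoly_rename f P) x = ipoly_eval P (x \<circ> f)"
  by (simp add: ipoly_rename_def ipoly_eval_sum ipoly_eval_def[of P] image_mset.compositionality o_def)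

lemma ipoly_vars_rename: "ipoly_vars (ipoly_rename f P) \<subseteq> f ` ipoly_vars P"
proof -
  have "ipoly_vars (ipoly_rename f P) \<subseteq> (\<Union>m\<in>Poly_Mapping.keys P. ipoly_vars (isingle (image_mset f m) (icoeff P m)))"
    unfolding ipoly_rename_def by (rule ipoly_vars_sum) auto
  also have "\<dots> \<subseteq> (\<Union>m\<in>Poly_Mapping.keys P. set_mset (image_mset f m))"
    using ipoly_vars_single by fast
  finally show ?thesis by (simp add: ipoly_vars_def[of P] image_UN)
qed

lemma common_denominator:
  assumes "finite (A :: rat set)"
  shows "\<exists>d::int. d > 0 \<and> (\<forall>r\<in>A. of_int d * r \<in> \<int>)"
  using assms
proof (induct A rule: finite_induct)
  case (insert r A)
  then obtain d where d: "d > 0" "\<And>s. s \<in> A \<Longrightarrow> of_int d * s \<in> \<int>" by auto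
  obtain a b where r: "r = Fract a b" "b > 0" by (cases r) auto
  have "of_int b * r = of_int a" using r by (simp add: Fract_of_int_quotient)
  then have "of_int (b * d) * r \<in> \<int>"
    by (metis Ints_mult Ints_of_int mult.assoc mult.commute of_int_mult)
  moreover have "of_int (b * d) * s \<in> \<int>" if "s \<in> A" for s
    using d(2)[OF that] by (metis Ints_mult Ints_of_int mult.assoc of_int_mult)
  ultimately show ?case using d r by (intro exI[of _ "b * d"]) auto
qed (auto intro: exI[of _ 1])

text \<open>Multiplication by a common denominator \<open>d\<close> changes neither the zeros nor
  the set of monomials.\<close>

lemma qpoly_clear_denominators:
  fixes P :: "'v qpoly"
  shows "\<exists>d Q. d \<noteq> 0 \<and> Poly_Mapping.keys Q = Poly_Mapping.keys P \<and>
    (\<forall>x::'v \<Rightarrow> 'c::field_char_0. ipoly_eval Q x = of_int d * qpoly_eval P x)"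
proof -
  obtain d :: int where d: "d > 0" "\<And>m. of_int d * icoeff P m \<in> \<int>"
  proof -
    obtain d :: int where "d > 0" "\<forall>r\<in>icoeff P ` Poly_Mapping.keys P. of_int d * r \<in> \<int>"
      using common_denominator by (metis finite_imageI finite_keys)
    then have "of_int d * icoeff P m \<in> \<int>" for m
      by (cases "m \<in> Poly_Mapping.keys P") (auto simp: in_keys_iff)
    then show ?thesis using that \<open>d > 0\<close> by blast
  qed
  \<comment> \<open>The floor acts only as the inverse of the embedding of the integers: by the
    choice of \<open>d\<close> its argument is an integer.\<close>
  define Q where "Q = Abs_poly_mapping (\<lambda>m. \<lfloor>of_int d * icoeff P m\<rfloor>)"
  have "finite {m. \<lfloor>of_int d * icoeff P m\<rfloor> \<noteq> 0}"
    by (rule finite_subset[of _ "Poly_Mapping.keys P"]) (auto simp: in_keys_iff)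
  then have Q: "icoeff Q m = \<lfloor>of_int d * icoeff P m\<rfloor>" for m
    by (simp add: Q_def)
  have Q': "of_int (icoeff Q m) = of_int d * icoeff P m" for m
    using d(2)[of m] by (metis Q Ints_cases floor_of_int)
  have keys: "Poly_Mapping.keys Q = Poly_Mapping.keys P"
    using Q' d(1) by (auto simp: in_keys_iff) (metis mult_eq_0_iff of_int_0 of_int_0_eq_iff less_irrefl)+
  have "of_int (icoeff Q m) = of_int d * (of_rat (icoeff P m) :: 'c)" for m
    by (metis Q' of_rat_mult of_rat_of_int_eq)
  then have "ipoly_eval Q x = of_int d * qpoly_eval P x" for x :: "'v \<Rightarrow> 'c"
    unfolding ipoly_eval_def qpoly_eval_def keys sum_distrib_left by (simp add: mult.assoc)
  then show ?thesis using d keys by (intro exI[of _ d] exI[of _ Q]) auto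
qed

lemma qpoly_of_ipoly:
  fixes P :: "'v ipoly"
  shows "\<exists>Q::'v qpoly. Poly_Mapping.keys Q = Poly_Mapping.keys P \<and>
    (\<forall>x::'v \<Rightarrow> 'c::field_char_0. qpoly_eval Q x = ipoly_eval P x)"
proof -
  define Q :: "'v qpoly" where "Q = Abs_poly_mapping (\<lambda>m. of_int (icoeff P m))"
  have "finite {m. of_int (icoeff P m) \<noteq> (0::rat)}"
    by (rule finite_subset[of _ "Poly_Mapping.keys P"]) (auto simp: in_keys_iff)
  then have Q: "icoeff Q m = of_int (icoeff P m)" for m
    by (simp add: Q_def)
  have keys: "Poly_Mapping.keys Q = Poly_Mapping.keys P"
    by (auto simp: in_keys_iff Q)
  then show ?thesis
    by (intro exI[of _ Q]) (simp add: qpoly_eval_def ipoly_eval_def Q)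
qed

text \<open>Sorting by powers of \<open>None\<close>, the variable for the function value, turns the
  polynomial in the definition of Nash functions into a univariate relation over the coordinate
  polynomials.\<close>

lemma qpoly_relation_to_ipoly:
  fixes P :: "'t option qpoly"
  assumes P: "P \<noteq> 0" "qpoly_vars P \<subseteq> insert None (Some ` T)"
  shows "\<exists>n C. (\<forall>i. ipoly_vars (C i) \<subseteq> T) \<and> (\<exists>i\<le>n. C i \<noteq> 0) \<and>
    (\<forall>x (w::complex). qpoly_eval P (case_option w x) = 0 \<longrightarrow>
      (\<Sum>i\<le>n. ipoly_eval (C i) x * w ^ i) = 0)"
proof -
  obtain d Q where d: "d \<noteq> 0" and Qk: "Poly_Mapping.keys Q = Poly_Mapping.keys P"
    and Q: "\<And>x::'t option \<Rightarrow> complex. ipoly_eval Q x = of_int d * qpoly_eval P x"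
    using qpoly_clear_denominators[of P, where 'c=complex] by blast
  have "Q \<noteq> 0" using P(1) Qk by (metis keys_eq_empty)
  have Qv: "ipoly_vars Q \<subseteq> insert None (Some ` T)"
    using P(2) Qk by (simp add: ipoly_vars_def qpoly_vars_def)
  obtain n C where QC: "Q = (\<Sum>i\<le>n. C i * isingle (replicate_mset i None) 1)"
    and C: "\<And>i. ipoly_vars (C i) \<subseteq> ipoly_vars Q - {None}"
    using ipoly_split_at[of Q None] by blast
  have Cv: "ipoly_vars (C i) \<subseteq> Some ` T" for i using C[of i] Qv by auto
  obtain i where i: "i \<le> n" "C i \<noteq> 0"
    using \<open>Q \<noteq> 0\<close> QC by (metis (no_types, lifting) atMost_iff mult_zero_left sum.neutral)
  \<comment> \<open>\<open>the\<close> removes the constructor \<open>Some\<close> again; it is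
    harmless because \<open>None\<close> does not occur in the coefficients.\<close>
  have ren: "ipoly_eval (ipoly_rename the (C j)) (x \<circ> Some) = ipoly_eval (C j) x" for j and x :: "_ \<Rightarrow> complex"
    unfolding ipoly_eval_rename by (rule ipoly_eval_cong) (use Cv[of j] in auto)
  have "ipoly_rename the (C i) \<noteq> 0"
    using ipoly_nonzero_point[OF i(2)] ren[of i] by (metis ipoly_eval_zero)
  moreover have "ipoly_vars (ipoly_rename the (C j)) \<subseteq> T" for j
    using ipoly_vars_rename[of the "C j"] Cv[of j] by fastforce
  moreover have "(\<Sum>i\<le>n. ipoly_eval (ipoly_rename the (C i)) x * w ^ i) = 0"
    if "qpoly_eval P (case_option w x) = 0" for x and w :: complex
  proof -
    have "case_option w x \<circ> Some = x" by auto
    then have "ipoly_eval (ipoly_rename the (C i)) x = ipoly_eval (C i) (case_option w x)" for i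
      using ren[of i "case_option w x"] by simp
    then have "(\<Sum>i\<le>n. ipoly_eval (ipoly_rename the (C i)) x * w ^ i) = ipoly_eval Q (case_option w x)"
      unfolding QC by (simp add: ipoly_eval_sum)
    then show ?thesis using Q that by simp
  qed
  ultimately show ?thesis
    using i(1) by (intro exI[of _ n] exI[of _ "\<lambda>i. ipoly_rename the (C i)"]) auto
qed

lemma ipoly_relation_to_qpoly:
  fixes C :: "nat \<Rightarrow> 't ipoly"
  assumes C: "\<And>i. ipoly_vars (C i) \<subseteq> T" "i \<le> n" "C i \<noteq> 0"
  shows "\<exists>P::'t option qpoly. P \<noteq> 0 \<and> qpoly_vars P \<subseteq> insert None (Some ` T) \<and>
    (\<forall>x (w::complex). qpoly_eval P (case_option w x) = (\<Sum>i\<le>n. ipoly_eval (C i) x * w ^ i))"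
proof -
  define Q where "Q = (\<Sum>i\<le>n. ipoly_rename Some (C i) * isingle (replicate_mset i None) 1)"
  have ev: "ipoly_eval Q (case_option w x) = (\<Sum>i\<le>n. ipoly_eval (C i) x * w ^ i)" for x and w :: complex
  proof -
    have "case_option w x \<circ> Some = x" by auto
    then show ?thesis by (simp add: Q_def ipoly_eval_sum)
  qed
  \<comment> \<open>That \<open>Q\<close> is nonzero is read off from a value: a point at which one
    coefficient is nonzero, then a \<open>w\<close> that is not a root of the resulting
    polynomial.\<close>
  obtain x :: "'t \<Rightarrow> complex" where "ipoly_eval (C i) x \<noteq> 0"
    using ipoly_nonzero_point C by blast
  then obtain w where "(\<Sum>i\<le>n. ipoly_eval (C i) x * w ^ i) \<noteq> 0"
    using nonzero_polynomial_point[of i n "\<lambda>i. ipoly_eval (C i) x"] C by blast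
  then have "Q \<noteq> 0" using ev[of w x] by auto
  have Qv: "ipoly_vars Q \<subseteq> insert None (Some ` T)"
  proof -
    have "ipoly_vars (ipoly_rename Some (C i) * isingle (replicate_mset i None) 1) \<subseteq> insert None (Some ` T)" for i
    proof -
      have "ipoly_vars (ipoly_rename Some (C i)) \<subseteq> Some ` T"
        using ipoly_vars_rename[of Some "C i"] C(1)[of i] by blast
      moreover have "ipoly_vars (isingle (replicate_mset i None) (1::int)) \<subseteq> {None::'t option}"
        using ipoly_vars_single[of "replicate_mset i (None::'t option)" 1] by (auto split: if_splits)
      ultimately show ?thesis
        using ipoly_vars_mult[of "ipoly_rename Some (C i)" "isingle (replicate_mset i None) 1"] by auto
    qed
    then have "(\<Union>i\<in>{..n}. ipoly_vars (ipoly_rename Some (C i) * isingle (replicate_mset i None) 1)) \<subseteq>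
        insert None (Some ` T)"
      by (rule UN_least)
    then show ?thesis
      unfolding Q_def by (rule order_trans[OF ipoly_vars_sum, rotated]) simp
  qed
  obtain P :: "'t option qpoly" where P: "Poly_Mapping.keys P = Poly_Mapping.keys Q"
    "\<And>x::'t option \<Rightarrow> complex. qpoly_eval P x = ipoly_eval Q x"
    using qpoly_of_ipoly[of Q, where 'c=complex] by blast
  have "P \<noteq> 0" using \<open>Q \<noteq> 0\<close> P by (metis keys_eq_empty)
  then show ?thesis using Qv P ev
    by (intro exI[of _ P]) (auto simp: qpoly_vars_def ipoly_vars_def)
qed

section \<open>Extending a partial isomorphism of algebraically closed fields\<close>

text \<open>Algebraic closedness, with polynomials given as coefficient sequences so that no
  polynomial ring has to be attached to the field.\<close>

definition has_roots :: "('a, 'm) ring_scheme \<Rightarrow> bool"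
  where "has_roots R \<longleftrightarrow> (\<forall>(n::nat) c. 0 < n \<and> c \<in> {..n} \<rightarrow> carrier R \<and> c n \<noteq> \<zero>\<^bsub>R\<^esub> \<longrightarrow>
    (\<exists>b\<in>carrier R. (\<Oplus>\<^bsub>R\<^esub>i\<in>{..n}. c i \<otimes>\<^bsub>R\<^esub> b [^]\<^bsub>R\<^esub> i) = \<zero>\<^bsub>R\<^esub>))"

text \<open>\<open>A\<close> will be a subring: algebraicity over its field of fractions, expressed
  after clearing denominators.\<close>

definition algebraic_over :: "('a, 'm) ring_scheme \<Rightarrow> 'a set \<Rightarrow> 'a \<Rightarrow> bool"
  where "algebraic_over R A a \<longleftrightarrow> (\<exists>(n::nat) c. c \<in> {..n} \<rightarrow> A \<and> (\<exists>i\<le>n. c i \<noteq> \<zero>\<^bsub>R\<^esub>) \<and>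
    (\<Oplus>\<^bsub>R\<^esub>i\<in>{..n}. c i \<otimes>\<^bsub>R\<^esub> a [^]\<^bsub>R\<^esub> i) = \<zero>\<^bsub>R\<^esub>)"

text \<open>Pseudo-division: over a domain, \<open>f\<close> can be divided by \<open>g\<close>
  after scaling with a power of the leading coefficient of \<open>g\<close>. The remainder lies in
  the kernel of \<open>h\<close> and has smaller degree than \<open>g\<close>, hence is
  zero.\<close>

lemma (in UP_domain) divide_by_minimal:
  assumes "ring_hom_ring P S h"
    and g: "g \<in> carrier P" "g \<noteq> \<zero>\<^bsub>P\<^esub>" "h g = \<zero>\<^bsub>S\<^esub>"
    and min: "\<And>r. r \<in> carrier P \<Longrightarrow> r \<noteq> \<zero>\<^bsub>P\<^esub> \<Longrightarrow> h r = \<zero>\<^bsub>S\<^esub> \<Longrightarrow> deg R g \<le> deg R r"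
    and f: "f \<in> carrier P" "h f = \<zero>\<^bsub>S\<^esub>"
  shows "\<exists>s\<in>carrier P. \<exists>c\<in>carrier R. c \<noteq> \<zero> \<and> c \<odot>\<^bsub>P\<^esub> f = g \<otimes>\<^bsub>P\<^esub> s"
proof -
  interpret h: ring_hom_ring P S h by fact
  obtain s r k where sr: "s \<in> carrier P" "r \<in> carrier P"
    "(up_ring.coeff P g (deg R g)) [^] (k::nat) \<odot>\<^bsub>P\<^esub> f = g \<otimes>\<^bsub>P\<^esub> s \<oplus>\<^bsub>P\<^esub> r"
    "r = \<zero>\<^bsub>P\<^esub> \<or> deg R r < deg R g"
    using long_div_theorem[OF g(1) f(1) g(2)] by blast
  let ?c = "(up_ring.coeff P g (deg R g)) [^] k"
  have lc: "up_ring.coeff P g (deg R g) \<in> carrier R" "up_ring.coeff P g (deg R g) \<noteq> \<zero>"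
    using g lcoeff_nonzero by auto
  have c: "?c \<in> carrier R" "?c \<noteq> \<zero>"
    using lc by (auto simp: R.nat_pow_closed) (induct k; auto simp: R.integral_iff)
  have "h (?c \<odot>\<^bsub>P\<^esub> f) = h (up_ring.monom P ?c 0 \<otimes>\<^bsub>P\<^esub> f)"
    using monom_mult_is_smult c f by simp
  also have "\<dots> = \<zero>\<^bsub>S\<^esub>" using c f by simp
  finally have "h (g \<otimes>\<^bsub>P\<^esub> s \<oplus>\<^bsub>P\<^esub> r) = \<zero>\<^bsub>S\<^esub>" using sr by simp
  then have "h r = \<zero>\<^bsub>S\<^esub>" using sr g by simp
  then have "r = \<zero>\<^bsub>P\<^esub>" using min sr by (metis leD)
  then show ?thesis
    using sr g c by (intro bexI[of _ s] bexI[of _ ?c] conjI) simp_all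
qed

text \<open>One simple algebraic extension step, done over a domain rather than its field of
  fractions. Up to scalars the polynomials vanishing at \<open>a\<close> are the multiples of one of
  least degree; \<open>b\<close> is a root of its image in \<open>N\<close>.\<close>

lemma root_transfer:
  assumes D: "domain D" and K: "field K" and N: "field N"
    and i: "i \<in> ring_hom D K" "\<And>d. d \<in> carrier D \<Longrightarrow> i d = \<zero>\<^bsub>K\<^esub> \<Longrightarrow> d = \<zero>\<^bsub>D\<^esub>"
    and j: "j \<in> ring_hom D N" "\<And>d. d \<in> carrier D \<Longrightarrow> j d = \<zero>\<^bsub>N\<^esub> \<Longrightarrow> d = \<zero>\<^bsub>D\<^esub>"
    and roots: "has_roots N"
    and a: "a \<in> carrier K" "algebraic_over K (i ` carrier D) a"
  shows "\<exists>b\<in>carrier N. \<forall>q\<in>carrier (UP D). UnivPoly.eval D K i a q = \<zero>\<^bsub>K\<^esub> \<longleftrightarrow> UnivPoly.eval D N j b q = \<zero>\<^bsub>N\<^esub>"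
proof -
  define P where "P = UP D"
  interpret D: domain D by fact
  interpret K: field K by fact
  interpret N: field N by fact
  interpret U: UP_domain D P by unfold_locales (rule eq_reflection[OF P_def])
  have "ring_hom_cring D K i" by (intro ring_hom_cringI D.cring_axioms K.cring_axioms i)
  then interpret UK: UP_pre_univ_prop D K i P
    by (intro UP_pre_univ_prop.intro U.UP_cring_axioms) (assumption, rule eq_reflection[OF P_def])
  have "ring_hom_cring D N j" by (intro ring_hom_cringI D.cring_axioms N.cring_axioms j)
  then interpret UN: UP_pre_univ_prop D N j P
    by (intro UP_pre_univ_prop.intro U.UP_cring_axioms) (assumption, rule eq_reflection[OF P_def])
  define E where "E = UnivPoly.eval D K i a"
  have "E \<in> ring_hom P K" using UK.eval_ring_hom[OF a(1)] by (simp add: E_def P_def)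
  then interpret E: ring_hom_ring P K E
    by (intro ring_hom_ringI2 U.P.ring_axioms K.ring_axioms)
  have Ec: "E (up_ring.monom P c 0) = i c" if "c \<in> carrier D" for c
    using UK.eval_const[OF a(1) that] by (simp add: E_def P_def)
  \<comment> \<open>The relation for \<open>a\<close> has coefficients in the image of
    \<open>D\<close>; choosing preimages gives a polynomial over \<open>D\<close>, nonzero because
    \<open>i\<close> maps zero to zero.\<close>
  have "\<exists>p0. p0 \<in> carrier P \<and> p0 \<noteq> \<zero>\<^bsub>P\<^esub> \<and> E p0 = \<zero>\<^bsub>K\<^esub>"
  proof -
    obtain n c where c: "c \<in> {..n::nat} \<rightarrow> i ` carrier D" "\<exists>k\<le>n. c k \<noteq> \<zero>\<^bsub>K\<^esub>"
      "(\<Oplus>\<^bsub>K\<^esub>k\<in>{..n}. c k \<otimes>\<^bsub>K\<^esub> a [^]\<^bsub>K\<^esub> k) = \<zero>\<^bsub>K\<^esub>"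
      using a(2) unfolding algebraic_over_def by blast
    have "\<exists>d. \<forall>k\<le>n. d k \<in> carrier D \<and> c k = i (d k)"
    proof (intro choice allI)
      fix k show "\<exists>d. k \<le> n \<longrightarrow> d \<in> carrier D \<and> c k = i d"
        using c(1) by (cases "k \<le> n") (auto simp: Pi_iff)
    qed
    then obtain d where d: "\<And>k. k \<le> n \<Longrightarrow> d k \<in> carrier D" "\<And>k. k \<le> n \<Longrightarrow> c k = i (d k)" by auto
    let ?p = "\<Oplus>\<^bsub>P\<^esub>k\<in>{..n}. up_ring.monom P (d k) k"
    have cl: "(\<lambda>k. up_ring.monom P (d k) k) \<in> {..n} \<rightarrow> carrier P" using d by auto
    have "E ?p = (\<Oplus>\<^bsub>K\<^esub>k\<in>{..n}. E (up_ring.monom P (d k) k))"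
      using E.hom_finsum[OF cl] by (simp add: o_def)
    also have "\<dots> = (\<Oplus>\<^bsub>K\<^esub>k\<in>{..n}. c k \<otimes>\<^bsub>K\<^esub> a [^]\<^bsub>K\<^esub> k)"
      using d c(1) a(1) i(1) UK.eval_monom[OF _ a(1)]
      by (intro K.finsum_cong') (auto simp: E_def P_def Pi_iff ring_hom_closed)
    finally have "E ?p = \<zero>\<^bsub>K\<^esub>" using c by simp
    moreover have "?p \<noteq> \<zero>\<^bsub>P\<^esub>"
    proof
      assume 0: "?p = \<zero>\<^bsub>P\<^esub>"
      obtain k where k: "k \<le> n" "c k \<noteq> \<zero>\<^bsub>K\<^esub>" using c by blast
      have "up_ring.coeff P ?p k = (\<Oplus>\<^bsub>D\<^esub>l\<in>{..n}. up_ring.coeff P (up_ring.monom P (d l) l) k)"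
        by (rule U.coeff_finsum) (use cl in auto)
      also have "\<dots> = (\<Oplus>\<^bsub>D\<^esub>l\<in>{..n}. if k = l then d l else \<zero>\<^bsub>D\<^esub>)"
        using d by (intro D.finsum_cong') auto
      also have "\<dots> = d k"
        by (rule D.finsum_singleton) (use d k in auto)
      finally have "d k = \<zero>\<^bsub>D\<^esub>" using 0 by simp
      then show False using d k ring_hom_zero[OF i(1) D.ring_axioms K.ring_axioms] by auto
    qed
    ultimately show ?thesis using cl by (intro exI[of _ ?p]) auto
  qed
  then obtain p where p: "p \<in> carrier P \<and> p \<noteq> \<zero>\<^bsub>P\<^esub> \<and> E p = \<zero>\<^bsub>K\<^esub>" by blast
  obtain p0 where p0': "p0 \<in> carrier P \<and> p0 \<noteq> \<zero>\<^bsub>P\<^esub> \<and> E p0 = \<zero>\<^bsub>K\<^esub>"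
    "\<forall>r. r \<in> carrier P \<and> r \<noteq> \<zero>\<^bsub>P\<^esub> \<and> E r = \<zero>\<^bsub>K\<^esub> \<longrightarrow> deg D p0 \<le> deg D r"
    using exE[OF ex_has_least_nat[of "\<lambda>p. p \<in> carrier P \<and> p \<noteq> \<zero>\<^bsub>P\<^esub> \<and> E p = \<zero>\<^bsub>K\<^esub>", OF p, of "deg D"]] by (metis (no_types, lifting))
  have p0: "p0 \<in> carrier P" "p0 \<noteq> \<zero>\<^bsub>P\<^esub>" "E p0 = \<zero>\<^bsub>K\<^esub>"
    and p0min: "\<And>r. r \<in> carrier P \<Longrightarrow> r \<noteq> \<zero>\<^bsub>P\<^esub> \<Longrightarrow> E r = \<zero>\<^bsub>K\<^esub> \<Longrightarrow> deg D p0 \<le> deg D r"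
    using p0' by simp_all
  have p0deg: "0 < deg D p0"
  proof (rule ccontr)
    assume "\<not> ?thesis"
    then have m: "p0 = up_ring.monom P (up_ring.coeff P p0 0) 0" using U.deg_zero_impl_monom p0(1) by simp
    have "i (up_ring.coeff P p0 0) = E (up_ring.monom P (up_ring.coeff P p0 0) 0)"
      using Ec U.coeff_closed[OF p0(1)] by simp
    also have "\<dots> = \<zero>\<^bsub>K\<^esub>" by (simp only: m[symmetric] p0)
    finally have "i (up_ring.coeff P p0 0) = \<zero>\<^bsub>K\<^esub>" .
    then have "up_ring.coeff P p0 0 = \<zero>\<^bsub>D\<^esub>" using i p0 U.coeff_closed by blast
    then show False using m p0(2) U.monom_zero by metis
  qed
  have "(\<lambda>k. j (up_ring.coeff P p0 k)) \<in> {..deg D p0} \<rightarrow> carrier N"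
    using p0 j by (auto intro: ring_hom_closed)
  moreover have "j (up_ring.coeff P p0 (deg D p0)) \<noteq> \<zero>\<^bsub>N\<^esub>"
    using j p0 U.lcoeff_nonzero U.coeff_closed by blast
  ultimately obtain b where b: "b \<in> carrier N"
    "(\<Oplus>\<^bsub>N\<^esub>k\<in>{..deg D p0}. j (up_ring.coeff P p0 k) \<otimes>\<^bsub>N\<^esub> b [^]\<^bsub>N\<^esub> k) = \<zero>\<^bsub>N\<^esub>"
    using roots p0deg unfolding has_roots_def by (meson)
  define F where "F = UnivPoly.eval D N j b"
  have "F \<in> ring_hom P N" using UN.eval_ring_hom[OF b(1)] by (simp add: F_def P_def)
  then interpret F: ring_hom_ring P N F
    by (intro ring_hom_ringI2 U.P.ring_axioms N.ring_axioms)
  have Fc: "F (up_ring.monom P c 0) = j c" if "c \<in> carrier D" for c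
    using UN.eval_const[OF b(1) that] by (simp add: F_def P_def)
  have Fp0: "F p0 = \<zero>\<^bsub>N\<^esub>"
    using b(2) U.eval_on_carrier[OF p0(1), of N j b] by (simp add: F_def)
  have smE: "E (c \<odot>\<^bsub>P\<^esub> f) = i c \<otimes>\<^bsub>K\<^esub> E f" if "c \<in> carrier D" "f \<in> carrier P" for c f
    using U.monom_mult_is_smult[OF that] Ec that by (metis E.hom_mult U.monom_closed)
  have smF: "F (c \<odot>\<^bsub>P\<^esub> f) = j c \<otimes>\<^bsub>N\<^esub> F f" if "c \<in> carrier D" "f \<in> carrier P" for c f
    using U.monom_mult_is_smult[OF that] Fc that by (metis F.hom_mult U.monom_closed)
  \<comment> \<open>A polynomial vanishing at \<open>a\<close> is, up to a nonzero scalar, a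
    multiple of \<open>p0\<close>, and \<open>p0\<close> vanishes at \<open>b\<close>.\<close>
  have EF: "F q = \<zero>\<^bsub>N\<^esub>" if q: "q \<in> carrier P" "E q = \<zero>\<^bsub>K\<^esub>" for q
  proof -
    obtain s c where s: "s \<in> carrier P" "c \<in> carrier D" "c \<noteq> \<zero>\<^bsub>D\<^esub>" "c \<odot>\<^bsub>P\<^esub> q = p0 \<otimes>\<^bsub>P\<^esub> s"
      using U.divide_by_minimal[OF E.ring_hom_ring_axioms p0 p0min q] by blast
    have "j c \<otimes>\<^bsub>N\<^esub> F q = \<zero>\<^bsub>N\<^esub>"
      using smF[OF s(2) q(1)] s p0 Fp0 by simp
    then show ?thesis using j s q by (metis F.hom_closed N.integral ring_hom_closed)
  qed
  have p: "p0 \<in> carrier P \<and> p0 \<noteq> \<zero>\<^bsub>P\<^esub> \<and> F p0 = \<zero>\<^bsub>N\<^esub>" using p0 Fp0 by blast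
  \<comment> \<open>For the converse a polynomial of least degree among those vanishing at
    \<open>b\<close> is compared with \<open>p0\<close>.\<close>
  obtain p1 where p1': "p1 \<in> carrier P \<and> p1 \<noteq> \<zero>\<^bsub>P\<^esub> \<and> F p1 = \<zero>\<^bsub>N\<^esub>"
    "\<forall>r. r \<in> carrier P \<and> r \<noteq> \<zero>\<^bsub>P\<^esub> \<and> F r = \<zero>\<^bsub>N\<^esub> \<longrightarrow> deg D p1 \<le> deg D r"
    using exE[OF ex_has_least_nat[of "\<lambda>p. p \<in> carrier P \<and> p \<noteq> \<zero>\<^bsub>P\<^esub> \<and> F p = \<zero>\<^bsub>N\<^esub>", OF p, of "deg D"]] by (metis (no_types, lifting))
  have p1: "p1 \<in> carrier P" "p1 \<noteq> \<zero>\<^bsub>P\<^esub>" "F p1 = \<zero>\<^bsub>N\<^esub>"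
    and p1min: "\<And>r. r \<in> carrier P \<Longrightarrow> r \<noteq> \<zero>\<^bsub>P\<^esub> \<Longrightarrow> F r = \<zero>\<^bsub>N\<^esub> \<Longrightarrow> deg D p1 \<le> deg D r"
    using p1' by simp_all
  have p1deg: "0 < deg D p1"
  proof (rule ccontr)
    assume "\<not> ?thesis"
    then have m: "p1 = up_ring.monom P (up_ring.coeff P p1 0) 0" using U.deg_zero_impl_monom p1(1) by simp
    have "j (up_ring.coeff P p1 0) = F (up_ring.monom P (up_ring.coeff P p1 0) 0)"
      using Fc U.coeff_closed[OF p1(1)] by simp
    also have "\<dots> = \<zero>\<^bsub>N\<^esub>" by (simp only: m[symmetric] p1)
    finally have "j (up_ring.coeff P p1 0) = \<zero>\<^bsub>N\<^esub>" .
    then have "up_ring.coeff P p1 0 = \<zero>\<^bsub>D\<^esub>" using j p1 U.coeff_closed by blast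
    then show False using m p1(2) U.monom_zero by metis
  qed
  \<comment> \<open>Up to a scalar, \<open>p0\<close> is \<open>p1\<close> times \<open>s\<close>.
    If \<open>p1\<close> did not vanish at \<open>a\<close>, the cofactor \<open>s\<close> would,
    although its degree is smaller than that of \<open>p0\<close> because \<open>p1\<close> has
    positive degree.\<close>
  have Ep1: "E p1 = \<zero>\<^bsub>K\<^esub>"
  proof (rule ccontr)
    assume ne: "E p1 \<noteq> \<zero>\<^bsub>K\<^esub>"
    obtain s c where s: "s \<in> carrier P" "c \<in> carrier D" "c \<noteq> \<zero>\<^bsub>D\<^esub>" "c \<odot>\<^bsub>P\<^esub> p0 = p1 \<otimes>\<^bsub>P\<^esub> s"
      using U.divide_by_minimal[OF F.ring_hom_ring_axioms p1 p1min p0(1) Fp0] by blast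
    have "E p1 \<otimes>\<^bsub>K\<^esub> E s = \<zero>\<^bsub>K\<^esub>"
      using smE[OF s(2) p0(1)] s p0 p1 i by (simp add: ring_hom_closed)
    then have "E s = \<zero>\<^bsub>K\<^esub>" using ne s p1 K.integral[of "E p1" "E s"] by auto
    have d: "deg D (c \<odot>\<^bsub>P\<^esub> p0) = deg D p0" using U.deg_smult[OF s(2) p0(1)] s(3) by simp
    then have "c \<odot>\<^bsub>P\<^esub> p0 \<noteq> \<zero>\<^bsub>P\<^esub>" using p0deg by (metis U.deg_zero less_irrefl)
    then have "s \<noteq> \<zero>\<^bsub>P\<^esub>" using s p1 by auto
    then have "deg D p0 = deg D p1 + deg D s" using d s p1 by simp
    moreover have "deg D p0 \<le> deg D s" using p0min s \<open>s \<noteq> \<zero>\<^bsub>P\<^esub>\<close> \<open>E s = \<zero>\<^bsub>K\<^esub>\<close> by blast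
    ultimately show False using p1deg by simp
  qed
  have FE: "E q = \<zero>\<^bsub>K\<^esub>" if q: "q \<in> carrier P" "F q = \<zero>\<^bsub>N\<^esub>" for q
  proof -
    obtain s c where s: "s \<in> carrier P" "c \<in> carrier D" "c \<noteq> \<zero>\<^bsub>D\<^esub>" "c \<odot>\<^bsub>P\<^esub> q = p1 \<otimes>\<^bsub>P\<^esub> s"
      using U.divide_by_minimal[OF F.ring_hom_ring_axioms p1 p1min q] by blast
    have "i c \<otimes>\<^bsub>K\<^esub> E q = \<zero>\<^bsub>K\<^esub>"
      using smE[OF s(2) q(1)] s p1 Ep1 by simp
    then show ?thesis using i s q by (metis E.hom_closed K.integral ring_hom_closed)
  qed
  show ?thesis using EF FE b(1) unfolding E_def F_def P_def by blast
qed


section \<open>Partial isomorphisms as subrings of a product\<close>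

lemma RDirProd_sel:
  "(x, y) \<otimes>\<^bsub>RDirProd K N\<^esub> (x', y') = (x \<otimes>\<^bsub>K\<^esub> x', y \<otimes>\<^bsub>N\<^esub> y')"
  "(x, y) \<oplus>\<^bsub>RDirProd K N\<^esub> (x', y') = (x \<oplus>\<^bsub>K\<^esub> x', y \<oplus>\<^bsub>N\<^esub> y')"
  "\<one>\<^bsub>RDirProd K N\<^esub> = (\<one>\<^bsub>K\<^esub>, \<one>\<^bsub>N\<^esub>)"
  "\<zero>\<^bsub>RDirProd K N\<^esub> = (\<zero>\<^bsub>K\<^esub>, \<zero>\<^bsub>N\<^esub>)"
  by (simp_all add: RDirProd_def DirProd_def monoid.defs)

text \<open>A matched subring of the product is the graph of an isomorphism between a subring of \<open>K\<close> and
  a subring of \<open>N\<close>.\<close>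

definition matched :: "('a, 'm) ring_scheme \<Rightarrow> ('b, 'n) ring_scheme \<Rightarrow> ('a \<times> 'b) set \<Rightarrow> bool"
  where "matched K N G \<longleftrightarrow> subring G (RDirProd K N) \<and>
    (\<forall>x y. (x, y) \<in> G \<longrightarrow> (x = \<zero>\<^bsub>K\<^esub> \<longleftrightarrow> y = \<zero>\<^bsub>N\<^esub>))"

text \<open>The symmetry that lets a statement on extending the domain also yield
  surjectivity.\<close>

lemma matched_swap:
  assumes "field K" "field N" "matched K N G"
  shows "matched N K (prod.swap ` G)"
proof -
  interpret K: field K by fact
  interpret N: field N by fact
  have "prod.swap \<in> ring_hom (RDirProd K N) (RDirProd N K)"
    by (rule ring_hom_memI) (auto simp: RDirProd_carrier RDirProd_sel)
  then interpret h: ring_hom_ring "RDirProd K N" "RDirProd N K" prod.swap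
    by (intro ring_hom_ringI2 RDirProd_ring K.ring_axioms N.ring_axioms)
  show ?thesis
    using assms(3) h.img_is_subring[of G] unfolding matched_def by (auto 0 4)
qed

lemma algebraic_over_mono:
  "algebraic_over R A a \<Longrightarrow> A \<subseteq> B \<Longrightarrow> algebraic_over R B a"
  unfolding algebraic_over_def by (meson Pi_mono subset_iff)

text \<open>\<open>G\<close> itself, with its two projections, is the domain to which
  \<open>root_transfer\<close> is applied. The larger graph is the image of the univariate
  polynomials over \<open>G\<close> under simultaneous evaluation at \<open>a\<close> and at
  \<open>b\<close>; it is matched because both values vanish for the same polynomials.\<close>

lemma matched_extend:
  assumes K: "field K" and N: "field N" and roots: "has_roots N" and G: "matched K N G"
    and a: "a \<in> carrier K" "algebraic_over K (fst ` G) a"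
  shows "\<exists>b G'. matched K N G' \<and> G \<subseteq> G' \<and> (a, b) \<in> G'"
proof -
  interpret K: field K by fact
  interpret N: field N by fact
  define R where "R = RDirProd K N"
  interpret R: ring R unfolding R_def by (intro RDirProd_ring K.ring_axioms N.ring_axioms)
  note sel = RDirProd_sel[where K=K and N=N, folded R_def]
  have G1: "subring G R" and G2: "\<And>x y. (x, y) \<in> G \<Longrightarrow> x = \<zero>\<^bsub>K\<^esub> \<longleftrightarrow> y = \<zero>\<^bsub>N\<^esub>"
    using G by (auto simp: matched_def R_def)
  have Gc: "x \<in> carrier K" "y \<in> carrier N" if "(x, y) \<in> G" for x y
    using subringE(1)[OF G1] that by (auto simp: R_def RDirProd_carrier)
  define D where "D = R\<lparr>carrier := G\<rparr>"
  have Dsel: "carrier D = G" "(\<otimes>\<^bsub>D\<^esub>) = (\<otimes>\<^bsub>R\<^esub>)" "(\<oplus>\<^bsub>D\<^esub>) = (\<oplus>\<^bsub>R\<^esub>)" "\<one>\<^bsub>D\<^esub> = \<one>\<^bsub>R\<^esub>" "\<zero>\<^bsub>D\<^esub> = \<zero>\<^bsub>R\<^esub>"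
    by (simp_all add: D_def)
  interpret D: ring D unfolding D_def by (rule R.subring_is_ring[OF G1])
  have "domain D"
  proof (intro domain.intro domain_axioms.intro cring.intro D.ring_axioms D.monoid_comm_monoidI)
    show "x \<otimes>\<^bsub>D\<^esub> y = y \<otimes>\<^bsub>D\<^esub> x" if "x \<in> carrier D" "y \<in> carrier D" for x y
      using that Gc by (cases x; cases y) (auto simp: Dsel sel K.m_comm N.m_comm)
    show "\<one>\<^bsub>D\<^esub> \<noteq> \<zero>\<^bsub>D\<^esub>" by (simp add: Dsel sel)
    \<comment> \<open>A product of rings has zero divisors, but in \<open>G\<close> a vanishing
      first component forces the second to vanish too.\<close>
    show "x = \<zero>\<^bsub>D\<^esub> \<or> y = \<zero>\<^bsub>D\<^esub>" if "x \<otimes>\<^bsub>D\<^esub> y = \<zero>\<^bsub>D\<^esub>" "x \<in> carrier D" "y \<in> carrier D" for x y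
      using that Gc G2 by (cases x; cases y) (auto simp: Dsel sel K.integral_iff)
  qed
  then interpret D: domain D .
  have i: "fst \<in> ring_hom D K" and j: "snd \<in> ring_hom D N"
    using Gc by (auto intro!: ring_hom_memI simp: Dsel sel)
  have "\<exists>b\<in>carrier N. \<forall>q\<in>carrier (UP D). UnivPoly.eval D K fst a q = \<zero>\<^bsub>K\<^esub> \<longleftrightarrow> UnivPoly.eval D N snd b q = \<zero>\<^bsub>N\<^esub>"
  proof (rule root_transfer[OF D.domain_axioms K N i _ j _ roots a(1)])
    show "algebraic_over K (fst ` carrier D) a" using a(2) by (simp add: Dsel)
  qed (use G2 in \<open>auto simp: Dsel sel\<close>)
  then obtain b where b: "b \<in> carrier N"
    "\<And>q. q \<in> carrier (UP D) \<Longrightarrow> UnivPoly.eval D K fst a q = \<zero>\<^bsub>K\<^esub> \<longleftrightarrow> UnivPoly.eval D N snd b q = \<zero>\<^bsub>N\<^esub>"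
    by blast
  define P where "P = UP D"
  interpret U: UP_cring D P by unfold_locales (rule eq_reflection[OF P_def])
  have "ring_hom_cring D K fst" by (intro ring_hom_cringI D.cring_axioms K.cring_axioms i)
  then interpret UK: UP_pre_univ_prop D K fst P
    by (intro UP_pre_univ_prop.intro U.UP_cring_axioms) (assumption, rule eq_reflection[OF P_def])
  have "ring_hom_cring D N snd" by (intro ring_hom_cringI D.cring_axioms N.cring_axioms j)
  then interpret UN: UP_pre_univ_prop D N snd P
    by (intro UP_pre_univ_prop.intro U.UP_cring_axioms) (assumption, rule eq_reflection[OF P_def])
  define h where "h q = (UnivPoly.eval D K fst a q, UnivPoly.eval D N snd b q)" for q
  note EK = UK.eval_ring_hom[OF a(1)] and EN = UN.eval_ring_hom[OF b(1)]
  have "h \<in> ring_hom P R"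
  proof (rule ring_hom_memI)
    show "h x \<in> carrier R" if "x \<in> carrier P" for x
      using ring_hom_closed[OF EK that] ring_hom_closed[OF EN that]
      by (simp add: h_def R_def RDirProd_carrier)
    show "h (x \<otimes>\<^bsub>P\<^esub> y) = h x \<otimes>\<^bsub>R\<^esub> h y" if "x \<in> carrier P" "y \<in> carrier P" for x y
      using ring_hom_mult[OF EK that] ring_hom_mult[OF EN that] by (simp add: h_def sel)
    show "h (x \<oplus>\<^bsub>P\<^esub> y) = h x \<oplus>\<^bsub>R\<^esub> h y" if "x \<in> carrier P" "y \<in> carrier P" for x y
      using ring_hom_add[OF EK that] ring_hom_add[OF EN that] by (simp add: h_def sel)
    show "h \<one>\<^bsub>P\<^esub> = \<one>\<^bsub>R\<^esub>"
      using ring_hom_one[OF EK] ring_hom_one[OF EN] by (simp add: h_def sel)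
  qed
  then interpret h: ring_hom_ring P R h
    by (intro ring_hom_ringI2 U.P.ring_axioms R.ring_axioms)
  have "subring (h ` carrier P) R"
    by (rule h.img_is_subring[OF U.P.carrier_is_subring])
  moreover have "x = \<zero>\<^bsub>K\<^esub> \<longleftrightarrow> y = \<zero>\<^bsub>N\<^esub>" if "(x, y) \<in> h ` carrier P" for x y
    using that b(2) by (auto simp: h_def P_def)
  ultimately have "matched K N (h ` carrier P)" by (simp add: matched_def R_def)
  moreover have "G \<subseteq> h ` carrier P"
  proof
    fix g assume g: "g \<in> G"
    then have "h (up_ring.monom P g 0) = g"
      using UK.eval_const[OF a(1)] UN.eval_const[OF b(1)] by (simp add: h_def Dsel)
    then show "g \<in> h ` carrier P" using g U.monom_closed by (metis Dsel(1) imageI)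
  qed
  moreover have "(a, b) \<in> h ` carrier P"
  proof -
    have "h (up_ring.monom P \<one>\<^bsub>D\<^esub> 1) = (a, b)"
      using UK.eval_monom1[OF a(1)] UN.eval_monom1[OF b(1)] by (simp add: h_def)
    then show ?thesis using U.monom_closed[OF D.one_closed] by (metis imageI)
  qed
  ultimately show ?thesis by blast
qed

text \<open>By Zorn there is a maximal matched subring above \<open>G0\<close>. Any element of
  \<open>K\<close> missing from its first projection could be added by
  \<open>matched_extend\<close>, and after a swap likewise for \<open>N\<close>.\<close>

theorem matched_ring_iso:
  assumes K: "field K" and N: "field N" and roots: "has_roots K" "has_roots N"
    and G0: "matched K N G0"
    and algK: "\<And>a. a \<in> carrier K \<Longrightarrow> algebraic_over K (fst ` G0) a"
    and algN: "\<And>b. b \<in> carrier N \<Longrightarrow> algebraic_over N (snd ` G0) b"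
  shows "\<exists>\<phi>\<in>ring_iso K N. \<forall>(x, y)\<in>G0. \<phi> x = y"
proof -
  interpret K: field K by fact
  interpret N: field N by fact
  define R where "R = RDirProd K N"
  interpret R: ring R unfolding R_def by (intro RDirProd_ring K.ring_axioms N.ring_axioms)
  note sel = RDirProd_sel[where K=K and N=N, folded R_def]
  have "\<exists>M\<in>{G. matched K N G \<and> G0 \<subseteq> G}. \<forall>Y\<in>{G. matched K N G \<and> G0 \<subseteq> G}. M \<subseteq> Y \<longrightarrow> Y = M"
  proof (rule subset_Zorn_nonempty)
    show "{G. matched K N G \<and> G0 \<subseteq> G} \<noteq> {}" using G0 by blast
    fix C assume C: "C \<noteq> {}" "subset.chain {G. matched K N G \<and> G0 \<subseteq> G} C"
    then have m: "subring G R" "\<And>x y. (x, y) \<in> G \<Longrightarrow> x = \<zero>\<^bsub>K\<^esub> \<longleftrightarrow> y = \<zero>\<^bsub>N\<^esub>" "G0 \<subseteq> G" if "G \<in> C" for G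
      using that by (auto simp: subset.chain_def matched_def R_def)
    have dir: "\<exists>G\<in>C. g \<in> G \<and> h \<in> G" if gh: "g \<in> \<Union>C" "h \<in> \<Union>C" for g h
    proof -
      obtain G H where GH: "G \<in> C" "H \<in> C" "g \<in> G" "h \<in> H" using gh by blast
      then have "G \<subseteq> H \<or> H \<subseteq> G" using C(2) by (auto simp: subset_chain_def)
      then show ?thesis using GH by blast
    qed
    have "subring (\<Union>C) R"
    proof (rule R.subringI)
      show "\<Union>C \<subseteq> carrier R" using subringE(1)[OF m(1)] by (intro Union_least)
      show "\<one>\<^bsub>R\<^esub> \<in> \<Union>C" using C(1) subringE(3)[OF m(1)] by auto
    next
      fix h assume "h \<in> \<Union>C"
      then obtain G where G: "G \<in> C" "h \<in> G" by (rule UnionE)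
      show "\<ominus>\<^bsub>R\<^esub> h \<in> \<Union>C" by (rule UnionI[OF G(1) subringE(5)[OF m(1)[OF G(1)] G(2)]])
    next
      fix g h assume gh: "g \<in> \<Union>C" "h \<in> \<Union>C"
      from dir[OF this] obtain G where G: "G \<in> C" "g \<in> G" "h \<in> G" by (elim bexE conjE)
      show "g \<otimes>\<^bsub>R\<^esub> h \<in> \<Union>C" by (rule UnionI[OF G(1) subringE(6)[OF m(1)[OF G(1)] G(2,3)]])
      show "g \<oplus>\<^bsub>R\<^esub> h \<in> \<Union>C" by (rule UnionI[OF G(1) subringE(7)[OF m(1)[OF G(1)] G(2,3)]])
    qed
    moreover have "x = \<zero>\<^bsub>K\<^esub> \<longleftrightarrow> y = \<zero>\<^bsub>N\<^esub>" if xy: "(x, y) \<in> \<Union>C" for x y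
    proof -
      obtain G where G: "G \<in> C" "(x, y) \<in> G" using xy by (rule UnionE)
      show ?thesis by (rule m(2)[OF G])
    qed
    moreover have "G0 \<subseteq> \<Union>C" using C(1) m(3) by (meson Union_upper all_not_in_conv order_trans)
    ultimately show "\<Union>C \<in> {G. matched K N G \<and> G0 \<subseteq> G}"
      unfolding matched_def R_def[symmetric] by simp
  qed
  then obtain M where M': "M \<in> {G. matched K N G \<and> G0 \<subseteq> G}"
    "\<forall>Y\<in>{G. matched K N G \<and> G0 \<subseteq> G}. M \<subseteq> Y \<longrightarrow> Y = M" by (rule bexE)
  then have M: "matched K N M" "G0 \<subseteq> M" by simp_all
  have max: "Y = M" if "matched K N Y" "M \<subseteq> Y" for Y
    using M'(2) that order_trans[OF M(2) that(2)] by simp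
  have M1: "subring M R" and M2: "\<And>x y. (x, y) \<in> M \<Longrightarrow> x = \<zero>\<^bsub>K\<^esub> \<longleftrightarrow> y = \<zero>\<^bsub>N\<^esub>"
    using M(1) by (auto simp: matched_def R_def)
  have Mc: "x \<in> carrier K" "y \<in> carrier N" if "(x, y) \<in> M" for x y
    using subringE(1)[OF M1] that by (auto simp: R_def RDirProd_carrier)
  have total: "\<exists>b. (a, b) \<in> M" if a: "a \<in> carrier K" for a
  proof -
    have "algebraic_over K (fst ` M) a"
      by (rule algebraic_over_mono[OF algK[OF a] image_mono[OF M(2)]])
    from matched_extend[OF K N roots(2) M(1) a this]
    obtain b G' where G': "matched K N G'" "M \<subseteq> G'" "(a, b) \<in> G'" by (elim exE conjE)
    then show ?thesis using max[OF G'(1,2)] by auto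
  qed
  have surj: "\<exists>a. (a, b) \<in> M" if b: "b \<in> carrier N" for b
  proof -
    have "algebraic_over N (fst ` prod.swap ` M) b"
      using algebraic_over_mono[OF algN[OF b] image_mono[OF M(2)]] by (simp add: image_image)
    from matched_extend[OF N K roots(1) matched_swap[OF K N M(1)] b this]
    obtain a G' where G': "matched N K G'" "prod.swap ` M \<subseteq> G'" "(b, a) \<in> G'" by (elim exE conjE)
    have "M \<subseteq> prod.swap ` G'" using G'(2) by (force simp: image_iff)
    from max[OF matched_swap[OF N K G'(1)] this] have "prod.swap ` G' = M" .
    then show ?thesis using G'(3) by force
  qed
  \<comment> \<open>Closure under differences turns the matching of zeros into single-valuedness in
    both directions.\<close>
  have diff: "(x \<ominus>\<^bsub>K\<^esub> x', y \<ominus>\<^bsub>N\<^esub> y') \<in> M" if "(x, y) \<in> M" "(x', y') \<in> M" for x y x' y'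
  proof -
    have "\<ominus>\<^bsub>R\<^esub> (x', y') = (\<ominus>\<^bsub>K\<^esub> x', \<ominus>\<^bsub>N\<^esub> y')"
      using Mc[OF that(2)]
      by (intro R.minus_equality) (auto simp: sel R_def[symmetric] K.l_neg N.l_neg, auto simp: R_def RDirProd_carrier)
    then have "(\<ominus>\<^bsub>K\<^esub> x', \<ominus>\<^bsub>N\<^esub> y') \<in> M" using subringE(5)[OF M1 that(2)] by simp
    then show ?thesis using subringE(7)[OF M1 that(1)] by (fastforce simp: sel a_minus_def)
  qed
  have fun_eq: "y = y'" if "(x, y) \<in> M" "(x, y') \<in> M" for x y y'
    using M2[OF diff[OF that]] Mc[OF that(1)] Mc[OF that(2)] by simp
  have inj_eq: "x = x'" if "(x, y) \<in> M" "(x', y) \<in> M" for x x' y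
    using M2[OF diff[OF that]] Mc[OF that(1)] Mc[OF that(2)] by simp
  define \<phi> where "\<phi> x = (THE y. (x, y) \<in> M)" for x
  have \<phi>: "\<phi> x = y" if "(x, y) \<in> M" for x y
    unfolding \<phi>_def by (rule the_equality) (use that fun_eq in auto)
  have \<phi>M: "(x, \<phi> x) \<in> M" if "x \<in> carrier K" for x
    using total[OF that] \<phi> by auto
  have "\<phi> \<in> ring_hom K N"
  proof (rule ring_hom_memI)
    show "\<phi> x \<in> carrier N" if "x \<in> carrier K" for x by (rule Mc(2)[OF \<phi>M[OF that]])
    show "\<phi> (x \<otimes>\<^bsub>K\<^esub> y) = \<phi> x \<otimes>\<^bsub>N\<^esub> \<phi> y" if "x \<in> carrier K" "y \<in> carrier K" for x y
      using subringE(6)[OF M1 \<phi>M[OF that(1)] \<phi>M[OF that(2)]] by (intro \<phi>) (simp add: sel)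
    show "\<phi> (x \<oplus>\<^bsub>K\<^esub> y) = \<phi> x \<oplus>\<^bsub>N\<^esub> \<phi> y" if "x \<in> carrier K" "y \<in> carrier K" for x y
      using subringE(7)[OF M1 \<phi>M[OF that(1)] \<phi>M[OF that(2)]] by (intro \<phi>) (simp add: sel)
    show "\<phi> \<one>\<^bsub>K\<^esub> = \<one>\<^bsub>N\<^esub>" using subringE(3)[OF M1] by (intro \<phi>) (simp add: sel)
  qed
  moreover have "bij_betw \<phi> (carrier K) (carrier N)"
  proof (rule bij_betw_imageI)
    show "inj_on \<phi> (carrier K)" by (rule inj_onI) (metis \<phi>M inj_eq)
    show "\<phi> ` carrier K = carrier N"
    proof
      show "\<phi> ` carrier K \<subseteq> carrier N" using Mc(2)[OF \<phi>M] by auto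
      show "carrier N \<subseteq> \<phi> ` carrier K"
      proof
        fix b assume "b \<in> carrier N"
        from surj[OF this] obtain a where a: "(a, b) \<in> M" by (rule exE)
        show "b \<in> \<phi> ` carrier K" using \<phi>[OF a] Mc(1)[OF a] by auto
      qed
    qed
  qed
  ultimately show ?thesis using \<phi> M(2) by (intro bexI[of _ \<phi>]) (auto simp: ring_iso_def)
qed

section \<open>Algebraic independence\<close>

text \<open>The counterpart, for rings given by a carrier, of the monomials inside
  \<open>ipoly_eval\<close>.\<close>

definition ring_monomial :: "('a, 'm) ring_scheme \<Rightarrow> ('v \<Rightarrow> 'a) \<Rightarrow> 'v multiset \<Rightarrow> 'a"
  where "ring_monomial R x m = (\<Otimes>\<^bsub>R\<^esub>v\<in>set_mset m. x v [^]\<^bsub>R\<^esub> count m v)"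

definition ring_poly_eval :: "('a, 'm) ring_scheme \<Rightarrow> ('v \<Rightarrow> 'a) \<Rightarrow> 'v ipoly \<Rightarrow> 'a"
  where "ring_poly_eval R x P = (\<Oplus>\<^bsub>R\<^esub>m\<in>Poly_Mapping.keys P. [icoeff P m] \<cdot>\<^bsub>R\<^esub> ring_monomial R x m)"

lemma (in ring) add_pow_int_0 [simp]: "[(0::int)] \<cdot> a = \<zero>"
  by (simp add: add_pow_def)

section \<open>Evaluation of integer polynomials at elements of a ring\<close>

context cring
begin

context
  fixes x :: "'v \<Rightarrow> 'a"
  assumes x: "\<And>v. x v \<in> carrier R"
begin

lemma ring_monomial_closed [simp]: "ring_monomial R x m \<in> carrier R"
  by (simp add: ring_monomial_def x Pi_def)

lemma ring_monomial_superset: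
  assumes "finite A" "set_mset m \<subseteq> A"
  shows "ring_monomial R x m = (\<Otimes>v\<in>A. x v [^] count m v)"
  unfolding ring_monomial_def using assms x
  by (intro finprod_mono_neutral_cong_left) (auto simp: not_in_iff)

lemma ring_monomial_empty [simp]: "ring_monomial R x {#} = \<one>"
  by (simp add: ring_monomial_def)

lemma ring_monomial_add: "ring_monomial R x (m + n) = ring_monomial R x m \<otimes> ring_monomial R x n"
proof -
  let ?A = "set_mset m \<union> set_mset n"
  have "ring_monomial R x k = (\<Otimes>v\<in>?A. x v [^] count k v)" if "k \<in> {m, n, m + n}" for k
    using that by (intro ring_monomial_superset) auto
  moreover have "(\<Otimes>v\<in>?A. x v [^] count (m + n) v) = (\<Otimes>v\<in>?A. x v [^] count m v \<otimes> x v [^] count n v)"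
    using x by (intro finprod_cong') (auto simp: nat_pow_mult)
  ultimately show ?thesis using x by (simp add: finprod_multf Pi_def)
qed

lemma ring_monomial_replicate: "ring_monomial R x (replicate_mset i v) = x v [^] i"
  using ring_monomial_superset[of "{v}" "replicate_mset i v"] x by (auto simp: x split: if_splits)

lemma ring_monomial_add_mset: "ring_monomial R x (add_mset v m) = x v \<otimes> ring_monomial R x m"
  using ring_monomial_add[of "{#v#}" m] ring_monomial_replicate[of 1 v] x by simp

lemma ring_poly_eval_closed [simp]: "ring_poly_eval R x P \<in> carrier R"
  by (simp add: ring_poly_eval_def Pi_def)

lemma ring_poly_eval_superset:
  assumes "finite A" "Poly_Mapping.keys P \<subseteq> A"
  shows "ring_poly_eval R x P = (\<Oplus>m\<in>A. [icoeff P m] \<cdot> ring_monomial R x m)"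
  unfolding ring_poly_eval_def using assms
  by (intro add.finprod_mono_neutral_cong_left) (auto simp: in_keys_iff add_pow_int_0)

lemma ring_poly_eval_zero [simp]: "ring_poly_eval R x 0 = \<zero>"
  by (simp add: ring_poly_eval_def)

lemma ring_poly_eval_single: "ring_poly_eval R x (isingle m c) = [c] \<cdot> ring_monomial R x m"
  by (simp add: ring_poly_eval_superset[of "{m}"])

lemma ring_poly_eval_add: "ring_poly_eval R x (P + Q) = ring_poly_eval R x P \<oplus> ring_poly_eval R x Q"
proof -
  let ?A = "Poly_Mapping.keys P \<union> Poly_Mapping.keys Q"
  have "ring_poly_eval R x F = (\<Oplus>m\<in>?A. [icoeff F m] \<cdot> ring_monomial R x m)" if "F \<in> {P, Q, P + Q}" for F
    using that Poly_Mapping.keys_add[of P Q] by (intro ring_poly_eval_superset) auto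
  moreover have "(\<Oplus>m\<in>?A. [icoeff (P + Q) m] \<cdot> ring_monomial R x m) =
      (\<Oplus>m\<in>?A. [icoeff P m] \<cdot> ring_monomial R x m \<oplus> [icoeff Q m] \<cdot> ring_monomial R x m)"
    by (intro finsum_cong') (auto simp: lookup_add add.int_pow_mult)
  ultimately show ?thesis by (simp add: finsum_addf Pi_def)
qed

lemma ring_poly_eval_sum:
  "finite A \<Longrightarrow> ring_poly_eval R x (sum F A) = (\<Oplus>i\<in>A. ring_poly_eval R x (F i))"
  by (induct A rule: finite_induct) (auto simp: ring_poly_eval_add Pi_def)

lemma ring_poly_eval_mult: "ring_poly_eval R x (P * Q) = ring_poly_eval R x P \<otimes> ring_poly_eval R x Q"
proof (induct P rule: poly_mapping_single_induct)
  case (single m c)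
  show ?case
  proof (induct Q rule: poly_mapping_single_induct)
    case (single n d)
    have "[(c * d)] \<cdot> (ring_monomial R x m \<otimes> ring_monomial R x n) =
        [d] \<cdot> ([c] \<cdot> (ring_monomial R x m \<otimes> ring_monomial R x n))"
      by (simp add: add.int_pow_pow mult.commute)
    then show ?case
      by (simp add: mult_single ring_poly_eval_single ring_monomial_add add_pow_ldistr_int add_pow_rdistr_int)
  qed (auto simp: distrib_left ring_poly_eval_add r_distr)
qed (auto simp: distrib_right ring_poly_eval_add l_distr)

lemma ring_poly_eval_one: "ring_poly_eval R x 1 = \<one>"
  using ring_poly_eval_single[of 0 1] by simp

lemma ring_poly_eval_uminus: "ring_poly_eval R x (- P) = \<ominus> ring_poly_eval R x P"
  by (rule minus_equality[symmetric]) (simp_all flip: ring_poly_eval_add)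

lemma ring_poly_eval_var: "ring_poly_eval R x (isingle {#v#} 1) = x v"
  using ring_monomial_replicate[of 1 v] x by (simp add: ring_poly_eval_single)

end

text \<open>Elements of the ring serve as their own variables. The default zero makes this
  assignment total with values in the carrier, as the evaluation lemmas require.\<close>

definition coord :: "'a \<Rightarrow> 'a"
  where "coord v = (if v \<in> carrier R then v else \<zero>)"

lemma coord_closed [simp]: "coord v \<in> carrier R"
  by (simp add: coord_def)

definition alg_indep :: "'a set \<Rightarrow> bool"
  where "alg_indep S \<longleftrightarrow> S \<subseteq> carrier R \<and>
    (\<forall>P. ipoly_vars P \<subseteq> S \<longrightarrow> ring_poly_eval R coord P = \<zero> \<longrightarrow> P = 0)"

text \<open>A polynomial has finitely many variables, so independence passes to unions of chains and
  Zorn applies. Adding \<open>a\<close> to a maximal set creates a relation; split at the variable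
  \<open>a\<close> it is the algebraic equation for \<open>a\<close>, nontrivial because the
  coefficients are polynomials over an independent set.\<close>

lemma alg_indep_extend:
  assumes "alg_indep S0"
  shows "\<exists>T. S0 \<subseteq> T \<and> alg_indep T \<and>
    (\<forall>a\<in>carrier R. algebraic_over R {ring_poly_eval R coord P | P. ipoly_vars P \<subseteq> T} a)"
proof -
  have "\<exists>M\<in>{T. alg_indep T \<and> S0 \<subseteq> T}. \<forall>Y\<in>{T. alg_indep T \<and> S0 \<subseteq> T}. M \<subseteq> Y \<longrightarrow> Y = M"
  proof (rule subset_Zorn_nonempty)
    show "{T. alg_indep T \<and> S0 \<subseteq> T} \<noteq> {}" using assms by auto
    fix C assume C: "C \<noteq> {}" "subset.chain {T. alg_indep T \<and> S0 \<subseteq> T} C"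
    then have CT: "\<And>T. T \<in> C \<Longrightarrow> alg_indep T \<and> S0 \<subseteq> T" by (auto simp: subset.chain_def)
    have "P = 0" if P: "ipoly_vars P \<subseteq> \<Union>C" "ring_poly_eval R coord P = \<zero>" for P
    proof -
      obtain B where "B \<in> C" "ipoly_vars P \<subseteq> B"
        using finite_subset_Union_chain[OF finite_ipoly_vars P(1) C] .
      then show ?thesis using CT[of B] P(2) by (auto simp: alg_indep_def)
    qed
    moreover have "\<Union>C \<subseteq> carrier R"
      by (rule Union_least) (use CT in \<open>simp add: alg_indep_def\<close>)
    ultimately have "alg_indep (\<Union>C)"
      unfolding alg_indep_def by blast
    moreover have "S0 \<subseteq> \<Union>C"
    proof -
      obtain B where "B \<in> C" using C(1) by auto
      then show ?thesis using CT[of B] by auto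
    qed
    ultimately show "\<Union>C \<in> {T. alg_indep T \<and> S0 \<subseteq> T}" by simp
  qed
  then obtain T where T: "T \<in> {T. alg_indep T \<and> S0 \<subseteq> T}"
    "\<forall>Y\<in>{T. alg_indep T \<and> S0 \<subseteq> T}. T \<subseteq> Y \<longrightarrow> Y = T" by (rule bexE)
  let ?G = "{ring_poly_eval R coord P | P. ipoly_vars P \<subseteq> T}"
  have ind: "P = 0" if "ipoly_vars P \<subseteq> T" "ring_poly_eval R coord P = \<zero>" for P
    using T(1) that by (simp add: alg_indep_def)
  have "algebraic_over R ?G a" if a: "a \<in> carrier R" for a
  proof (cases "\<one> = \<zero>")
    case True
    \<comment> \<open>In the zero ring no set is independent, since the polynomial 1 evaluates to
      zero there.\<close>
    have "(1 :: 'a ipoly) = 0"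
      by (rule ind) (use True ring_poly_eval_one[of coord] in \<open>simp_all add: ipoly_vars_def\<close>)
    then show ?thesis by simp
  next
    case False
    show ?thesis
    proof (cases "a \<in> T")
      case True
      \<comment> \<open>A member of the basis is a root of the linear polynomial
        \<open>X - a\<close>.\<close>
      define c where "c i = (if i = (0::nat) then \<ominus> a else \<one>)" for i
      have "(\<Oplus>i\<in>{..1}. c i \<otimes> a [^] i) = \<zero>"
        using a by (simp add: c_def atMost_Suc r_neg)
      moreover have "c \<in> {..1} \<rightarrow> ?G"
      proof
        fix i :: nat
        have "\<ominus> a = ring_poly_eval R coord (- isingle {#a#} 1)"
          using ring_poly_eval_uminus[of coord "isingle {#a#} 1"] ring_poly_eval_var[of coord a] a
          by (simp add: coord_def)
        moreover have "ipoly_vars (- isingle {#a#} 1) \<subseteq> T" using True by (simp add: ipoly_vars_def)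
        ultimately have "\<ominus> a \<in> ?G" by blast
        moreover have "\<one> \<in> ?G"
          using ring_poly_eval_one[of coord] by (intro CollectI exI[of _ 1]) (simp add: ipoly_vars_def)
        ultimately show "c i \<in> ?G" unfolding c_def by simp
      qed
      moreover have "c 1 \<noteq> \<zero>" using False by (simp add: c_def)
      ultimately show ?thesis unfolding algebraic_over_def by blast
    next
      case False
      have "\<not> alg_indep (insert a T)"
      proof
        assume "alg_indep (insert a T)"
        then have "insert a T = T" using T by (metis (mono_tags, lifting) mem_Collect_eq subset_insertI subset_trans)
        then show False using False by blast
      qed
      then obtain P where P: "ipoly_vars P \<subseteq> insert a T" "ring_poly_eval R coord P = \<zero>" "P \<noteq> 0"
        using T a by (auto simp: alg_indep_def)
      obtain n C where PC: "P = (\<Sum>i\<le>n. C i * isingle (replicate_mset i a) 1)"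
        and "\<And>i. ipoly_vars (C i) \<subseteq> ipoly_vars P - {a}"
        using ipoly_split_at[of P a] by blast
      then have C: "ipoly_vars (C i) \<subseteq> T" for i using P(1) by blast
      obtain i where i: "i \<le> n" "C i \<noteq> 0"
        using P(3) PC by (metis (no_types, lifting) atMost_iff mult_zero_left sum.neutral)
      then have "ring_poly_eval R coord (C i) \<noteq> \<zero>" using T(1) C[of i] by (auto simp: alg_indep_def)
      moreover have "(\<Oplus>i\<in>{..n}. ring_poly_eval R coord (C i) \<otimes> a [^] i) = \<zero>"
      proof -
        have "ring_poly_eval R coord (C i * isingle (replicate_mset i a) 1) =
            ring_poly_eval R coord (C i) \<otimes> a [^] i" for i
          using a by (simp add: ring_poly_eval_mult ring_poly_eval_single ring_monomial_replicate)
            (simp add: coord_def)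
        then show ?thesis using P(2) unfolding PC by (simp add: ring_poly_eval_sum)
      qed
      moreover have "(\<lambda>i. ring_poly_eval R coord (C i)) \<in> {..n} \<rightarrow> ?G" using C by auto
      ultimately show ?thesis using i(1) unfolding algebraic_over_def by blast
    qed
  qed
  then show ?thesis using T(1) by blast
qed

end

section \<open>Differentially closed fields\<close>

text \<open>\<open>indexed_pset\<close> is generated by constants, sums and multiplication by
  letters: a single term is built letter by letter, and finitely many terms are added up.
  Differential polynomials can then be given by their coefficient functions.\<close>

lemma (in ring) finite_support_in_indexed_pset:
  fixes p :: "'c multiset \<Rightarrow> 'a"
  assumes "finite {m. p m \<noteq> \<zero>}" "\<And>m. p m \<in> carrier R"
  shows "p \<in> indexed_pset UNIV (carrier R)"
proof -
  have single: "(\<lambda>m. if m = m0 then k else \<zero>) \<in> indexed_pset UNIV (carrier R)"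
    if k: "k \<in> carrier R" for k and m0 :: "'c multiset"
  proof (induct m0)
    case empty
    then show ?case using indexed_pset.indexed_const[OF k] by (simp add: indexed_const_def)
  next
    case (add i m0)
    have "indexed_pmult (\<lambda>m. if m = m0 then k else \<zero>) i = (\<lambda>m. if m = add_mset i m0 then k else \<zero>)"
      unfolding indexed_pmult_def by (rule ext) (auto dest: multi_member_split)
    then show ?case using indexed_pset.indexed_pmult[OF add, of i] by simp
  qed
  have "(\<lambda>m. if m \<in> A then p m else \<zero>) \<in> indexed_pset UNIV (carrier R)" if "finite A" for A
    using that
  proof (induct A rule: finite_induct)
    case empty
    then show ?case using indexed_pset.indexed_const[of \<zero> "carrier R" UNIV] by (simp add: indexed_const_def)
  next
    case (insert a A)
    have "indexed_padd (\<lambda>m. if m = a then p a else \<zero>) (\<lambda>m. if m \<in> A then p m else \<zero>) =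
        (\<lambda>m. if m \<in> insert a A then p m else \<zero>)"
      unfolding indexed_padd_def using insert(2) assms(2) by (intro ext) auto
    then show ?case
      using indexed_pset.indexed_padd[OF single[OF assms(2)[of a], of a] insert(3)] by simp
  qed
  moreover have "(\<lambda>m. if m \<in> {m. p m \<noteq> \<zero>} then p m else \<zero>) = p" by auto
  ultimately show ?thesis using assms(1) by metis
qed

context differential_field
begin

lemma iter_deriv_closed: "a \<in> carrier R \<Longrightarrow> (\<delta> ^^ j) a \<in> carrier R"
  by (induct j) (auto intro: deriv_closed)

lemma deriv_zero [simp]: "\<delta> \<zero> = \<zero>"
proof -
  have "\<delta> \<zero> = \<delta> \<zero> \<oplus> \<delta> \<zero>" using deriv_add[of \<zero> \<zero>] by simp
  then show ?thesis using deriv_closed[of \<zero>] by (metis a_comm add.r_cancel_one zero_closed)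
qed

lemma deriv_one [simp]: "\<delta> \<one> = \<zero>"
proof -
  have "\<delta> \<one> = \<delta> \<one> \<oplus> \<delta> \<one>" using deriv_mult[of \<one> \<one>] deriv_closed[of \<one>] by simp
  then show ?thesis using deriv_closed[of \<one>] by (metis add.r_cancel_one one_closed)
qed

lemma deriv_uminus: "a \<in> carrier R \<Longrightarrow> \<delta> (\<ominus> a) = \<ominus> \<delta> a"
  using deriv_add[of "\<ominus> a" a] deriv_closed by (simp add: l_neg minus_equality)

lemma deriv_nat_multiple_one: "\<delta> ([(n::nat)] \<cdot> \<one>) = \<zero>"
  by (induct n) (auto simp: deriv_add)

lemma deriv_int_multiple_one: "\<delta> ([(k::int)] \<cdot> \<one>) = \<zero>"
  by (cases "k \<ge> 0") (auto simp: add_pow_int_ge add_pow_int_lt deriv_uminus deriv_nat_multiple_one)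

lemma int_multiple_one_eq_zero: "[(k::int)] \<cdot> \<one> = \<zero> \<longleftrightarrow> k = 0"
proof (cases "k \<ge> 0")
  case True
  then show ?thesis
    using char_zero[of "nat k"] by (cases "k = 0") (auto simp: add_pow_int_ge)
next
  case False
  then show ?thesis using char_zero[of "nat (- k)"] by (auto simp: add_pow_int_lt)
qed

lemma deriv_finsum:
  "finite A \<Longrightarrow> f \<in> A \<rightarrow> carrier R \<Longrightarrow> \<delta> (\<Oplus>i\<in>A. f i) = (\<Oplus>i\<in>A. \<delta> (f i))"
  by (induct A rule: finite_induct) (auto simp: deriv_add deriv_closed Pi_def)

lemma diff_eval_superset:
  assumes "finite S" "{m. p m \<noteq> \<zero>} \<subseteq> S" "\<And>m. p m \<in> carrier R" "a \<in> carrier R"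
  shows "diff_eval p a = (\<Oplus>m\<in>S. p m \<otimes> ring_monomial R (\<lambda>j. (\<delta> ^^ j) a) m)"
proof -
  have "ring_monomial R (\<lambda>j. (\<delta> ^^ j) a) m \<in> carrier R" for m
    by (rule ring_monomial_closed) (rule iter_deriv_closed[OF assms(4)])
  then show ?thesis
    unfolding diff_eval_def ring_monomial_def[symmetric] using assms(1-3)
    by (intro add.finprod_mono_neutral_cong_left) auto
qed

lemma diff_ord_eqI:
  assumes "p m \<noteq> \<zero>" "j \<in># m" "\<And>m i. p m \<noteq> \<zero> \<Longrightarrow> i \<in># m \<Longrightarrow> i \<le> j"
  shows "diff_ord p = int j"
proof -
  have "{n. \<not> index_free p n} \<subseteq> {..j}" using assms(3) by (auto simp: index_free_def)
  moreover have "\<not> index_free p j" using assms by (auto simp: index_free_def)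
  ultimately have "Max {n. \<not> index_free p n} = j"
    by (intro Max_eqI) (auto intro: finite_subset[of _ "{..j}"])
  then show ?thesis using \<open>\<not> index_free p j\<close> by (auto simp: diff_ord_def)
qed

text \<open>Horner evaluation at \<open>x\<close>. Polynomials of type \<open>int poly\<close> bring
  degree and \<open>pderiv\<close> with them, and \<open>pderiv\<close> mirrors
  \<open>\<delta>\<close> as soon as \<open>\<delta> x = \<one>\<close>.\<close>

definition upoly :: "'a \<Rightarrow> int poly \<Rightarrow> 'a"
  where "upoly x f = foldr (\<lambda>a r. [a] \<cdot> \<one> \<oplus> x \<otimes> r) (coeffs f) \<zero>"

context
  fixes x assumes x: "x \<in> carrier R"
begin

lemma upoly_0 [simp]: "upoly x 0 = \<zero>"
  by (simp add: upoly_def)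

lemma upoly_pCons [simp]: "upoly x (pCons a f) = [a] \<cdot> \<one> \<oplus> x \<otimes> upoly x f"
  using x by (auto simp: upoly_def cCons_def)

lemma upoly_closed [simp]: "upoly x f \<in> carrier R"
  using x by (induct f) auto

lemma upoly_add: "upoly x (f + g) = upoly x f \<oplus> upoly x g"
proof (induct f arbitrary: g)
  case (pCons a f)
  note IH = pCons(2)
  show ?case
  proof (cases g)
    case (pCons b h)
    then show ?thesis
      using x by (simp add: IH add.int_pow_mult r_distr a_ac)
  qed
qed simp

lemma upoly_smult: "upoly x (Polynomial.smult c f) = [c] \<cdot> \<one> \<otimes> upoly x f"
proof (induct f)
  case (pCons a f)
  have "[(c * a)] \<cdot> \<one> = [c] \<cdot> \<one> \<otimes> [a] \<cdot> \<one>"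
    by (simp add: add_pow_ldistr_int add.int_pow_pow mult.commute)
  then show ?case using x pCons by (simp add: r_distr m_lcomm)
qed (simp add: x)

lemma upoly_mult: "upoly x (f * g) = upoly x f \<otimes> upoly x g"
proof (induct f)
  case (pCons a f)
  then show ?case using x by (simp add: upoly_add upoly_smult l_distr m_assoc)
qed (simp add: x)

lemma upoly_uminus: "upoly x (- f) = \<ominus> upoly x f"
  by (rule minus_equality[symmetric]) (simp_all flip: upoly_add)

lemma upoly_monom: "upoly x (Polynomial.monom 1 n) = x [^] n"
  using x by (induct n) (simp_all add: monom_0 monom_Suc m_comm)

lemma deriv_upoly:
  assumes "\<delta> x = \<one>"
  shows "\<delta> (upoly x f) = upoly x (pderiv f)"
proof (induct f)
  case (pCons a f)
  then show ?case
    using x assms by (simp add: deriv_add deriv_mult deriv_int_multiple_one pderiv_pCons upoly_add)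
qed simp

text \<open>Differentiating a relation lowers its degree, and a nonzero integer does not vanish in
  characteristic zero; so an element with derivative 1 is transcendental.\<close>

lemma upoly_eq_0:
  assumes "\<delta> x = \<one>" "upoly x f = \<zero>"
  shows "f = 0"
  using assms(2)
proof (induct "Polynomial.degree f" arbitrary: f rule: less_induct)
  case less
  show ?case
  proof (cases "Polynomial.degree f = 0")
    case True
    then obtain a where "f = [:a:]" by (rule degree_eq_zeroE)
    then show ?thesis using less.prems x by (simp add: int_multiple_one_eq_zero)
  next
    case False
    have "upoly x (pderiv f) = \<zero>" using deriv_upoly[OF assms(1)] less.prems by (metis deriv_zero)
    then have "pderiv f = 0" using less.hyps False by (simp add: degree_pderiv)
    then show ?thesis using False by (simp add: pderiv_eq_0_iff)
  qed
qed

text \<open>Exponential monomials with distinct polynomial exponents are linearly independent over the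
  polynomials in \<open>x\<close>: a relation is shortened by differentiating it and eliminating one term.\<close>

lemma exponentials_independent:
  fixes M :: "'i \<Rightarrow> 'a" and g :: "'i \<Rightarrow> int poly"
  assumes dx: "\<delta> x = \<one>" and "finite A"
    and M: "\<And>i. i \<in> A \<Longrightarrow> M i \<in> carrier R" "\<And>i. i \<in> A \<Longrightarrow> M i \<noteq> \<zero>"
    and dM: "\<And>i. i \<in> A \<Longrightarrow> \<delta> (M i) = upoly x (g i) \<otimes> M i"
    and inj: "inj_on g A"
    and rel: "(\<Oplus>i\<in>A. upoly x (c i) \<otimes> M i) = \<zero>" and c: "\<And>i. i \<in> A \<Longrightarrow> c i \<noteq> 0"
  shows "A = {}"
  using \<open>finite A\<close> M dM inj rel c
proof (induct A arbitrary: c rule: finite_induct)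
  case (insert i0 A)
  define L where "L d B = (\<Oplus>i\<in>B. upoly x (d i) \<otimes> M i)" for d B
  have Mc: "M i \<in> carrier R" if "i \<in> insert i0 A" for i using insert.prems(1) that by blast
  have term_closed: "(\<lambda>i. upoly x (d i) \<otimes> M i) \<in> insert i0 A \<rightarrow> carrier R" for d using Mc by auto
  have Lc: "L d (insert i0 A) \<in> carrier R" for d unfolding L_def using term_closed by auto
  have L_add: "L (\<lambda>i. d i + e i) (insert i0 A) = L d (insert i0 A) \<oplus> L e (insert i0 A)" for d e
  proof -
    have "(\<Oplus>i\<in>insert i0 A. upoly x (d i + e i) \<otimes> M i) =
        (\<Oplus>i\<in>insert i0 A. upoly x (d i) \<otimes> M i \<oplus> upoly x (e i) \<otimes> M i)"
      using Mc by (intro finsum_cong') (auto simp: upoly_add l_distr)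
    then show ?thesis unfolding L_def using term_closed by (simp add: finsum_addf del: finsum_insert)
  qed
  have L_mult: "L (\<lambda>i. e * d i) (insert i0 A) = upoly x e \<otimes> L d (insert i0 A)" for d e
  proof -
    have "upoly x e \<otimes> L d (insert i0 A) = (\<Oplus>i\<in>insert i0 A. upoly x e \<otimes> (upoly x (d i) \<otimes> M i))"
      unfolding L_def by (rule finsum_rdistr) (use insert.hyps term_closed in auto)
    also have "\<dots> = L (\<lambda>i. e * d i) (insert i0 A)"
      unfolding L_def using Mc by (intro finsum_cong') (auto simp: upoly_mult m_assoc)
    finally show ?thesis ..
  qed
  \<comment> \<open>The coefficients of the differentiated relation: a term \<open>c i * M i\<close>
    has derivative \<open>(pderiv (c i) + c i * g i) * M i\<close>.\<close>
  define u where "u i = pderiv (c i) + c i * g i" for i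
  have L0: "L c (insert i0 A) = \<zero>" using insert.prems(5) by (simp only: L_def)
  have "L u (insert i0 A) = \<delta> (L c (insert i0 A))"
  proof -
    have "\<delta> (L c (insert i0 A)) = (\<Oplus>i\<in>insert i0 A. \<delta> (upoly x (c i) \<otimes> M i))"
      unfolding L_def by (rule deriv_finsum) (use insert.hyps term_closed in auto)
    also have "\<dots> = L u (insert i0 A)"
      unfolding L_def
    proof (rule finsum_cong')
      fix i assume i: "i \<in> insert i0 A"
      have "\<delta> (upoly x (c i) \<otimes> M i) = upoly x (pderiv (c i)) \<otimes> M i \<oplus> upoly x (c i) \<otimes> (upoly x (g i) \<otimes> M i)"
        using deriv_mult[of "upoly x (c i)" "M i"] Mc[OF i] insert.prems(3)[OF i] deriv_upoly[OF dx] by simp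
      then show "\<delta> (upoly x (c i) \<otimes> M i) = upoly x (u i) \<otimes> M i"
        using Mc[OF i] by (simp add: u_def upoly_add upoly_mult l_distr m_assoc)
    qed (use term_closed in auto)
    finally show ?thesis ..
  qed
  then have Lu: "L u (insert i0 A) = \<zero>" using L0 by simp
  \<comment> \<open>The combination of the relation and its derivative in which the term at
    \<open>i0\<close> cancels.\<close>
  define d where "d i = c i0 * u i + (- u i0) * c i" for i
  have "L d (insert i0 A) = \<zero>"
    unfolding d_def L_add L_mult L0 Lu using x by simp
  moreover have "L d (insert i0 A) = upoly x (d i0) \<otimes> M i0 \<oplus> L d A"
    unfolding L_def using insert.hyps term_closed[of d] by (intro finsum_insert) auto
  moreover have "d i0 = 0" by (simp add: d_def)
  moreover have "L d A \<in> carrier R" unfolding L_def using term_closed[of d] by auto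
  ultimately have "L d A = \<zero>" using Mc[of i0] by simp
  \<comment> \<open>No further term is lost. If \<open>d i\<close> were zero,
    \<open>c i0 * c i\<close> times the nonzero difference of exponents would equal an expression in
    the derivatives of \<open>c i0\<close> and \<open>c i\<close>, which has smaller degree or, for
    two constants, is zero.\<close>
  have "d i \<noteq> 0" if i: "i \<in> A" for i
  proof
    assume "d i = 0"
    define h where "h = g i - g i0"
    have "h \<noteq> 0" using insert.prems(4) insert.hyps(2) i by (auto simp: h_def inj_on_def)
    have nz: "c i0 \<noteq> 0" "c i \<noteq> 0" using insert.prems(6) i by auto
    have eq: "c i0 * c i * h = pderiv (c i0) * c i - c i0 * pderiv (c i)"
      using \<open>d i = 0\<close> by (simp add: d_def u_def h_def algebra_simps)
    let ?a = "Polynomial.degree (c i0)" and ?b = "Polynomial.degree (c i)"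
    have deg: "Polynomial.degree (c i0 * c i * h) \<ge> ?a + ?b"
      using nz \<open>h \<noteq> 0\<close> by (simp add: degree_mult_eq)
    show False
    proof (cases "?a + ?b = 0")
      case True
      then have "pderiv (c i0) = 0" "pderiv (c i) = 0" by (auto simp: pderiv_eq_0_iff)
      then show False using eq nz \<open>h \<noteq> 0\<close> by simp
    next
      case False
      have "Polynomial.degree (pderiv (c i0) * c i) < ?a + ?b"
        using False degree_mult_le[of "pderiv (c i0)" "c i"] degree_pderiv[of "c i0"]
        by (cases "?a = 0") (auto simp: pderiv_eq_0_iff[THEN iffD2])
      moreover have "Polynomial.degree (c i0 * pderiv (c i)) < ?a + ?b"
        using False degree_mult_le[of "c i0" "pderiv (c i)"] degree_pderiv[of "c i"]
        by (cases "?b = 0") (auto simp: pderiv_eq_0_iff[THEN iffD2])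
      ultimately have "Polynomial.degree (c i0 * c i * h) < ?a + ?b"
        unfolding eq by (rule degree_diff_less)
      then show False using deg by simp
    qed
  qed
  then have "A = {}"
    using insert.hyps(3)[of d] insert.prems \<open>L d A = \<zero>\<close> by (auto simp: L_def inj_on_def)
  then have "upoly x (c i0) \<otimes> M i0 = \<zero>" using L0 Mc by (simp add: L_def)
  then have "upoly x (c i0) = \<zero>" using insert.prems(2) Mc integral[of "upoly x (c i0)" "M i0"] by auto
  then have "c i0 = 0" by (rule upoly_eq_0[OF dx])
  then show ?case using insert.prems(6) by blast
qed simp

end

end

section \<open>Consequences of differential closedness\<close>

context differentially_closed_field
begin

text \<open>A polynomial of positive degree in the letter 0 has order 0, and the constant 1 has
  order -1; differential closedness for this pair yields a root.\<close>

lemma has_roots: "has_roots R"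
  unfolding has_roots_def
proof (intro allI impI, elim conjE)
  fix n :: nat and c assume n: "0 < n" and c: "c \<in> {..n} \<rightarrow> carrier R" and cn: "c n \<noteq> \<zero>"
  define S where "S = (\<lambda>i. replicate_mset i (0::nat)) ` {..n}"
  define p where "p m = (if m \<in> S then c (size m) else \<zero>)" for m
  have pc: "p m \<in> carrier R" for m using c by (auto simp: p_def S_def)
  have sub: "{m. p m \<noteq> \<zero>} \<subseteq> S" by (auto simp: p_def)
  have fS: "finite S" by (simp add: S_def)
  have "p \<in> diff_polys"
    unfolding diff_polys_def using finite_subset[OF sub fS] pc by (rule finite_support_in_indexed_pset)
  moreover have "indexed_const \<one> \<in> diff_polys"
    unfolding diff_polys_def by (rule indexed_pset.indexed_const) simp
  moreover have "diff_ord p = int 0"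
  proof (rule diff_ord_eqI)
    show "p (replicate_mset n 0) \<noteq> \<zero>" using cn by (auto simp: p_def S_def)
    show "0 \<in># replicate_mset n 0" using n by simp
    show "i \<le> 0" if "p m \<noteq> \<zero>" "i \<in># m" for m i
      using that by (auto simp: p_def S_def split: if_splits)
  qed
  moreover have "diff_ord (indexed_const \<one>) = -1"
  proof -
    have "index_free (indexed_const \<one> :: nat multiset \<Rightarrow> 'a) n" for n
      by (rule indexed_const_index_free)
    then show ?thesis by (simp add: diff_ord_def)
  qed
  moreover have "indexed_const \<one> \<noteq> (indexed_const \<zero> :: nat multiset \<Rightarrow> 'a)"
    by (auto simp: indexed_const_def fun_eq_iff)
  ultimately obtain a where a: "a \<in> carrier R" "diff_eval p a = \<zero>"
    using diff_closed[of p "indexed_const \<one>"] by auto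
  have cl: "(\<delta> ^^ j) a \<in> carrier R" for j by (rule iter_deriv_closed[OF a(1)])
  have "diff_eval p a = (\<Oplus>m\<in>S. p m \<otimes> ring_monomial R (\<lambda>j. (\<delta> ^^ j) a) m)"
    by (rule diff_eval_superset[OF fS sub pc a(1)])
  also have "\<dots> = (\<Oplus>i\<in>{..n}. p (replicate_mset i 0) \<otimes> ring_monomial R (\<lambda>j. (\<delta> ^^ j) a) (replicate_mset i 0))"
    unfolding S_def by (rule finsum_reindex) (auto simp: inj_on_def pc cl dest: arg_cong[of _ _ size])
  also have "\<dots> = (\<Oplus>i\<in>{..n}. c i \<otimes> a [^] i)"
    using c a(1) ring_monomial_replicate[of "\<lambda>j. (\<delta> ^^ j) a" _ 0, OF cl]
    by (intro finsum_cong') (auto simp: p_def S_def)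
  finally show "\<exists>b\<in>carrier R. (\<Oplus>i\<in>{..n}. c i \<otimes> b [^] i) = \<zero>" using a by auto
qed

text \<open>Differential closedness for \<open>p = y' + b y + c\<close> of order 1 and
  \<open>q = y\<close> of order 0; the second polynomial excludes the zero solution.\<close>

lemma linear_differential_equation:
  assumes b: "b \<in> carrier R" and c: "c \<in> carrier R"
  shows "\<exists>a\<in>carrier R. a \<noteq> \<zero> \<and> \<delta> a \<oplus> (b \<otimes> a \<oplus> c) = \<zero>"
proof -
  define p where "p m = (if m = {#1::nat#} then \<one> else if m = {#0#} then b else if m = {#} then c else \<zero>)" for m
  define q where "q m = (if m = {#0::nat#} then \<one> else \<zero>)" for m
  have pc: "p m \<in> carrier R" and qc: "q m \<in> carrier R" for m using b c by (auto simp: p_def q_def)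
  have psub: "{m. p m \<noteq> \<zero>} \<subseteq> {{#1#}, {#0#}, {#}}" by (auto simp: p_def)
  have qsub: "{m. q m \<noteq> \<zero>} \<subseteq> {{#0#}}" by (auto simp: q_def)
  have "p \<in> diff_polys" "q \<in> diff_polys"
    unfolding diff_polys_def using finite_subset[OF psub] finite_subset[OF qsub] pc qc
    by (auto intro!: finite_support_in_indexed_pset)
  moreover have "diff_ord p = int 1"
    by (rule diff_ord_eqI[of _ "{#1#}"]) (auto simp: p_def split: if_splits)
  moreover have "diff_ord q = int 0"
    by (rule diff_ord_eqI[of _ "{#0#}"]) (auto simp: q_def split: if_splits)
  moreover have "q \<noteq> indexed_const \<zero>"
    by (auto simp: q_def indexed_const_def fun_eq_iff)
  ultimately obtain a where a: "a \<in> carrier R" "diff_eval p a = \<zero>" "diff_eval q a \<noteq> \<zero>"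
    using diff_closed[of p q] by auto
  have cl: "(\<delta> ^^ j) a \<in> carrier R" for j by (rule iter_deriv_closed[OF a(1)])
  have m1: "ring_monomial R (\<lambda>j. (\<delta> ^^ j) a) {#j#} = (\<delta> ^^ j) a" for j
    using ring_monomial_replicate[of "\<lambda>j. (\<delta> ^^ j) a" 1 j] cl by simp
  have m0: "ring_monomial R (\<lambda>j. (\<delta> ^^ j) a) {#} = \<one>"
    using ring_monomial_replicate[of "\<lambda>j. (\<delta> ^^ j) a" 0] cl by simp
  have "diff_eval p a = (\<Oplus>m\<in>{{#1#}, {#0#}, {#}}. p m \<otimes> ring_monomial R (\<lambda>j. (\<delta> ^^ j) a) m)"
    by (rule diff_eval_superset[OF _ psub pc a(1)]) simp
  also have "\<dots> = \<delta> a \<oplus> (b \<otimes> a \<oplus> c)"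
    using m1[of 0] m1[of 1] m0 a(1) b c deriv_closed[OF a(1)] by (simp add: p_def)
  finally have "diff_eval p a = \<delta> a \<oplus> (b \<otimes> a \<oplus> c)" .
  moreover have "diff_eval q a = (\<Oplus>m\<in>{{#0#}}. q m \<otimes> ring_monomial R (\<lambda>j. (\<delta> ^^ j) a) m)"
    by (rule diff_eval_superset[OF _ qsub qc a(1)]) simp
  then have "diff_eval q a = a"
    using m1[of 0] a(1) by (simp add: q_def)
  ultimately show ?thesis using a by auto
qed

text \<open>The element \<open>y n\<close> behaves like the exponential of
  \<open>x^(n+1)/(n+1)\<close>. The logarithmic derivative of a monomial in these elements is a
  polynomial in \<open>x\<close> that determines the monomial, so an algebraic relation among them
  is a linear relation between exponentials with distinct exponents.\<close>

lemma infinite_alg_indep: "\<exists>Y. infinite Y \<and> alg_indep Y"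
proof -
  obtain x where x: "x \<in> carrier R" "\<delta> x = \<one>"
  proof -
    \<comment> \<open>With \<open>b = 0\<close> and \<open>c = -1\<close> the equation says that the
      derivative of \<open>x\<close> is 1.\<close>
    obtain x where "x \<in> carrier R" "\<delta> x \<oplus> (\<zero> \<otimes> x \<oplus> \<ominus> \<one>) = \<zero>"
      using linear_differential_equation[of \<zero> "\<ominus> \<one>"] by auto
    then show ?thesis using that[of x] deriv_closed[of x] minus_equality[of "\<delta> x" "\<ominus> \<one>"] by simp
  qed
  have "\<exists>y. y \<in> carrier R \<and> y \<noteq> \<zero> \<and> \<delta> y = x [^] (n::nat) \<otimes> y" for n
  proof -
    obtain y where "y \<in> carrier R" "y \<noteq> \<zero>" "\<delta> y \<oplus> (\<ominus> (x [^] n) \<otimes> y \<oplus> \<zero>) = \<zero>"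
      using linear_differential_equation[of "\<ominus> (x [^] n)" \<zero>] x by auto
    then show ?thesis
      using x deriv_closed[of y] minus_equality[of "\<delta> y" "\<ominus> (x [^] n \<otimes> y)"] by (auto simp: l_minus)
  qed
  then obtain y where y: "\<And>n. y n \<in> carrier R" "\<And>n. y n \<noteq> \<zero>" "\<And>n. \<delta> (y n) = x [^] (n::nat) \<otimes> y n"
    by metis
  \<comment> \<open>Equal elements would have equal logarithmic derivatives \<open>x [^] m\<close>
    and \<open>x [^] n\<close>, but \<open>x\<close> is transcendental.\<close>
  have inj: "inj y"
  proof (rule injI)
    fix m n assume "y m = y n"
    then have "x [^] m \<otimes> y n = x [^] n \<otimes> y n" using y(3) by metis
    then have "x [^] m = x [^] n" using y x by (simp add: m_rcancel)
    then have "upoly x (Polynomial.monom 1 m + - Polynomial.monom 1 n) = \<zero>"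
      using x by (simp only: upoly_add[OF x(1)] upoly_uminus[OF x(1)] upoly_monom[OF x(1)]) (simp add: r_neg)
    then have "Polynomial.monom 1 m + - Polynomial.monom (1::int) n = 0"
      by (rule upoly_eq_0[OF x])
    then have "Polynomial.monom (1::int) m = Polynomial.monom 1 n" by simp
    then show "m = n" by (metis degree_monom_eq one_neq_zero)
  qed
  define ix where "ix = inv_into UNIV y"
  have ix: "ix (y n) = n" for n using inj by (simp add: ix_def)
  have "alg_indep (range y)"
    unfolding alg_indep_def
  proof (intro conjI allI impI)
    show "range y \<subseteq> carrier R" using y by auto
    fix P assume P: "ipoly_vars P \<subseteq> range y" "ring_poly_eval R coord P = \<zero>"
    \<comment> \<open>The logarithmic derivative of the monomial \<open>m\<close>, as a polynomial
      in \<open>x\<close>.\<close>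
    define g where "g m = (\<Sum>v\<in>#m. Polynomial.monom (1::int) (ix v))" for m
    have mon: "ring_monomial R coord m \<noteq> \<zero> \<and>
        \<delta> (ring_monomial R coord m) = upoly x (g m) \<otimes> ring_monomial R coord m"
      if "set_mset m \<subseteq> range y" for m
      using that
    proof (induct m)
      case empty
      then show ?case by (simp add: g_def upoly_0[OF x(1)])
    next
      case (add v m)
      then obtain n where n: "v = y n" by auto
      have v: "coord v = y n" using y n by (simp add: coord_def)
      have m: "ring_monomial R coord m \<in> carrier R" by simp
      have "\<delta> (y n \<otimes> ring_monomial R coord m) =
          upoly x (Polynomial.monom 1 n + g m) \<otimes> (y n \<otimes> ring_monomial R coord m)"
        using add deriv_mult[OF y(1) m, of n] y(1) y(3) m x(1)
        by (simp add: upoly_add upoly_monom l_distr r_distr m_assoc m_lcomm)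
      moreover have "g (add_mset v m) = Polynomial.monom 1 n + g m" by (simp add: g_def n ix)
      ultimately show ?case
        using add y(1,2)[of n] m by (simp add: ring_monomial_add_mset v integral_iff)
    qed
    have "Poly_Mapping.keys P = {}"
    proof (rule exponentials_independent[OF x(1,2)])
      show "finite (Poly_Mapping.keys P)" by simp
      show "ring_monomial R coord m \<in> carrier R" for m by simp
      have sub: "set_mset m \<subseteq> range y" if "m \<in> Poly_Mapping.keys P" for m
        using P(1) that by (auto simp: ipoly_vars_def)
      show "ring_monomial R coord m \<noteq> \<zero>" if "m \<in> Poly_Mapping.keys P" for m
        using mon[OF sub[OF that]] by simp
      show "\<delta> (ring_monomial R coord m) = upoly x (g m) \<otimes> ring_monomial R coord m"
        if "m \<in> Poly_Mapping.keys P" for m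
        using mon[OF sub[OF that]] by simp
      show "inj_on g (Poly_Mapping.keys P)"
      proof (rule inj_onI)
        fix m m' assume m: "m \<in> Poly_Mapping.keys P" "m' \<in> Poly_Mapping.keys P" "g m = g m'"
        \<comment> \<open>The coefficient at degree \<open>n\<close> counts the factors
          \<open>y n\<close>, so \<open>g\<close> is injective on monomials in the
          \<open>y n\<close>.\<close>
        have cnt: "poly.coeff (g k) n = int (count k (y n))" if "set_mset k \<subseteq> range y" for k n
          using that
        proof (induct k)
          case (add v k)
          then obtain n' where "v = y n'" by auto
          then show ?case using add inj by (auto simp: g_def ix inj_eq)
        qed (simp add: g_def)
        show "m = m'"
        proof (rule multiset_eqI)
          fix v
          show "count m v = count m' v"
          proof (cases "v \<in> range y")
            case True
            then show ?thesis using cnt[OF sub[OF m(1)]] cnt[OF sub[OF m(2)]] m(3) by auto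
          next
            case False
            then show ?thesis using sub[OF m(1)] sub[OF m(2)] by (metis not_in_iff subsetD)
          qed
        qed
      qed
      \<comment> \<open>Integer coefficients enter as constant polynomials in
        \<open>x\<close>.\<close>
      show "(\<Oplus>m\<in>Poly_Mapping.keys P. upoly x [:icoeff P m:] \<otimes> ring_monomial R coord m) = \<zero>"
      proof -
        have "(\<Oplus>m\<in>Poly_Mapping.keys P. upoly x [:icoeff P m:] \<otimes> ring_monomial R coord m) = ring_poly_eval R coord P"
          unfolding ring_poly_eval_def using x(1)
          by (intro finsum_cong') (auto simp: upoly_pCons upoly_0 add_pow_ldistr_int)
        then show ?thesis using P(2) by simp
      qed
      show "[:icoeff P m:] \<noteq> 0" if "m \<in> Poly_Mapping.keys P" for m
        using that by (simp add: in_keys_iff)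
    qed
    then show "P = 0" by simp
  qed
  moreover have "infinite (range y)" using inj by (simp add: finite_image_iff)
  ultimately show ?thesis by blast
qed

end

section \<open>Derivations that vanish on the coefficients of an algebraic relation\<close>

context differential_field
begin

lemma deriv_int_multiple:
  assumes "a \<in> carrier R"
  shows "\<delta> ([(k::int)] \<cdot> a) = [k] \<cdot> \<delta> a"
proof -
  have nat: "\<delta> ([(n::nat)] \<cdot> a) = [n] \<cdot> \<delta> a" for n
    using assms by (induct n) (auto simp: deriv_add)
  show ?thesis
    using assms nat by (cases "k \<ge> 0") (auto simp: add_pow_int_ge add_pow_int_lt deriv_uminus deriv_closed)
qed

lemma deriv_power:
  assumes "a \<in> carrier R"
  shows "\<delta> (a [^] Suc n) = [Suc n] \<cdot> (a [^] n) \<otimes> \<delta> a"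
proof (induct n)
  case 0
  then show ?case using assms deriv_closed by simp
next
  case (Suc n)
  have "\<delta> (a [^] Suc (Suc n)) = \<delta> (a [^] Suc n) \<otimes> a \<oplus> a [^] Suc n \<otimes> \<delta> a"
    using assms deriv_mult[of "a [^] Suc n" a] by simp
  also have "\<dots> = [Suc n] \<cdot> (a [^] Suc n) \<otimes> \<delta> a \<oplus> a [^] Suc n \<otimes> \<delta> a"
    using assms deriv_closed[OF assms]
    by (simp only: Suc) (simp add: m_ac add_pow_ldistr add_pow_rdistr del: add.nat_pow_Suc)
  also have "\<dots> = [Suc (Suc n)] \<cdot> (a [^] Suc n) \<otimes> \<delta> a"
    using assms deriv_closed[OF assms]
    by (simp only: add.nat_pow_Suc[of "Suc n"]) (simp add: l_distr del: add.nat_pow_Suc nat_pow_Suc)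
  finally show ?case .
qed

lemma deriv_poly_eval_eq_zero:
  assumes x: "\<And>v. x v \<in> carrier R" and dx: "\<And>v. v \<in> ipoly_vars P \<Longrightarrow> \<delta> (x v) = \<zero>"
  shows "\<delta> (ring_poly_eval R x P) = \<zero>"
proof -
  have mon: "\<delta> (ring_monomial R x m) = \<zero>" if "\<And>v. v \<in># m \<Longrightarrow> \<delta> (x v) = \<zero>" for m
    using that
  proof (induct m)
    case (add v m)
    then show ?case
      using x by (simp add: ring_monomial_add_mset[OF x] deriv_mult ring_monomial_closed[OF x])
  qed (simp add: ring_monomial_empty[OF x])
  have "\<delta> (ring_poly_eval R x P) = (\<Oplus>m\<in>Poly_Mapping.keys P. \<delta> ([icoeff P m] \<cdot> ring_monomial R x m))"
    unfolding ring_poly_eval_def by (rule deriv_finsum) (auto simp: ring_monomial_closed[OF x])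
  also have "\<dots> = (\<Oplus>m\<in>Poly_Mapping.keys P. \<zero>)"
  proof (rule finsum_cong')
    fix m assume "m \<in> Poly_Mapping.keys P"
    then have "\<delta> (ring_monomial R x m) = \<zero>" by (intro mon dx) (auto simp: ipoly_vars_def)
    then show "\<delta> ([icoeff P m] \<cdot> ring_monomial R x m) = \<zero>"
      by (simp add: deriv_int_multiple ring_monomial_closed[OF x])
  qed auto
  finally show ?thesis by simp
qed

text \<open>Applying \<open>\<delta>\<close> to the relation gives
  \<open>S \<otimes> \<delta> a = \<zero>\<close>, where \<open>S\<close> is the formal derivative
  at \<open>a\<close>. If \<open>S\<close> is zero, it is a relation of lower degree, again with
  coefficients killed by \<open>\<delta>\<close>, and the induction applies. Should all its
  coefficients vanish, then in characteristic zero the given relation reduces to its constant term,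
  which must vanish as well.\<close>

lemma deriv_algebraic_eq_zero:
  fixes n :: nat
  assumes a: "a \<in> carrier R"
    and c: "\<And>i. c i \<in> carrier R" "\<And>i. \<delta> (c i) = \<zero>" "\<exists>i\<le>n. c i \<noteq> \<zero>"
    and rel: "(\<Oplus>i\<in>{..n}. c i \<otimes> a [^] i) = \<zero>"
  shows "\<delta> a = \<zero>"
  using c rel
proof (induct n arbitrary: c)
  case 0
  then show ?case by simp
next
  case (Suc n)
  have cc: "c i \<in> carrier R" for i by (rule Suc.prems(1))
  have da: "\<delta> a \<in> carrier R" using a by (rule deriv_closed)
  define d where "d i = [Suc i] \<cdot> c (Suc i)" for i
  have dc: "d i \<in> carrier R" for i using cc by (simp add: d_def del: add.nat_pow_Suc)
  define S where "S = (\<Oplus>i\<in>{..n}. d i \<otimes> a [^] i)"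
  have Sc: "S \<in> carrier R" unfolding S_def using dc a by (intro finsum_closed) auto
  have term0: "\<delta> (c 0 \<otimes> a [^] (0::nat)) = \<zero>" using cc Suc.prems(2) by simp
  have termS: "\<delta> (c (Suc i) \<otimes> a [^] Suc i) = d i \<otimes> a [^] i \<otimes> \<delta> a" for i
  proof -
    have "\<delta> (c (Suc i) \<otimes> a [^] Suc i) = c (Suc i) \<otimes> ([Suc i] \<cdot> (a [^] i) \<otimes> \<delta> a)"
      using deriv_mult[of "c (Suc i)" "a [^] Suc i"] cc a da Suc.prems(2)[of "Suc i"] deriv_power[OF a, of i]
      by (simp del: nat_pow_Suc add.nat_pow_Suc)
    also have "\<dots> = d i \<otimes> a [^] i \<otimes> \<delta> a"
      using cc a da by (simp add: d_def m_ac add_pow_ldistr add_pow_rdistr del: add.nat_pow_Suc)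
    finally show ?thesis .
  qed
  have "\<zero> = \<delta> (\<Oplus>i\<in>{..Suc n}. c i \<otimes> a [^] i)" using Suc.prems(4) by simp
  also have "\<dots> = (\<Oplus>i\<in>{..Suc n}. \<delta> (c i \<otimes> a [^] i))"
    using cc a by (intro deriv_finsum) auto
  also have "\<dots> = (\<Oplus>i\<in>{..n}. \<delta> (c (Suc i) \<otimes> a [^] Suc i)) \<oplus> \<delta> (c 0 \<otimes> a [^] (0::nat))"
    using cc a deriv_closed by (intro finsum_Suc2) auto
  also have "\<dots> = (\<Oplus>i\<in>{..n}. d i \<otimes> a [^] i \<otimes> \<delta> a)"
    unfolding term0 termS using dc a da by simp
  also have "\<dots> = S \<otimes> \<delta> a"
    unfolding S_def using dc a da by (intro finsum_ldistr[symmetric]) auto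
  finally have S0: "S = \<zero> \<or> \<delta> a = \<zero>" using integral[OF _ Sc da] by simp
  show ?case
  proof (cases "\<delta> a = \<zero>")
    case False
    then have "S = \<zero>" using S0 by simp
    show ?thesis
    proof (cases "\<exists>i\<le>n. d i \<noteq> \<zero>")
      case True
      have "\<delta> (d i) = \<zero>" for i
        using deriv_int_multiple[OF cc[of "Suc i"], of "int (Suc i)"] Suc.prems(2)[of "Suc i"]
        by (simp add: d_def add_pow_int_ge del: add.nat_pow_Suc of_nat_Suc)
      then show ?thesis using Suc.hyps[of d] dc True \<open>S = \<zero>\<close> by (simp add: S_def)
    next
      case no: False
      have cS: "c (Suc i) = \<zero>" if "i \<le> n" for i
      proof -
        have "[Suc i] \<cdot> \<one> \<otimes> c (Suc i) = \<zero>"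
          using no that cc[of "Suc i"] by (simp add: d_def add_pow_ldistr del: add.nat_pow_Suc)
        then show ?thesis using char_zero[of "Suc i"] cc[of "Suc i"] integral[of "[Suc i] \<cdot> \<one>" "c (Suc i)"]
          by (simp del: add.nat_pow_Suc)
      qed
      have "(\<Oplus>i\<in>{..Suc n}. c i \<otimes> a [^] i) = (\<Oplus>i\<in>{..n}. c (Suc i) \<otimes> a [^] Suc i) \<oplus> c 0 \<otimes> a [^] (0::nat)"
        using cc a by (intro finsum_Suc2) auto
      also have "(\<Oplus>i\<in>{..n}. c (Suc i) \<otimes> a [^] Suc i) = (\<Oplus>i\<in>{..n}. \<zero>)"
        using cS a by (intro finsum_cong') auto
      finally have "c 0 = \<zero>" using Suc.prems(4) cc by simp
      then have "c i = \<zero>" if "i \<le> Suc n" for i using cS that by (cases i) auto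
      then show ?thesis using Suc.prems(3) by blast
    qed
  qed
qed

end

section \<open>Difference and transport of derivations\<close>

context differential_field
begin

text \<open>Reduces the equality of two derivations to the vanishing of a single one.\<close>

lemma differential_field_diff:
  assumes "differential_field R \<delta>'"
  shows "differential_field R (\<lambda>a. \<delta> a \<ominus> \<delta>' a)"
proof -
  interpret D: differential_field R \<delta>' by fact
  show ?thesis
  proof (intro differential_field.intro differential_field_axioms.intro field_axioms char_zero)
    fix x assume x: "x \<in> carrier R"
    then show "\<delta> x \<ominus> \<delta>' x \<in> carrier R" using deriv_closed D.deriv_closed by simp
  next
    fix x y assume xy: "x \<in> carrier R" "y \<in> carrier R"
    note c = xy deriv_closed[OF xy(1)] deriv_closed[OF xy(2)] D.deriv_closed[OF xy(1)] D.deriv_closed[OF xy(2)]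
    show "\<delta> (x \<oplus> y) \<ominus> \<delta>' (x \<oplus> y) = \<delta> x \<ominus> \<delta>' x \<oplus> (\<delta> y \<ominus> \<delta>' y)"
      unfolding deriv_add[OF xy] D.deriv_add[OF xy] using c by algebra
    show "\<delta> (x \<otimes> y) \<ominus> \<delta>' (x \<otimes> y) = (\<delta> x \<ominus> \<delta>' x) \<otimes> y \<oplus> x \<otimes> (\<delta> y \<ominus> \<delta>' y)"
      unfolding deriv_mult[OF xy] D.deriv_mult[OF xy] using c by algebra
  qed
qed

lemma differential_field_transport:
  assumes N: "field N" and \<phi>: "\<phi> \<in> ring_iso R N"
  shows "differential_field N (\<lambda>b. \<phi> (\<delta> (inv_into (carrier R) \<phi> b)))"
proof -
  interpret N: field N by fact
  have hom: "\<phi> \<in> ring_hom R N" and bij: "bij_betw \<phi> (carrier R) (carrier N)"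
    using \<phi> by (auto simp: ring_iso_def)
  interpret h: ring_hom_cring R N \<phi>
    by (intro ring_hom_cring.intro ring_hom_cring_axioms.intro is_cring N.is_cring hom)
  let ?\<psi> = "inv_into (carrier R) \<phi>"
  have \<phi>\<psi>: "\<phi> (?\<psi> b) = b" if "b \<in> carrier N" for b using bij_betw_inv_into_right[OF bij that] .
  have \<psi>\<phi>: "?\<psi> (\<phi> a) = a" if "a \<in> carrier R" for a using bij_betw_inv_into_left[OF bij that] .
  have \<psi>c: "?\<psi> b \<in> carrier R" if "b \<in> carrier N" for b
    using bij_betw_apply[OF bij_betw_inv_into[OF bij] that] .
  have \<psi>add: "?\<psi> (b \<oplus>\<^bsub>N\<^esub> b') = ?\<psi> b \<oplus> ?\<psi> b'" if "b \<in> carrier N" "b' \<in> carrier N" for b b'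
    using \<psi>\<phi>[of "?\<psi> b \<oplus> ?\<psi> b'"] \<phi>\<psi> \<psi>c that by simp
  have \<psi>mult: "?\<psi> (b \<otimes>\<^bsub>N\<^esub> b') = ?\<psi> b \<otimes> ?\<psi> b'" if "b \<in> carrier N" "b' \<in> carrier N" for b b'
    using \<psi>\<phi>[of "?\<psi> b \<otimes> ?\<psi> b'"] \<phi>\<psi> \<psi>c that by simp
  have \<phi>nat: "\<phi> ([(n::nat)] \<cdot> \<one>) = [n] \<cdot>\<^bsub>N\<^esub> \<one>\<^bsub>N\<^esub>" for n by (induct n) auto
  have inj: "\<phi> a = \<zero>\<^bsub>N\<^esub> \<Longrightarrow> a = \<zero>" if "a \<in> carrier R" for a
    using \<psi>\<phi>[OF that] \<psi>\<phi>[OF zero_closed] h.hom_zero by simp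
  show ?thesis
  proof (intro differential_field.intro differential_field_axioms.intro N)
    fix n :: nat assume "0 < n"
    then show "[n] \<cdot>\<^bsub>N\<^esub> \<one>\<^bsub>N\<^esub> \<noteq> \<zero>\<^bsub>N\<^esub>"
      using inj[of "[n] \<cdot> \<one>"] char_zero[of n] \<phi>nat[of n] by auto
  next
    fix b assume "b \<in> carrier N"
    then show "\<phi> (\<delta> (?\<psi> b)) \<in> carrier N" using \<psi>c deriv_closed by simp
  next
    fix b b' assume b: "b \<in> carrier N" "b' \<in> carrier N"
    note c = \<psi>c[OF b(1)] \<psi>c[OF b(2)] deriv_closed[OF \<psi>c[OF b(1)]] deriv_closed[OF \<psi>c[OF b(2)]]
    show "\<phi> (\<delta> (?\<psi> (b \<oplus>\<^bsub>N\<^esub> b'))) = \<phi> (\<delta> (?\<psi> b)) \<oplus>\<^bsub>N\<^esub> \<phi> (\<delta> (?\<psi> b'))"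
      using c by (simp add: \<psi>add[OF b] deriv_add)
    show "\<phi> (\<delta> (?\<psi> (b \<otimes>\<^bsub>N\<^esub> b'))) = \<phi> (\<delta> (?\<psi> b)) \<otimes>\<^bsub>N\<^esub> b' \<oplus>\<^bsub>N\<^esub> b \<otimes>\<^bsub>N\<^esub> \<phi> (\<delta> (?\<psi> b'))"
      using c by (simp add: \<psi>mult[OF b] deriv_mult \<phi>\<psi> b)
  qed
qed

end

section \<open>Functions algebraic over the coordinates\<close>

text \<open>Gaussian elimination by cross-multiplication, which needs no division but only the
  absence of zero divisors. \<open>S\<close> is a subring that contains all coefficients; later it
  restricts the variables of polynomials.\<close>

lemma homogeneous_system_solution:
  fixes B :: "'i \<Rightarrow> 'j \<Rightarrow> 'r::comm_ring_1"
  assumes nzd: "\<And>a b::'r. a * b = 0 \<Longrightarrow> a = 0 \<or> b = 0"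
    and S: "1 \<in> S" "0 \<in> S" "\<And>a b. a \<in> S \<Longrightarrow> b \<in> S \<Longrightarrow> a + b \<in> S" "\<And>a b. a \<in> S \<Longrightarrow> b \<in> S \<Longrightarrow> a * b \<in> S"
      "\<And>a. a \<in> S \<Longrightarrow> - a \<in> S"
    and J: "finite J" and I: "finite I" "card J < card I"
    and B: "\<And>i j. i \<in> I \<Longrightarrow> j \<in> J \<Longrightarrow> B i j \<in> S"
  shows "\<exists>b. (\<forall>i\<in>I. b i \<in> S) \<and> (\<exists>i\<in>I. b i \<noteq> 0) \<and> (\<forall>j\<in>J. (\<Sum>i\<in>I. b i * B i j) = 0)"
  using J I B
proof (induct J arbitrary: I B rule: finite_induct)
  case empty
  then have "I \<noteq> {}" by auto
  then show ?case using S by (intro exI[of _ "\<lambda>_. 1"]) auto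
next
  case (insert m J)
  show ?case
  proof (cases "\<forall>i\<in>I. B i m = 0")
    case True
    then show ?thesis using insert.hyps(3)[of I B] insert.prems insert.hyps(1,2) by auto
  next
    case False
    then obtain k where k: "k \<in> I" "B k m \<noteq> 0" by blast
    define I' where "I' = I - {k}"
    have I': "finite I'" "I = insert k I'" "k \<notin> I'" using k insert.prems by (auto simp: I'_def)
    \<comment> \<open>Cross-multiplication with row \<open>k\<close> makes the entry in column
      \<open>m\<close> vanish.\<close>
    define B' where "B' i j = B k m * B i j + - (B i m * B k j)" for i j
    have "card J < card I'" using insert.prems(2) insert.hyps(1,2) I' by simp
    moreover have "B' i j \<in> S" if "i \<in> I'" "j \<in> J" for i j
      unfolding B'_def using that k insert.prems(3) I' by (intro S) auto
    ultimately obtain b where b: "\<forall>i\<in>I'. b i \<in> S" "\<exists>i\<in>I'. b i \<noteq> 0" "\<forall>j\<in>J. (\<Sum>i\<in>I'. b i * B' i j) = 0"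
      using insert.hyps(3)[of I' B'] I'(1) by auto
    \<comment> \<open>After the other unknowns are scaled by the pivot \<open>B k m\<close>, the
      equation at \<open>m\<close> is solved by this value of the unknown \<open>k\<close> without
      division.\<close>
    define s where "s = - (\<Sum>i\<in>I'. b i * B i m)"
    have sumS: "(\<Sum>i\<in>A. F i) \<in> S" if "\<And>i. i \<in> A \<Longrightarrow> F i \<in> S" for A and F :: "'i \<Rightarrow> 'r"
      using that by (induct A rule: infinite_finite_induct) (auto intro: S)
    have sS: "s \<in> S"
      unfolding s_def using b(1) insert.prems(3) I' by (intro S sumS) auto
    define b' where "b' i = (if i = k then s else B k m * b i)" for i
    have sum: "(\<Sum>i\<in>I. b' i * B i j) = s * B k j + B k m * (\<Sum>i\<in>I'. b i * B i j)" for j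
    proof -
      have "(\<Sum>i\<in>I'. b' i * B i j) = (\<Sum>i\<in>I'. B k m * (b i * B i j))"
        using I' by (intro sum.cong) (auto simp: b'_def mult.assoc)
      then show ?thesis using I' by (simp add: b'_def sum_distrib_left)
    qed
    show ?thesis
    proof (intro exI[of _ b'] conjI ballI)
      show "b' i \<in> S" if "i \<in> I" for i
        using that b(1) sS k insert.prems(3) I' by (auto simp: b'_def intro!: S)
      show "\<exists>i\<in>I. b' i \<noteq> 0"
      proof -
        obtain i where "i \<in> I'" "b i \<noteq> 0" using b(2) by blast
        then show ?thesis using I' k nzd by (intro bexI[of _ i]) (auto simp: b'_def)
      qed
      show "(\<Sum>i\<in>I. b' i * B i j) = 0" if "j \<in> insert m J" for j
      proof (cases "j = m")
        case True
        then show ?thesis by (simp add: sum s_def mult.commute)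
      next
        case False
        then have "(\<Sum>i\<in>I'. b i * B' i j) = 0" using b(3) that by auto
        moreover have "(\<Sum>i\<in>I'. b i * B' i j) = s * B k j + B k m * (\<Sum>i\<in>I'. b i * B i j)"
          by (simp add: B'_def s_def algebra_simps sum_subtractf sum_distrib_left sum_distrib_right)
        ultimately show ?thesis by (simp add: sum)
      qed
    qed
  qed
qed

text \<open>No regularity of \<open>f\<close> is asked for, so that closure properties become pure
  algebra and holomorphy is handled separately.\<close>

definition Q_algebraic_fun :: "'t set \<Rightarrow> ('t \<Rightarrow> complex) set \<Rightarrow> (('t \<Rightarrow> complex) \<Rightarrow> complex) \<Rightarrow> bool"
  where "Q_algebraic_fun T U f \<longleftrightarrow> (\<exists>n C. (\<forall>i. ipoly_vars (C i) \<subseteq> T) \<and> (\<exists>i\<le>n. C i \<noteq> 0) \<and>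
    (\<forall>x\<in>U. (\<Sum>i\<le>n. ipoly_eval (C i) x * f x ^ i) = 0))"

lemma Q_algebraic_fun_iff_qpoly:
  "Q_algebraic_fun T U f \<longleftrightarrow>
    (\<exists>P::'t option qpoly. P \<noteq> 0 \<and> qpoly_vars P \<subseteq> insert None (Some ` T) \<and>
      (\<forall>x\<in>U. qpoly_eval P (case_option (f x) x) = 0))" (is "_ \<longleftrightarrow> ?R")
proof
  assume "Q_algebraic_fun T U f"
  then obtain n C i where C: "\<And>i. ipoly_vars (C i) \<subseteq> T" "i \<le> n" "C i \<noteq> 0"
    "\<forall>x\<in>U. (\<Sum>i\<le>n. ipoly_eval (C i) x * f x ^ i) = 0"
    unfolding Q_algebraic_fun_def by blast
  then show ?R using ipoly_relation_to_qpoly[of C T i n] by metis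
next
  assume ?R
  then obtain P :: "'t option qpoly" where P: "P \<noteq> 0" "qpoly_vars P \<subseteq> insert None (Some ` T)"
    "\<forall>x\<in>U. qpoly_eval P (case_option (f x) x) = 0" by blast
  then show "Q_algebraic_fun T U f"
    unfolding Q_algebraic_fun_def using qpoly_relation_to_ipoly[OF P(1,2)] by metis
qed

section \<open>Sums, products and roots of algebraic functions\<close>

context
  fixes T :: "'t set" and U :: "('t \<Rightarrow> complex) set"
begin

abbreviation (input) coeffs_over :: "'t ipoly set"
  where "coeffs_over \<equiv> {P. ipoly_vars P \<subseteq> T}"

lemma coeffs_over_closed:
  "1 \<in> coeffs_over" "0 \<in> coeffs_over"
  "P \<in> coeffs_over \<Longrightarrow> Q \<in> coeffs_over \<Longrightarrow> P + Q \<in> coeffs_over"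
  "P \<in> coeffs_over \<Longrightarrow> Q \<in> coeffs_over \<Longrightarrow> P * Q \<in> coeffs_over"
  "P \<in> coeffs_over \<Longrightarrow> - P \<in> coeffs_over"
  using ipoly_vars_add[of P Q] ipoly_vars_mult[of P Q] by (auto simp: ipoly_vars_def[of 1])

text \<open>Linear dependence over the coordinate polynomials up to a nonzero denominator. Torsion is
  allowed: no coefficient is ever divided by.\<close>

definition rspan :: "'j set \<Rightarrow> ('j \<Rightarrow> ('t \<Rightarrow> complex) \<Rightarrow> complex) \<Rightarrow> (('t \<Rightarrow> complex) \<Rightarrow> complex) \<Rightarrow> bool"
  where "rspan J v w \<longleftrightarrow> (\<exists>c B. c \<in> coeffs_over \<and> c \<noteq> 0 \<and> (\<forall>j\<in>J. B j \<in> coeffs_over) \<and>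
    (\<forall>x\<in>U. ipoly_eval c x * w x = (\<Sum>j\<in>J. ipoly_eval (B j) x * v j x)))"

text \<open>\<open>v\<close> takes the part of the finite generating system of a module stable under
  \<open>h\<close>, as in the classical proof that sums and products of algebraic elements are
  algebraic.\<close>

definition multiplier :: "'j set \<Rightarrow> ('j \<Rightarrow> ('t \<Rightarrow> complex) \<Rightarrow> complex) \<Rightarrow> (('t \<Rightarrow> complex) \<Rightarrow> complex) \<Rightarrow> bool"
  where "multiplier J v h \<longleftrightarrow> (\<forall>j\<in>J. rspan J v (\<lambda>x. h x * v j x))"

lemma rspan_cong: "rspan J v w \<Longrightarrow> (\<And>x. x \<in> U \<Longrightarrow> w x = w' x) \<Longrightarrow> rspan J v w'"
  unfolding rspan_def by auto

lemma rspan_zero: "rspan J v (\<lambda>_. 0)"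
  unfolding rspan_def using coeffs_over_closed by (intro exI[of _ 1] exI[of _ "\<lambda>_. 0"]) auto

lemma rspan_add:
  assumes "rspan J v w" "rspan J v w'"
  shows "rspan J v (\<lambda>x. w x + w' x)"
proof -
  obtain c B where c: "c \<in> coeffs_over" "c \<noteq> 0" "\<forall>j\<in>J. B j \<in> coeffs_over"
    "\<forall>x\<in>U. ipoly_eval c x * w x = (\<Sum>j\<in>J. ipoly_eval (B j) x * v j x)"
    using assms(1) unfolding rspan_def by blast
  obtain c' B' where c': "c' \<in> coeffs_over" "c' \<noteq> 0" "\<forall>j\<in>J. B' j \<in> coeffs_over"
    "\<forall>x\<in>U. ipoly_eval c' x * w' x = (\<Sum>j\<in>J. ipoly_eval (B' j) x * v j x)"
    using assms(2) unfolding rspan_def by blast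
  have "ipoly_eval (c * c') x * (w x + w' x) = (\<Sum>j\<in>J. ipoly_eval (c' * B j + c * B' j) x * v j x)" if "x \<in> U" for x
  proof -
    have "ipoly_eval (c * c') x * (w x + w' x) =
        ipoly_eval c' x * (ipoly_eval c x * w x) + ipoly_eval c x * (ipoly_eval c' x * w' x)"
      by (simp add: algebra_simps)
    also have "\<dots> = (\<Sum>j\<in>J. ipoly_eval (c' * B j + c * B' j) x * v j x)"
      using c(4) c'(4) that by (simp add: sum_distrib_left sum.distrib algebra_simps)
    finally show ?thesis .
  qed
  moreover have "c * c' \<noteq> 0" using c(2) c'(2) ipoly_no_zero_divisors by blast
  moreover have "c * c' \<in> coeffs_over" using c(1) c'(1) by (rule coeffs_over_closed)
  moreover have "\<forall>j\<in>J. c' * B j + c * B' j \<in> coeffs_over"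
    using c(1,3) c'(1,3) by (intro ballI coeffs_over_closed) auto
  ultimately show ?thesis
    unfolding rspan_def by (intro exI[of _ "c * c'"] exI[of _ "\<lambda>j. c' * B j + c * B' j"]) blast
qed

lemma rspan_sum: "(\<And>i. i \<in> A \<Longrightarrow> rspan J v (w i)) \<Longrightarrow> rspan J v (\<lambda>x. \<Sum>i\<in>A. w i x)"
  by (induct A rule: infinite_finite_induct) (auto intro: rspan_add rspan_zero)

lemma rspan_scale:
  assumes "rspan J v w" "P \<in> coeffs_over"
  shows "rspan J v (\<lambda>x. ipoly_eval P x * w x)"
proof -
  obtain c B where c: "c \<in> coeffs_over" "c \<noteq> 0" "\<forall>j\<in>J. B j \<in> coeffs_over"
    "\<forall>x\<in>U. ipoly_eval c x * w x = (\<Sum>j\<in>J. ipoly_eval (B j) x * v j x)"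
    using assms(1) unfolding rspan_def by blast
  have "\<forall>x\<in>U. ipoly_eval c x * (ipoly_eval P x * w x) = (\<Sum>j\<in>J. ipoly_eval (P * B j) x * v j x)"
    using c(4) by (simp add: mult.left_commute sum_distrib_left mult.assoc)
  moreover have "\<forall>j\<in>J. P * B j \<in> coeffs_over" using c(3) assms(2) by (intro ballI coeffs_over_closed) auto
  ultimately show ?thesis
    unfolding rspan_def using c by (intro exI[of _ c] exI[of _ "\<lambda>j. P * B j"]) blast
qed

text \<open>The factor \<open>P\<close> is absorbed into the denominator and not inverted, so zeros
  of \<open>P\<close> in \<open>U\<close> do no harm.\<close>

lemma rspan_cancel:
  assumes "rspan J v (\<lambda>x. ipoly_eval P x * w x)" "P \<in> coeffs_over" "P \<noteq> 0"
  shows "rspan J v w"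
proof -
  obtain c B where c: "c \<in> coeffs_over" "c \<noteq> 0" "\<forall>j\<in>J. B j \<in> coeffs_over"
    "\<forall>x\<in>U. ipoly_eval c x * (ipoly_eval P x * w x) = (\<Sum>j\<in>J. ipoly_eval (B j) x * v j x)"
    using assms(1) unfolding rspan_def by blast
  have "\<forall>x\<in>U. ipoly_eval (c * P) x * w x = (\<Sum>j\<in>J. ipoly_eval (B j) x * v j x)"
    using c(4) by (simp add: mult.assoc)
  moreover have "c * P \<noteq> 0" using c(2) assms(3) ipoly_no_zero_divisors by blast
  moreover have "c * P \<in> coeffs_over" using c(1) assms(2) by (rule coeffs_over_closed)
  ultimately show ?thesis
    unfolding rspan_def using c(3) by (intro exI[of _ "c * P"] exI[of _ B]) blast
qed

lemma rspan_base:
  assumes "finite J" "j \<in> J"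
  shows "rspan J v (v j)"
  unfolding rspan_def using assms coeffs_over_closed(1,2)
  by (intro exI[of _ 1] exI[of _ "\<lambda>i. if i = j then 1 else 0"])
    (auto simp: if_distrib[of "\<lambda>P. ipoly_eval P _ * _"] cong: if_cong)

lemma rspan_multiplier:
  assumes h: "multiplier J v h" and "rspan J v w"
  shows "rspan J v (\<lambda>x. h x * w x)"
proof -
  obtain c B where c: "c \<in> coeffs_over" "c \<noteq> 0" "\<forall>j\<in>J. B j \<in> coeffs_over"
    "\<forall>x\<in>U. ipoly_eval c x * w x = (\<Sum>j\<in>J. ipoly_eval (B j) x * v j x)"
    using assms(2) unfolding rspan_def by blast
  have "rspan J v (\<lambda>x. \<Sum>j\<in>J. ipoly_eval (B j) x * (h x * v j x))"
    using h c(3) unfolding multiplier_def by (intro rspan_sum rspan_scale) auto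
  then have "rspan J v (\<lambda>x. ipoly_eval c x * (h x * w x))"
  proof (rule rspan_cong)
    fix x assume "x \<in> U"
    then have "ipoly_eval c x * (h x * w x) = h x * (\<Sum>j\<in>J. ipoly_eval (B j) x * v j x)"
      using c(4) by (simp add: mult.left_commute)
    then show "(\<Sum>j\<in>J. ipoly_eval (B j) x * (h x * v j x)) = ipoly_eval c x * (h x * w x)"
      by (simp add: sum_distrib_left mult.left_commute)
  qed
  then show ?thesis using c(1,2) by (rule rspan_cancel)
qed

lemma multiplier_add: "multiplier J v f \<Longrightarrow> multiplier J v g \<Longrightarrow> multiplier J v (\<lambda>x. f x + g x)"
  unfolding multiplier_def by (auto simp: distrib_right intro!: rspan_add)

lemma multiplier_mult:
  assumes "multiplier J v f" "multiplier J v g"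
  shows "multiplier J v (\<lambda>x. f x * g x)"
  using assms(2) rspan_multiplier[OF assms(1)] unfolding multiplier_def by (auto simp: mult.assoc)

lemma multiplier_poly:
  assumes "finite J" "P \<in> coeffs_over"
  shows "multiplier J v (ipoly_eval P)"
  using assms unfolding multiplier_def by (auto intro: rspan_scale rspan_base)

text \<open>The powers of \<open>h\<close> with exponents \<open>0\<close> to \<open>card J\<close>
  all lie in the span of \<open>card J\<close> functions, because the span contains 1 and is stable
  under \<open>h\<close>. These \<open>card J + 1\<close> functions are linearly dependent, and a
  dependence between powers is an algebraic relation.\<close>

lemma multiplier_algebraic:
  assumes J: "finite J" "j0 \<in> J" "\<And>x. x \<in> U \<Longrightarrow> v j0 x = 1" and h: "multiplier J v h"
  shows "Q_algebraic_fun T U h"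
proof -
  have "rspan J v (\<lambda>x. h x ^ k)" for k
  proof (induct k)
    case 0
    show ?case by (rule rspan_cong[OF rspan_base[OF J(1,2)]]) (simp add: J(3))
  next
    case (Suc k)
    show ?case using rspan_multiplier[OF h Suc] by simp
  qed
  then have "\<forall>k. \<exists>c B. c \<in> coeffs_over \<and> c \<noteq> 0 \<and> (\<forall>j\<in>J. B j \<in> coeffs_over) \<and>
    (\<forall>x\<in>U. ipoly_eval c x * h x ^ k = (\<Sum>j\<in>J. ipoly_eval (B j) x * v j x))"
    unfolding rspan_def by (rule allI)
  from choice[OF this] obtain c where "\<forall>k. \<exists>B. c k \<in> coeffs_over \<and> c k \<noteq> 0 \<and> (\<forall>j\<in>J. B j \<in> coeffs_over) \<and>
    (\<forall>x\<in>U. ipoly_eval (c k) x * h x ^ k = (\<Sum>j\<in>J. ipoly_eval (B j) x * v j x))" by (rule exE)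
  from choice[OF this] obtain B where cB: "\<forall>k. c k \<in> coeffs_over \<and> c k \<noteq> 0 \<and> (\<forall>j\<in>J. B k j \<in> coeffs_over) \<and>
    (\<forall>x\<in>U. ipoly_eval (c k) x * h x ^ k = (\<Sum>j\<in>J. ipoly_eval (B k j) x * v j x))" by (rule exE)
  have c: "c k \<in> coeffs_over" "c k \<noteq> 0" for k using cB by simp_all
  have B: "B k j \<in> coeffs_over" if "j \<in> J" for k j using cB that by simp
  have eq: "ipoly_eval (c k) x * h x ^ k = (\<Sum>j\<in>J. ipoly_eval (B k j) x * v j x)" if "x \<in> U" for k x
    using cB that by simp
  have "\<exists>b. (\<forall>i\<in>{..card J}. b i \<in> coeffs_over) \<and> (\<exists>i\<in>{..card J}. b i \<noteq> 0) \<and>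
      (\<forall>j\<in>J. (\<Sum>i\<in>{..card J}. b i * B i j) = 0)"
    by (rule homogeneous_system_solution[OF ipoly_no_zero_divisors coeffs_over_closed J(1)]) (use B in auto)
  then obtain b where b: "\<And>i. i \<le> card J \<Longrightarrow> b i \<in> coeffs_over" "\<exists>i\<le>card J. b i \<noteq> 0"
    "\<And>j. j \<in> J \<Longrightarrow> (\<Sum>i\<le>card J. b i * B i j) = 0" by auto
  \<comment> \<open>The scalars of the dependence times the denominators collected for the
    powers.\<close>
  define C where "C k = (if k \<le> card J then b k * c k else 0)" for k
  have "ipoly_vars (C k) \<subseteq> T" for k
    using coeffs_over_closed(4)[of "b k" "c k"] b(1) c(1) by (auto simp: C_def)
  moreover have "\<exists>k\<le>card J. C k \<noteq> 0"
  proof -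
    obtain k where k: "k \<le> card J" "b k \<noteq> 0" using b(2) by auto
    then have "b k * c k \<noteq> 0" using c(2)[of k] ipoly_no_zero_divisors[of "b k" "c k"] by auto
    then show ?thesis using k by (intro exI[of _ k]) (simp add: C_def)
  qed
  moreover have "(\<Sum>k\<le>card J. ipoly_eval (C k) x * h x ^ k) = 0" if x: "x \<in> U" for x
  proof -
    have "(\<Sum>k\<le>card J. ipoly_eval (C k) x * h x ^ k) =
        (\<Sum>k\<le>card J. ipoly_eval (b k) x * (\<Sum>j\<in>J. ipoly_eval (B k j) x * v j x))"
      using eq[OF x] by (intro sum.cong) (auto simp: C_def mult.assoc)
    also have "\<dots> = (\<Sum>k\<le>card J. \<Sum>j\<in>J. ipoly_eval (b k * B k j) x * v j x)"
      by (simp add: sum_distrib_left mult.assoc)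
    also have "\<dots> = (\<Sum>j\<in>J. \<Sum>k\<le>card J. ipoly_eval (b k * B k j) x * v j x)"
      by (rule sum.swap)
    also have "\<dots> = (\<Sum>j\<in>J. ipoly_eval (\<Sum>k\<le>card J. b k * B k j) x * v j x)"
      by (simp only: ipoly_eval_sum sum_distrib_right)
    also have "\<dots> = 0" using b(3) by simp
    finally show ?thesis .
  qed
  ultimately show ?thesis unfolding Q_algebraic_fun_def by blast
qed

text \<open>Adjoining \<open>h\<close> to the family: the products of the old functions with
  \<open>h ^ k\<close> for \<open>k < n\<close> are stable under \<open>h\<close>, because the
  relation rewrites \<open>h ^ n\<close>. Its coefficients need only be multipliers of the old
  family, which covers both polynomial and algebraic coefficients.\<close>

lemma multiplier_family_extend:
  fixes J :: "nat list set"
  assumes J: "finite J" "[] \<in> J" "\<And>x. x \<in> U \<Longrightarrow> v [] x = 1"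
    and a: "\<And>k. k < n \<Longrightarrow> multiplier J v (a k)" and c: "c \<in> coeffs_over" "c \<noteq> 0" and n: "0 < n"
    and h: "\<And>x. x \<in> U \<Longrightarrow> ipoly_eval c x * h x ^ n = (\<Sum>k<n. a k x * h x ^ k)"
  shows "\<exists>J' v'. finite J' \<and> ([]::nat list) \<in> J' \<and> (\<forall>x\<in>U. v' [] x = 1) \<and>
    multiplier J' v' h \<and> (\<forall>g. multiplier J v g \<longrightarrow> multiplier J' v' g)"
proof -
  \<comment> \<open>The empty list stands for the constant 1 and \<open>k # i\<close> for
    \<open>v i\<close> times \<open>h ^ k\<close>. Lists leave room for further adjunctions without
    a change of type.\<close>
  define J' where "J' = insert [] ((\<lambda>(k, i). k # i) ` ({..<n} \<times> J))"
  define v' where "v' l x = (case l of [] \<Rightarrow> 1 | k # i \<Rightarrow> v i x * h x ^ k)" for l x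
  have fJ': "finite J'" using J(1) by (simp add: J'_def)
  have base: "rspan J' v' (\<lambda>x. w x * h x ^ k)" if w: "rspan J v w" and k: "k < n" for w k
  proof -
    obtain d B where d: "d \<in> coeffs_over" "d \<noteq> 0" "\<forall>j\<in>J. B j \<in> coeffs_over"
      "\<forall>x\<in>U. ipoly_eval d x * w x = (\<Sum>j\<in>J. ipoly_eval (B j) x * v j x)"
      using w unfolding rspan_def by blast
    have "rspan J' v' (\<lambda>x. \<Sum>j\<in>J. ipoly_eval (B j) x * v' (k # j) x)"
      using d(3) k by (intro rspan_sum rspan_scale rspan_base fJ') (auto simp: J'_def)
    then have "rspan J' v' (\<lambda>x. ipoly_eval d x * (w x * h x ^ k))"
    proof (rule rspan_cong)
      fix x assume "x \<in> U"
      then have "ipoly_eval d x * (w x * h x ^ k) = (\<Sum>j\<in>J. ipoly_eval (B j) x * v j x) * h x ^ k"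
        using d(4) by (simp add: mult.assoc[symmetric])
      then show "(\<Sum>j\<in>J. ipoly_eval (B j) x * v' (k # j) x) = ipoly_eval d x * (w x * h x ^ k)"
        by (simp add: v'_def sum_distrib_right mult.assoc)
    qed
    then show ?thesis using d(1,2) by (rule rspan_cancel)
  qed
  have old: "multiplier J' v' g" if g: "multiplier J v g" for g
    unfolding multiplier_def
  proof
    fix l assume "l \<in> J'"
    then consider "l = []" | k i where "l = k # i" "k < n" "i \<in> J" by (auto simp: J'_def)
    then show "rspan J' v' (\<lambda>x. g x * v' l x)"
    proof cases
      case 1
      have "rspan J v (\<lambda>x. g x * v [] x)" using g J(2) unfolding multiplier_def by blast
      from base[OF this n] show ?thesis by (rule rspan_cong) (simp add: 1 v'_def J(3))
    next
      case 2
      have "rspan J v (\<lambda>x. g x * v i x)" using g 2 unfolding multiplier_def by blast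
      from base[OF this 2(2)] show ?thesis by (rule rspan_cong) (simp add: 2 v'_def)
    qed
  qed
  have step: "rspan J' v' (\<lambda>x. h x * (v i x * h x ^ k))" if i: "i \<in> J" and k: "k < n" for i k
  proof (cases "Suc k < n")
    case True
    from base[OF rspan_base[OF J(1) i] this] show ?thesis
      by (rule rspan_cong) (simp add: algebra_simps)
  next
    case False
    \<comment> \<open>At the top exponent the factor \<open>h\<close> completes
      \<open>h ^ n\<close>, and the relation is substituted.\<close>
    then have kn: "Suc k = n" using k by simp
    have "rspan J' v' (\<lambda>x. \<Sum>l<n. (a l x * v i x) * h x ^ l)"
      using a i unfolding multiplier_def by (intro rspan_sum base) auto
    then have "rspan J' v' (\<lambda>x. ipoly_eval c x * (h x * (v i x * h x ^ k)))"
    proof (rule rspan_cong)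
      fix x assume "x \<in> U"
      have "ipoly_eval c x * (h x * (v i x * h x ^ k)) = v i x * (ipoly_eval c x * h x ^ n)"
        by (simp add: kn[symmetric] algebra_simps)
      also have "\<dots> = v i x * (\<Sum>k<n. a k x * h x ^ k)" using h[OF \<open>x \<in> U\<close>] by simp
      also have "\<dots> = (\<Sum>l<n. (a l x * v i x) * h x ^ l)"
        by (simp add: sum_distrib_left algebra_simps)
      finally show "(\<Sum>l<n. (a l x * v i x) * h x ^ l) = ipoly_eval c x * (h x * (v i x * h x ^ k))" ..
    qed
    then show ?thesis using c by (rule rspan_cancel)
  qed
  have "multiplier J' v' h"
    unfolding multiplier_def
  proof
    fix l assume "l \<in> J'"
    then consider "l = []" | k i where "l = k # i" "k < n" "i \<in> J" by (auto simp: J'_def)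
    then show "rspan J' v' (\<lambda>x. h x * v' l x)"
    proof cases
      case 1
      from step[OF J(2) n] show ?thesis by (rule rspan_cong) (simp add: 1 v'_def J(3))
    next
      case 2
      from step[OF 2(3,2)] show ?thesis by (rule rspan_cong) (simp add: 2 v'_def)
    qed
  qed
  then show ?thesis using fJ' old
    by (intro exI[of _ J'] exI[of _ v']) (auto simp: J'_def v'_def)
qed

lemma Q_algebraic_fun_leading:
  assumes "Q_algebraic_fun T U f"
  shows "\<exists>n c C. 0 < n \<and> c \<in> coeffs_over \<and> c \<noteq> 0 \<and> (\<forall>k<n. C k \<in> coeffs_over) \<and>
    (\<forall>x\<in>U. ipoly_eval c x * f x ^ n = (\<Sum>k<n. ipoly_eval (C k) x * f x ^ k))"
proof -
  obtain n C i where C: "\<And>i. ipoly_vars (C i) \<subseteq> T" "i \<le> n" "C i \<noteq> 0"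
    "\<And>x. x \<in> U \<Longrightarrow> (\<Sum>i\<le>n. ipoly_eval (C i) x * f x ^ i) = 0"
    using assms unfolding Q_algebraic_fun_def by blast
  define m where "m = Max {i. i \<le> n \<and> C i \<noteq> 0}"
  have fin: "finite {i. i \<le> n \<and> C i \<noteq> 0}" by simp
  have "m \<in> {i. i \<le> n \<and> C i \<noteq> 0}" unfolding m_def using C(2,3) by (intro Max_in fin) auto
  then have m: "m \<le> n" "C m \<noteq> 0" by auto
  have big: "C i = 0" if "m < i" "i \<le> n" for i
    using Max_ge[OF fin, of i] that by (fastforce simp: m_def)
  have rel: "ipoly_eval (C m) x * f x ^ m = (\<Sum>k<m. ipoly_eval (- C k) x * f x ^ k)" if x: "x \<in> U" for x
  proof -
    have "(\<Sum>i\<le>n. ipoly_eval (C i) x * f x ^ i) = (\<Sum>i\<le>m. ipoly_eval (C i) x * f x ^ i)"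
      using m big by (intro sum.mono_neutral_right) auto
    then have "(\<Sum>i<m. ipoly_eval (C i) x * f x ^ i) + ipoly_eval (C m) x * f x ^ m = 0"
      using C(4)[OF x] by (simp add: lessThan_Suc_atMost[symmetric])
    then show ?thesis by (simp add: sum_negf add_eq_0_iff)
  qed
  show ?thesis
  proof (cases "m = 0")
    \<comment> \<open>Then the constant coefficient vanishes on all of \<open>U\<close>; multiplying
      by \<open>f\<close> gives a relation of the required positive degree.\<close>
    case True
    then have "\<forall>x\<in>U. ipoly_eval (C m) x * f x ^ 1 = (\<Sum>k<1. ipoly_eval 0 x * f x ^ k)"
      using rel by simp
    then show ?thesis using C(1)[of m] m coeffs_over_closed(2)
      by (intro exI[of _ 1] exI[of _ "C m"] exI[of _ "\<lambda>_. 0"]) auto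
  next
    case False
    then show ?thesis using C(1) m rel
      by (intro exI[of _ m] exI[of _ "C m"] exI[of _ "\<lambda>k. - C k"]) auto
  qed
qed

lemma multiplier_family:
  assumes "finite F" "\<And>f. f \<in> F \<Longrightarrow> Q_algebraic_fun T U f"
  shows "\<exists>(J::nat list set) v. finite J \<and> [] \<in> J \<and> (\<forall>x\<in>U. v [] x = 1) \<and> (\<forall>f\<in>F. multiplier J v f)"
  using assms
proof (induct F rule: finite_induct)
  case empty
  show ?case by (intro exI[of _ "{[]}"] exI[of _ "\<lambda>_ _. 1"]) auto
next
  case (insert f F)
  then obtain J :: "nat list set" and v where J: "finite J" "[] \<in> J" "\<forall>x\<in>U. v [] x = 1" "\<forall>f\<in>F. multiplier J v f"
    by auto
  have "Q_algebraic_fun T U f" by (rule insert.prems) simp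
  from Q_algebraic_fun_leading[OF this]
  obtain n c C where n: "0 < n" and c: "c \<in> coeffs_over" "c \<noteq> 0" "\<forall>k<n. C k \<in> coeffs_over"
    "\<forall>x\<in>U. ipoly_eval c x * f x ^ n = (\<Sum>k<n. ipoly_eval (C k) x * f x ^ k)"
    by (elim exE conjE)
  have "\<exists>J' v'. finite J' \<and> ([]::nat list) \<in> J' \<and> (\<forall>x\<in>U. v' [] x = 1) \<and>
    multiplier J' v' f \<and> (\<forall>g. multiplier J v g \<longrightarrow> multiplier J' v' g)"
    by (rule multiplier_family_extend[where a = "\<lambda>k. ipoly_eval (C k)" and n = n and c = c])
      (use J c n in \<open>auto intro!: multiplier_poly\<close>)
  then show ?case using J(4) by (metis insert_iff)
qed

lemma Q_algebraic_fun_add: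
  assumes "Q_algebraic_fun T U f" "Q_algebraic_fun T U g"
  shows "Q_algebraic_fun T U (\<lambda>x. f x + g x)"
proof -
  obtain J :: "nat list set" and v where J: "finite J" "[] \<in> J" "\<forall>x\<in>U. v [] x = 1" "\<forall>h\<in>{f, g}. multiplier J v h"
    using multiplier_family[of "{f, g}"] assms by auto
  show ?thesis by (rule multiplier_algebraic[OF J(1,2) _ multiplier_add, of v]) (use J in auto)
qed

lemma Q_algebraic_fun_mult:
  assumes "Q_algebraic_fun T U f" "Q_algebraic_fun T U g"
  shows "Q_algebraic_fun T U (\<lambda>x. f x * g x)"
proof -
  obtain J :: "nat list set" and v where J: "finite J" "[] \<in> J" "\<forall>x\<in>U. v [] x = 1" "\<forall>h\<in>{f, g}. multiplier J v h"
    using multiplier_family[of "{f, g}"] assms by auto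
  show ?thesis by (rule multiplier_algebraic[OF J(1,2) _ multiplier_mult, of v]) (use J in auto)
qed

text \<open>Algebraic coefficients act on a common family; \<open>h\<close> is adjoined to that
  family by means of its monic equation.\<close>

lemma Q_algebraic_fun_root:
  assumes "0 < n" "\<And>k. k < n \<Longrightarrow> Q_algebraic_fun T U (a k)"
    "\<And>x. x \<in> U \<Longrightarrow> h x ^ n = (\<Sum>k<n. a k x * h x ^ k)"
  shows "Q_algebraic_fun T U h"
proof -
  obtain J :: "nat list set" and v where J: "finite J" "[] \<in> J" "\<forall>x\<in>U. v [] x = 1" "\<forall>h\<in>a ` {..<n}. multiplier J v h"
    using multiplier_family[of "a ` {..<n}"] assms(2) by auto
  have "\<exists>J' v'. finite J' \<and> ([]::nat list) \<in> J' \<and> (\<forall>x\<in>U. v' [] x = 1) \<and>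
    multiplier J' v' h \<and> (\<forall>g. multiplier J v g \<longrightarrow> multiplier J' v' g)"
    by (rule multiplier_family_extend[where a = a and n = n and c = 1])
      (use J assms coeffs_over_closed(1) in auto)
  then show ?thesis using multiplier_algebraic by metis
qed

lemma Q_algebraic_fun_poly:
  assumes "ipoly_vars P \<subseteq> T"
  shows "Q_algebraic_fun T U (ipoly_eval P)"
  by (rule Q_algebraic_fun_root[of 1 "\<lambda>_. ipoly_eval P"])
    (use assms in \<open>auto intro!: multiplier_algebraic[of "{0::nat}" 0 "\<lambda>_ _. 1"] multiplier_poly\<close>)

text \<open>Dividing the relation for \<open>f\<close> by \<open>f x ^ n\<close> gives a relation
  for the inverse with the coefficients in reverse order.\<close>

lemma Q_algebraic_fun_inverse:
  assumes "Q_algebraic_fun T U f" "\<And>x. x \<in> U \<Longrightarrow> f x \<noteq> 0"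
  shows "Q_algebraic_fun T U (\<lambda>x. inverse (f x))"
proof -
  obtain n C i where C: "\<And>i. ipoly_vars (C i) \<subseteq> T" "i \<le> n" "C i \<noteq> 0"
    "\<And>x. x \<in> U \<Longrightarrow> (\<Sum>i\<le>n. ipoly_eval (C i) x * f x ^ i) = 0"
    using assms(1) unfolding Q_algebraic_fun_def by blast
  have "(\<Sum>i\<le>n. ipoly_eval (C (n - i)) x * inverse (f x) ^ i) = 0" if x: "x \<in> U" for x
  proof -
    have "(\<Sum>i\<le>n. ipoly_eval (C (n - i)) x * inverse (f x) ^ i) =
        (\<Sum>i\<le>n. ipoly_eval (C i) x * inverse (f x) ^ (n - i))"
      by (rule sum.reindex_bij_witness[of _ "\<lambda>i. n - i" "\<lambda>i. n - i"]) auto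
    also have "\<dots> = (\<Sum>i\<le>n. inverse (f x) ^ n * (ipoly_eval (C i) x * f x ^ i))"
    proof (rule sum.cong)
      fix i assume "i \<in> {..n}"
      then have "inverse (f x) ^ n = inverse (f x) ^ (n - i) * inverse (f x) ^ i"
        by (simp add: power_add[symmetric])
      then show "ipoly_eval (C i) x * inverse (f x) ^ (n - i) = inverse (f x) ^ n * (ipoly_eval (C i) x * f x ^ i)"
        using assms(2)[OF x] by (simp add: field_simps power_inverse)
    qed simp
    also have "\<dots> = inverse (f x) ^ n * (\<Sum>i\<le>n. ipoly_eval (C i) x * f x ^ i)"
      by (rule sum_distrib_left[symmetric])
    also have "\<dots> = 0" using C(4)[OF x] by simp
    finally show ?thesis .
  qed
  then show ?thesis unfolding Q_algebraic_fun_def using C(1-3)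
    by (intro exI[of _ n] exI[of _ "\<lambda>i. C (n - i)"]) (auto intro!: exI[of _ "n - i"])
qed

lemma Q_algebraic_fun_subset_cong:
  assumes "Q_algebraic_fun T U f" "V \<subseteq> U" "\<And>x. x \<in> V \<Longrightarrow> f x = g x"
  shows "Q_algebraic_fun T V g"
proof -
  obtain n C where C: "\<forall>i. ipoly_vars (C i) \<subseteq> T" "\<exists>i\<le>n. C i \<noteq> 0"
    "\<forall>x\<in>U. (\<Sum>i\<le>n. ipoly_eval (C i) x * f x ^ i) = 0"
    using assms(1) unfolding Q_algebraic_fun_def by blast
  have "\<forall>x\<in>V. (\<Sum>i\<le>n. ipoly_eval (C i) x * g x ^ i) = 0"
    using C(3) assms(2,3) by (metis (no_types, lifting) subsetD sum.cong)
  then show ?thesis unfolding Q_algebraic_fun_def using C(1,2) by blast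
qed

end

section \<open>Roots of separable polynomials on simply connected spaces\<close>

text \<open>The modulus of a monic polynomial at \<open>w\<close> is the product of the distances
  from \<open>w\<close> to its roots, so a small value forces a root near \<open>w\<close>. This is
  the quantitative continuity of roots used for the covering.\<close>

lemma monic_root_near:
  fixes p :: "complex poly"
  assumes monic: "poly.coeff p (Polynomial.degree p) = 1" and \<epsilon>: "\<epsilon> > 0"
    and small: "cmod (poly p w) < \<epsilon> ^ Polynomial.degree p"
  shows "\<exists>z. poly p z = 0 \<and> dist z w < \<epsilon>"
proof -
  have "p \<noteq> 0" using monic by auto
  then obtain A where A: "size A = Polynomial.degree p"
    and pA: "p = Polynomial.smult (poly.coeff p (Polynomial.degree p)) (\<Prod>x\<in>#A. [:-x, 1:])"
    using alg_closed_imp_factorization by blast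
  have p: "p = (\<Prod>x\<in>#A. [:-x, 1:])" using pA monic by simp
  have ev: "poly p z = (\<Prod>x\<in>#A. z - x)" for z
    unfolding p by (induct A) (auto simp: algebra_simps)
  have ge: "\<epsilon> ^ size B \<le> cmod (\<Prod>x\<in>#B. w - x)" if "\<forall>x\<in>#B. \<epsilon> \<le> dist x w" for B
    using that
  proof (induct B)
    case (add x B)
    then have "\<epsilon> * \<epsilon> ^ size B \<le> cmod (w - x) * cmod (\<Prod>x\<in>#B. w - x)"
      using \<epsilon> by (intro mult_mono) (auto simp: dist_norm norm_minus_commute)
    then show ?case by (simp add: norm_mult)
  qed simp
  have "\<exists>x\<in>#A. dist x w < \<epsilon>"
    using ge[of A] small ev[of w] A by (metis not_le)
  moreover have "poly p x = 0" if "x \<in># A" for x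
    using that by (auto simp: ev)
  ultimately show ?thesis by auto
qed

lemma card_roots_separable:
  fixes p :: "complex poly"
  assumes sep: "\<And>z. poly p z = 0 \<Longrightarrow> poly (pderiv p) z \<noteq> 0"
  shows "card {z. poly p z = 0} = Polynomial.degree p"
proof -
  have rs: "rsquarefree p"
    using sep by (auto simp: rsquarefree_roots)
  then have "p \<noteq> 0" by (auto simp: rsquarefree_def)
  have "p = Polynomial.smult (poly.coeff p (Polynomial.degree p)) (\<Prod>z|poly p z = 0. [:-z, 1:])"
    using complex_poly_decompose_rsquarefree[OF rs] by simp
  then have "Polynomial.degree p = Polynomial.degree (\<Prod>z|poly p z = 0. [:-z, 1:])"
    using \<open>p \<noteq> 0\<close> by (metis degree_smult_eq leading_coeff_0_iff)
  also have "\<dots> = card {z. poly p z = 0}"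
    by (subst degree_prod_eq_sum_degree) auto
  finally show ?thesis by simp
qed

text \<open>Take disjoint discs about the \<open>n\<close> roots of \<open>P s0\<close>. For
  \<open>s\<close> near \<open>s0\<close> each disc contains a root of \<open>P s\<close> by
  \<open>monic_root_near\<close>, hence exactly one, as there are only \<open>n\<close> roots. The
  discs cut out the sheets, and the same estimate shows that the root in a disc is continuous in
  \<open>s\<close>.\<close>

lemma separable_roots_covering_space:
  fixes P :: "'s::real_normed_vector \<Rightarrow> complex poly"
  assumes deg: "\<And>s. s \<in> S \<Longrightarrow> Polynomial.degree (P s) = n" "0 < n"
    and monic: "\<And>s. s \<in> S \<Longrightarrow> poly.coeff (P s) n = 1"
    and cont: "\<And>i. continuous_on S (\<lambda>s. poly.coeff (P s) i)"
    and sep: "\<And>s z. s \<in> S \<Longrightarrow> poly (P s) z = 0 \<Longrightarrow> poly (pderiv (P s)) z \<noteq> 0"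
  shows "covering_space (SIGMA s:S. {z. poly (P s) z = 0}) fst S"
proof (rule covering_spaceI)
  let ?E = "SIGMA s:S. {z. poly (P s) z = 0}"
  show "continuous_on ?E fst" by (intro continuous_intros)
  show "fst ` ?E = S"
  proof -
    have "\<exists>z. poly (P s) z = 0" if "s \<in> S" for s
      using alg_closed_imp_poly_has_root[of "P s"] deg that by auto
    then show ?thesis by force
  qed
  fix s0 assume s0: "s0 \<in> S"
  define R where "R = {z. poly (P s0) z = 0}"
  have nz: "P s \<noteq> 0" if "s \<in> S" for s using deg(1)[OF that] deg(2) by auto
  have fin: "finite {z. poly (P s) z = 0}" if "s \<in> S" for s
    using nz[OF that] poly_roots_finite by blast
  have card: "card {z. poly (P s) z = 0} = n" if "s \<in> S" for s
    using card_roots_separable[of "P s"] sep that deg by auto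
  have contp: "continuous_on S (\<lambda>s. poly (P s) w)" for w
  proof -
    have "poly (P s) w = (\<Sum>i\<le>n. poly.coeff (P s) i * w ^ i)" if "s \<in> S" for s
      using deg(1)[OF that] by (simp add: poly_altdef)
    moreover have "continuous_on S (\<lambda>s. \<Sum>i\<le>n. poly.coeff (P s) i * w ^ i)"
      by (intro continuous_intros cont)
    ultimately show ?thesis by (simp cong: continuous_on_cong)
  qed
  have near: "\<exists>z. poly (P s) z = 0 \<and> dist z w < e" if "s \<in> S" "e > 0" "cmod (poly (P s) w) < e ^ n" for s w e
    using monic_root_near[of "P s" e w] deg(1) monic that by auto
  obtain \<epsilon> where \<epsilon>: "\<epsilon> > 0" and disj: "\<And>z z'. z \<in> R \<Longrightarrow> z' \<in> R \<Longrightarrow> z \<noteq> z' \<Longrightarrow> 2 * \<epsilon> \<le> dist z z'"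
  proof
    \<comment> \<open>The 1 keeps the set nonempty when there is a single root.\<close>
    let ?D = "insert 1 ((\<lambda>(z, z'). dist z z') ` {(z, z'). z \<in> R \<and> z' \<in> R \<and> z \<noteq> z'})"
    have "finite ?D"
      using fin[OF s0] by (auto intro!: finite_imageI intro: finite_subset[of _ "R \<times> R"] simp: R_def)
    then show "Min ?D / 2 > 0" "\<And>z z'. z \<in> R \<Longrightarrow> z' \<in> R \<Longrightarrow> z \<noteq> z' \<Longrightarrow> 2 * (Min ?D / 2) \<le> dist z z'"
      by (auto intro!: Min_le)
  qed
  \<comment> \<open>The sum bounds the values at all roots of \<open>P s0\<close> at once, and it is
    zero at \<open>s0\<close>.\<close>
  define T where "T = S \<inter> (\<lambda>s. \<Sum>z\<in>R. cmod (poly (P s) z)) -` {..<\<epsilon> ^ n}"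
  have "openin (top_of_set S) T"
    unfolding T_def by (rule continuous_openin_preimage_gen) (auto intro!: continuous_intros contp)
  have "s0 \<in> T" using s0 \<epsilon> by (auto simp: T_def R_def)
  have TS: "T \<subseteq> S" by (auto simp: T_def)
  have inball: "\<exists>w. poly (P s) w = 0 \<and> dist w z < \<epsilon>" if "s \<in> T" "z \<in> R" for s z
  proof -
    have "cmod (poly (P s) z) \<le> (\<Sum>z\<in>R. cmod (poly (P s) z))"
      using that fin[OF s0] by (intro member_le_sum) (auto simp: R_def)
    then show ?thesis using that \<epsilon> by (intro near) (auto simp: T_def)
  qed
  define \<rho> where "\<rho> s z = (SOME w. poly (P s) w = 0 \<and> dist w z < \<epsilon>)" for s z
  have \<rho>: "poly (P s) (\<rho> s z) = 0" "dist (\<rho> s z) z < \<epsilon>" if "s \<in> T" "z \<in> R" for s z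
    using someI_ex[OF inball[OF that]] by (auto simp: \<rho>_def)
  have inj: "inj_on (\<rho> s) R" if "s \<in> T" for s
  proof (rule inj_onI, rule ccontr)
    fix z z' assume z: "z \<in> R" "z' \<in> R" "\<rho> s z = \<rho> s z'" "z \<noteq> z'"
    have "dist z z' \<le> dist (\<rho> s z) z + dist (\<rho> s z) z'" by (metis dist_triangle dist_commute)
    also have "\<dots> < 2 * \<epsilon>" using \<rho>[OF that z(1)] \<rho>[OF that z(2)] z(3) by simp
    finally show False using disj z by force
  qed
  have surj: "\<rho> s ` R = {w. poly (P s) w = 0}" if "s \<in> T" for s
  proof (rule card_subset_eq)
    show "finite {w. poly (P s) w = 0}" using fin that TS by auto
    show "\<rho> s ` R \<subseteq> {w. poly (P s) w = 0}" using \<rho> that by auto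
    show "card (\<rho> s ` R) = card {w. poly (P s) w = 0}"
      using card_image[OF inj[OF that]] card that TS s0 by (auto simp: R_def)
  qed
  have uniq: "w = \<rho> s z" if uq: "s \<in> T" "z \<in> R" "poly (P s) w = 0" "dist w z < \<epsilon>" for s z w
  proof -
    obtain z' where z': "z' \<in> R" "w = \<rho> s z'" using surj[OF uq(1)] uq(3) by blast
    have "dist z z' \<le> dist w z + dist w z'" by (metis dist_triangle dist_commute)
    also have "\<dots> < 2 * \<epsilon>" using \<rho>[OF uq(1) z'(1)] uq z'(2) by simp
    finally have "z = z'" using disj uq z' by force
    then show ?thesis using z' by simp
  qed
  have cont\<rho>: "continuous_on T (\<lambda>s. \<rho> s z)" if "z \<in> R" for z
    unfolding continuous_on_iff
  proof (intro ballI allI impI)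
    fix s1 e assume s1: "s1 \<in> T" and e: "0 < (e::real)"
    \<comment> \<open>The second bound keeps the nearby root inside the disc about \<open>z\<close>,
      where it must coincide with \<open>\<rho> s z\<close>.\<close>
    define e' where "e' = min e (\<epsilon> - dist (\<rho> s1 z) z)"
    have e': "e' > 0" using e \<rho>[OF s1 that] by (auto simp: e'_def)
    have "continuous_on S (\<lambda>s. poly (P s) (\<rho> s1 z))" by (rule contp)
    then obtain d where d: "d > 0" "\<And>s. s \<in> S \<Longrightarrow> dist s s1 < d \<Longrightarrow>
        dist (poly (P s) (\<rho> s1 z)) (poly (P s1) (\<rho> s1 z)) < e' ^ n"
      using s1 TS e' unfolding continuous_on_iff by (metis subsetD zero_less_power)
    show "\<exists>d>0. \<forall>x'\<in>T. dist x' s1 < d \<longrightarrow> dist (\<rho> x' z) (\<rho> s1 z) < e"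
    proof (intro exI conjI ballI impI)
      fix s assume s: "s \<in> T" "dist s s1 < d"
      have "cmod (poly (P s) (\<rho> s1 z)) < e' ^ n"
        using d(2)[of s] s TS \<rho>[OF s1 that] by (auto simp: dist_norm)
      then obtain w where w: "poly (P s) w = 0" "dist w (\<rho> s1 z) < e'"
        using near[of s e' "\<rho> s1 z"] s TS e' by auto
      have "dist w z \<le> dist w (\<rho> s1 z) + dist (\<rho> s1 z) z" by (rule dist_triangle)
      also have "\<dots> < \<epsilon>" using w by (auto simp: e'_def)
      finally have "w = \<rho> s z" using uniq s that w by blast
      then show "dist (\<rho> s z) (\<rho> s1 z) < e" using w by (auto simp: e'_def)
    qed (use d in auto)
  qed
  define V where "V = (\<lambda>z. ?E \<inter> T \<times> ball z \<epsilon>) ` R"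
  show "\<exists>T. s0 \<in> T \<and> openin (top_of_set S) T \<and>
      (\<exists>v. \<Union>v = ?E \<inter> fst -` T \<and> (\<forall>u \<in> v. openin (top_of_set ?E) u) \<and>
        pairwise disjnt v \<and> (\<forall>u \<in> v. \<exists>q. homeomorphism u T fst q))"
  proof (intro exI[of _ T] exI[of _ V] conjI)
    show "\<Union>V = ?E \<inter> fst -` T"
    proof (intro equalityI subsetI)
      fix x assume "x \<in> ?E \<inter> fst -` T"
      then obtain s w where x: "x = (s, w)" "s \<in> T" "poly (P s) w = 0" "s \<in> S" by auto
      then obtain z where z: "z \<in> R" "w = \<rho> s z" using surj[OF x(2)] by blast
      then show "x \<in> \<Union>V" using x \<rho>(2)[OF x(2) z(1)] by (auto simp: V_def dist_commute)
    qed (auto simp: V_def)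
    show "\<forall>u \<in> V. openin (top_of_set ?E) u"
    proof
      fix u assume "u \<in> V"
      then obtain z where u: "u = ?E \<inter> T \<times> ball z \<epsilon>" by (auto simp: V_def)
      obtain O' where O': "open O'" "T = S \<inter> O'"
        using \<open>openin (top_of_set S) T\<close> by (auto simp: openin_open)
      have "u = ?E \<inter> (O' \<times> ball z \<epsilon>)" using u O' by auto
      then show "openin (top_of_set ?E) u"
        using O' by (auto simp: openin_open intro!: open_Times)
    qed
    show "pairwise disjnt V"
    proof -
      have "disjnt (?E \<inter> T \<times> ball z \<epsilon>) (?E \<inter> T \<times> ball z' \<epsilon>)" if "z \<in> R" "z' \<in> R" "z \<noteq> z'" for z z'
      proof (rule ccontr)
        assume "\<not> disjnt (?E \<inter> T \<times> ball z \<epsilon>) (?E \<inter> T \<times> ball z' \<epsilon>)"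
        then obtain w where "dist z w < \<epsilon>" "dist z' w < \<epsilon>" by (auto simp: disjnt_iff)
        then have "dist z z' < 2 * \<epsilon>" using dist_triangle2[of z z' w] by auto
        then show False using disj that by force
      qed
      then show ?thesis unfolding V_def pairwise_def by blast
    qed
    show "\<forall>u \<in> V. \<exists>q. homeomorphism u T fst q"
    proof
      fix u assume "u \<in> V"
      then obtain z where z: "z \<in> R" and u: "u = ?E \<inter> T \<times> ball z \<epsilon>" by (auto simp: V_def)
      have "homeomorphism u T fst (\<lambda>s. (s, \<rho> s z))"
      proof (rule homeomorphismI)
        show "continuous_on u fst" by (intro continuous_intros)
        show "continuous_on T (\<lambda>s. (s, \<rho> s z))" by (intro continuous_intros cont\<rho> z)
        show "(\<lambda>s. (s, \<rho> s z)) ` T \<subseteq> u" using \<rho>[OF _ z] TS by (auto simp: u dist_commute)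
        show "(fst x, \<rho> (fst x) z) = x" if "x \<in> u" for x
          using that uniq[of "fst x" z "snd x"] z by (auto simp: u dist_commute)
      qed (auto simp: u)
      then show "\<exists>q. homeomorphism u T fst q" by blast
    qed
  qed (use \<open>s0 \<in> T\<close> \<open>openin (top_of_set S) T\<close> in auto)
qed

text \<open>The identity of a simply connected, locally path connected base lifts through the
  covering; the second component of the lift is a continuous choice of root.\<close>

lemma separable_root_section:
  fixes P :: "'s::real_normed_vector \<Rightarrow> complex poly"
  assumes deg: "\<And>s. s \<in> S \<Longrightarrow> Polynomial.degree (P s) = n" "0 < n"
    and monic: "\<And>s. s \<in> S \<Longrightarrow> poly.coeff (P s) n = 1"
    and cont: "\<And>i. continuous_on S (\<lambda>s. poly.coeff (P s) i)"
    and sep: "\<And>s z. s \<in> S \<Longrightarrow> poly (P s) z = 0 \<Longrightarrow> poly (pderiv (P s)) z \<noteq> 0"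
    and S: "simply_connected S" "locally path_connected S"
  shows "\<exists>f. continuous_on S f \<and> (\<forall>s\<in>S. poly (P s) (f s) = 0)"
proof -
  let ?E = "SIGMA s:S. {z. poly (P s) z = 0}"
  have "covering_space ?E fst S"
    by (rule separable_roots_covering_space[OF deg monic cont sep])
  then obtain g where g: "continuous_on S g" "g \<in> S \<rightarrow> ?E" "\<And>y. y \<in> S \<Longrightarrow> fst (g y) = y"
    using covering_space_lift[OF _ S, of ?E fst S "\<lambda>x. x"] by auto
  have "continuous_on S (snd \<circ> g)" by (intro continuous_on_compose g continuous_intros)
  moreover have "poly (P s) (snd (g s)) = 0" if "s \<in> S" for s
    using g(2,3) that by (force simp: Pi_iff)
  ultimately show ?thesis by (auto simp: o_def)
qed

section \<open>Holomorphic functions on powers of the complex line\<close>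

definition cline :: "'t set \<Rightarrow> ('t \<Rightarrow> complex) \<Rightarrow> ('t \<Rightarrow> complex) \<Rightarrow> complex \<Rightarrow> 't \<Rightarrow> complex"
  where "cline T x h z = (\<lambda>t\<in>T. x t + z * h t)"

lemma continuous_map_cline: "continuous_map euclidean (powertop_complex T) (cline T x h)"
  unfolding continuous_map_componentwise
  by (auto simp: cline_def intro!: continuous_intros)

lemma cline_0: "x \<in> topspace (powertop_complex T) \<Longrightarrow> cline T x h 0 = x"
  by (auto simp: cline_def PiE_def extensional_def)

lemma eventually_cline:
  assumes "openin (powertop_complex T) U" "x \<in> U"
  shows "\<forall>\<^sub>F z in nhds 0. cline T x h z \<in> U"
proof -
  have "open {z. cline T x h z \<in> U}"
    using openin_continuous_map_preimage[OF continuous_map_cline assms(1), of x h] by simp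
  moreover have "cline T x h 0 = x"
    using openin_subset[OF assms(1)] assms(2) by (intro cline_0) auto
  ultimately show ?thesis
    using assms(2) eventually_nhds_in_open[of "{z. cline T x h z \<in> U}" 0] by simp
qed

lemma power_holomorphic_on_iff:
  "power_holomorphic_on f T U \<longleftrightarrow>
    continuous_map (subtopology (powertop_complex T) U) euclidean f \<and>
    (\<forall>x\<in>U. \<forall>h\<in>topspace (powertop_complex T). (\<lambda>z. f (cline T x h z)) field_differentiable at 0)"
  by (simp add: power_holomorphic_on_def cline_def)

lemma field_differentiable_eventually_cong:
  assumes "\<forall>\<^sub>F z in nhds (a::complex). f z = g z" "f field_differentiable at a"
  shows "g field_differentiable at a"
  using assms DERIV_cong_ev[OF refl assms(1) refl] unfolding field_differentiable_def by auto

lemma power_holomorphic_on_cong: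
  assumes U: "openin (powertop_complex T) U" and f: "power_holomorphic_on f T U"
    and fg: "\<And>x. x \<in> U \<Longrightarrow> f x = g x"
  shows "power_holomorphic_on g T U"
  unfolding power_holomorphic_on_iff
proof (intro conjI ballI)
  show "continuous_map (subtopology (powertop_complex T) U) euclidean g"
    using f fg unfolding power_holomorphic_on_iff by (auto elim!: continuous_map_eq)
  fix x h assume x: "x \<in> U" and h: "h \<in> topspace (powertop_complex T)"
  have "\<forall>\<^sub>F z in nhds 0. f (cline T x h z) = g (cline T x h z)"
    using eventually_cline[OF U x] by eventually_elim (rule fg)
  then show "(\<lambda>z. g (cline T x h z)) field_differentiable at 0"
    by (rule field_differentiable_eventually_cong) (use f x h in \<open>auto simp: power_holomorphic_on_iff\<close>)
qed

lemma power_holomorphic_on_subset: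
  "power_holomorphic_on f T U \<Longrightarrow> V \<subseteq> U \<Longrightarrow> power_holomorphic_on f T V"
  unfolding power_holomorphic_on_iff by (auto elim!: continuous_map_from_subtopology_mono)

lemma power_holomorphic_on_const: "power_holomorphic_on (\<lambda>_. c) T U"
  unfolding power_holomorphic_on_iff by auto

lemma power_holomorphic_on_coordinate: "t \<in> T \<Longrightarrow> power_holomorphic_on (\<lambda>x. x t) T U"
  unfolding power_holomorphic_on_iff
  by (auto intro!: continuous_intros derivative_intros simp: cline_def)

lemma power_holomorphic_on_add:
  "power_holomorphic_on f T U \<Longrightarrow> power_holomorphic_on g T U \<Longrightarrow> power_holomorphic_on (\<lambda>x. f x + g x) T U"
  unfolding power_holomorphic_on_iff
  by (auto intro!: continuous_intros derivative_intros)

lemma power_holomorphic_on_mult: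
  "power_holomorphic_on f T U \<Longrightarrow> power_holomorphic_on g T U \<Longrightarrow> power_holomorphic_on (\<lambda>x. f x * g x) T U"
  unfolding power_holomorphic_on_iff
  by (auto intro!: derivative_intros simp: continuous_map_atin tendsto_mult)

lemma power_holomorphic_on_inverse:
  assumes U: "U \<subseteq> topspace (powertop_complex T)" and f: "power_holomorphic_on f T U" "\<And>x. x \<in> U \<Longrightarrow> f x \<noteq> 0"
  shows "power_holomorphic_on (\<lambda>x. inverse (f x)) T U"
proof -
  have "cline T x h 0 = x" if "x \<in> U" for x h using cline_0 U that by blast
  then show ?thesis
    using f unfolding power_holomorphic_on_iff
    by (auto intro!: field_differentiable_inverse simp: continuous_map_atin tendsto_inverse)
qed

lemma power_holomorphic_on_sum:
  "(\<And>i. i \<in> A \<Longrightarrow> power_holomorphic_on (f i) T U) \<Longrightarrow> power_holomorphic_on (\<lambda>x. \<Sum>i\<in>A. f i x) T U"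
  by (induct A rule: infinite_finite_induct)
    (auto intro: power_holomorphic_on_const power_holomorphic_on_add)

lemma power_holomorphic_on_poly:
  assumes "ipoly_vars P \<subseteq> T"
  shows "power_holomorphic_on (ipoly_eval P) T U"
proof -
  have mon: "power_holomorphic_on (\<lambda>x. \<Prod>v\<in>#m. x v) T U" if "set_mset m \<subseteq> T" for m
    using that by (induct m)
      (auto intro: power_holomorphic_on_const power_holomorphic_on_mult power_holomorphic_on_coordinate)
  have "power_holomorphic_on (\<lambda>x. \<Sum>m\<in>Poly_Mapping.keys P. of_int (icoeff P m) * (\<Prod>v\<in>#m. x v)) T U"
    using assms by (intro power_holomorphic_on_sum power_holomorphic_on_mult power_holomorphic_on_const mon)
      (auto simp: ipoly_vars_def)
  then show ?thesis by (simp add: ipoly_eval_def[abs_def])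
qed

text \<open>Implicit differentiation when \<open>f\<close> is only known to be continuous. With
  \<open>p 0 = (X - f 0) q\<close>, subtracting the relation for \<open>p 0\<close> from that for
  \<open>p z\<close> expresses the difference quotient of \<open>f\<close> by those of the
  coefficients, divided by \<open>- q (f z)\<close>. The denominator stays away from zero since
  \<open>q (f 0)\<close> is the derivative of \<open>p 0\<close> at its root.\<close>

lemma separable_root_differentiable:
  fixes p :: "complex \<Rightarrow> complex poly" and f :: "complex \<Rightarrow> complex"
  assumes deg: "\<And>z. Polynomial.degree (p z) \<le> N"
    and diff: "\<And>i. (\<lambda>z. poly.coeff (p z) i) field_differentiable at 0"
    and cont: "isCont f 0" and root: "\<forall>\<^sub>F z in nhds 0. poly (p z) (f z) = 0"
    and sep: "poly (pderiv (p 0)) (f 0) \<noteq> 0"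
  shows "f field_differentiable at 0"
proof -
  define q where "q = synthetic_div (p 0) (f 0)"
  have p00: "poly (p 0) (f 0) = 0" using eventually_nhds_x_imp_x[OF root] .
  have p0: "p 0 = [:- f 0, 1:] * q"
    using synthetic_div_correct'[of "f 0" "p 0"] p00 by (simp add: q_def)
  have "pderiv (p 0) = [:- f 0, 1:] * pderiv q + q * pderiv [:- f 0, 1:]"
    by (subst p0) (rule pderiv_mult)
  then have "poly (pderiv (p 0)) (f 0) = poly q (f 0)"
    by (simp add: pderiv_pCons)
  then have q0: "poly q (f 0) \<noteq> 0" using sep by simp
  have "\<forall>i. \<exists>a. (\<lambda>z. (poly.coeff (p z) i - poly.coeff (p 0) i) / z) \<midarrow>0\<rightarrow> a"
    using diff unfolding field_differentiable_def has_field_derivative_iff by simp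
  then obtain a where a: "\<And>i. (\<lambda>z. (poly.coeff (p z) i - poly.coeff (p 0) i) / z) \<midarrow>0\<rightarrow> a i"
    by metis
  have f0: "f \<midarrow>0\<rightarrow> f 0" using cont by (simp add: isCont_def)
  have q1: "(\<lambda>z. poly q (f z)) \<midarrow>0\<rightarrow> poly q (f 0)"
    by (rule tendsto_poly[OF f0])
  define G where "G z = - (\<Sum>i\<le>N. (poly.coeff (p z) i - poly.coeff (p 0) i) / z * f z ^ i) / poly q (f z)" for z
  have G: "G \<midarrow>0\<rightarrow> - (\<Sum>i\<le>N. a i * f 0 ^ i) / poly q (f 0)"
    unfolding G_def by (intro tendsto_intros a f0 q1 q0)
  have "\<forall>\<^sub>F z in at 0. poly q (f z) \<noteq> 0"
    using tendsto_imp_eventually_ne[OF q1 q0] .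
  moreover have "\<forall>\<^sub>F z in at 0. poly (p z) (f z) = 0"
    using root by (simp add: eventually_nhds_conv_at)
  moreover have "\<forall>\<^sub>F z::complex in at 0. z \<noteq> 0"
    by (simp add: eventually_at_filter)
  ultimately have "\<forall>\<^sub>F z in at 0. G z = (f z - f 0) / (z - 0)"
  proof eventually_elim
    case (elim z)
    have ev: "poly (p w) u = (\<Sum>i\<le>N. poly.coeff (p w) i * u ^ i)" for w u
    proof -
      have "poly (p w) u = (\<Sum>i\<le>Polynomial.degree (p w). poly.coeff (p w) i * u ^ i)" by (rule poly_altdef)
      also have "\<dots> = (\<Sum>i\<le>N. poly.coeff (p w) i * u ^ i)"
        using deg[of w] by (intro sum.mono_neutral_left) (auto intro: coeff_eq_0)
      finally show ?thesis .
    qed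
    have "(\<Sum>i\<le>N. (poly.coeff (p z) i - poly.coeff (p 0) i) * f z ^ i) = poly (p z) (f z) - poly (p 0) (f z)"
      by (simp add: ev algebra_simps sum_subtractf)
    also have "\<dots> = - ((f z - f 0) * poly q (f z))"
      using elim by (subst p0) (simp add: algebra_simps)
    finally have s: "(\<Sum>i\<le>N. (poly.coeff (p z) i - poly.coeff (p 0) i) * f z ^ i) = - ((f z - f 0) * poly q (f z))" .
    have "(\<Sum>i\<le>N. (poly.coeff (p z) i - poly.coeff (p 0) i) / z * f z ^ i) =
        (\<Sum>i\<le>N. (poly.coeff (p z) i - poly.coeff (p 0) i) * f z ^ i) / z"
      by (simp add: sum_divide_distrib)
    then have "G z = ((f z - f 0) * poly q (f z)) / z / poly q (f z)" by (simp add: G_def s)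
    then show ?case using elim by simp
  qed
  then have "(\<lambda>z. (f z - f 0) / (z - 0)) \<midarrow>0\<rightarrow> - (\<Sum>i\<le>N. a i * f 0 ^ i) / poly q (f 0)"
    by (rule Lim_transform_eventually[OF G])
  then show ?thesis
    unfolding field_differentiable_def has_field_derivative_iff by blast
qed

lemma separable_root_power_holomorphic:
  assumes U: "openin (powertop_complex T) U"
    and deg: "\<And>x. Polynomial.degree (p x) \<le> N"
    and p: "\<And>i. power_holomorphic_on (\<lambda>x. poly.coeff (p x) i) T U"
    and cont: "continuous_map (subtopology (powertop_complex T) U) euclidean f"
    and root: "\<And>x. x \<in> U \<Longrightarrow> poly (p x) (f x) = 0"
    and sep: "\<And>x z. x \<in> U \<Longrightarrow> poly (p x) z = 0 \<Longrightarrow> poly (pderiv (p x)) z \<noteq> 0"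
  shows "power_holomorphic_on f T U"
  unfolding power_holomorphic_on_iff
proof (intro conjI ballI cont)
  fix x h assume x: "x \<in> U" and h: "h \<in> topspace (powertop_complex T)"
  have c0: "cline T x h 0 = x" using openin_subset[OF U] x by (intro cline_0) auto
  let ?V = "{z. cline T x h z \<in> U}"
  have oV: "open ?V"
    using openin_continuous_map_preimage[OF continuous_map_cline U, of x h] by simp
  have "continuous_map (subtopology euclidean ?V) (subtopology (powertop_complex T) U) (cline T x h)"
    by (auto simp: continuous_map_in_subtopology continuous_map_from_subtopology continuous_map_cline)
  then have "continuous_map (subtopology euclidean ?V) euclidean (f \<circ> cline T x h)"
    using cont by (rule continuous_map_compose)
  then have "continuous_on ?V (\<lambda>z. f (cline T x h z))" by (simp add: o_def)
  then have 1: "isCont (\<lambda>z. f (cline T x h z)) 0"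
    using oV x c0 by (simp add: continuous_on_eq_continuous_at)
  have 2: "\<forall>\<^sub>F z in nhds 0. poly (p (cline T x h z)) (f (cline T x h z)) = 0"
    using eventually_cline[OF U x] by eventually_elim (rule root)
  have 3: "(\<lambda>z. poly.coeff (p (cline T x h z)) i) field_differentiable at 0" for i
    using p[of i] x h unfolding power_holomorphic_on_iff by blast
  have 4: "poly (pderiv (p (cline T x h 0))) (f (cline T x h 0)) \<noteq> 0"
    unfolding c0 by (rule sep[OF x root[OF x]])
  show "(\<lambda>z. f (cline T x h z)) field_differentiable at 0"
    by (rule separable_root_differentiable[OF deg 3 1 2 4])
qed

section \<open>Reduction to finitely many coordinates\<close>

lemma qpoly_eval_real_coords_finite_dependence:
  assumes P: "qpoly_vars P \<subseteq> T <+> T"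
  shows "\<exists>F. finite F \<and> F \<subseteq> T \<and> (\<forall>x y. (\<forall>t\<in>F. x t = y t) \<longrightarrow>
      qpoly_eval P (real_coords x) = (qpoly_eval P (real_coords y) :: real))"
proof (intro exI[of _ "{t. Inl t \<in> qpoly_vars P \<or> Inr t \<in> qpoly_vars P}"] conjI allI impI)
  have fin: "finite (qpoly_vars P)" by (simp add: qpoly_vars_def)
  have "{t. Inl t \<in> qpoly_vars P \<or> Inr t \<in> qpoly_vars P} \<subseteq> case_sum id id ` qpoly_vars P"
    by force
  then show "finite {t. Inl t \<in> qpoly_vars P \<or> Inr t \<in> qpoly_vars P}"
    using fin by (meson finite_imageI finite_subset)
  show "{t. Inl t \<in> qpoly_vars P \<or> Inr t \<in> qpoly_vars P} \<subseteq> T" using P by blast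
  fix x y :: "_ \<Rightarrow> complex" assume eq: "\<forall>t\<in>{t. Inl t \<in> qpoly_vars P \<or> Inr t \<in> qpoly_vars P}. x t = y t"
  have "real_coords x v = real_coords y v" if "v \<in> qpoly_vars P" for v
    using eq that by (cases v) (auto simp: real_coords_def)
  then show "qpoly_eval P (real_coords x) = (qpoly_eval P (real_coords y) :: real)"
    unfolding qpoly_eval_def
    by (intro sum.cong refl arg_cong2[of _ _ _ _ "(*)"] arg_cong[of _ _ prod_mset] image_mset_cong)
      (auto simp: qpoly_vars_def)
qed

lemma Q_semialgebraic_finite_dependence:
  assumes "Q_semialgebraic T A"
  shows "\<exists>F. finite F \<and> F \<subseteq> T \<and> (\<forall>x\<in>topspace (powertop_complex T). \<forall>y\<in>topspace (powertop_complex T).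
    (\<forall>t\<in>F. x t = y t) \<longrightarrow> (x \<in> A \<longleftrightarrow> y \<in> A))"
  using assms
proof induct
  case (gt P)
  from qpoly_eval_real_coords_finite_dependence[OF gt]
  obtain F where F: "finite F" "F \<subseteq> T" "\<forall>x y. (\<forall>t\<in>F. x t = y t) \<longrightarrow>
      qpoly_eval P (real_coords x) = (qpoly_eval P (real_coords y) :: real)" by (elim exE conjE)
  show ?case
  proof (intro exI[of _ F] conjI ballI impI F(1,2))
    fix x y :: "_ \<Rightarrow> complex" assume "\<forall>t\<in>F. x t = y t" and xy: "x \<in> topspace (powertop_complex T)" "y \<in> topspace (powertop_complex T)"
    then have "qpoly_eval P (real_coords x) = (qpoly_eval P (real_coords y) :: real)" using F(3) by blast
    then show "x \<in> {x \<in> topspace (powertop_complex T). qpoly_eval P (real_coords x) > 0} \<longleftrightarrow>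
        y \<in> {x \<in> topspace (powertop_complex T). qpoly_eval P (real_coords x) > 0}"
      using xy by simp
  qed
next
  case (ge P)
  from qpoly_eval_real_coords_finite_dependence[OF ge]
  obtain F where F: "finite F" "F \<subseteq> T" "\<forall>x y. (\<forall>t\<in>F. x t = y t) \<longrightarrow>
      qpoly_eval P (real_coords x) = (qpoly_eval P (real_coords y) :: real)" by (elim exE conjE)
  show ?case
  proof (intro exI[of _ F] conjI ballI impI F(1,2))
    fix x y :: "_ \<Rightarrow> complex" assume "\<forall>t\<in>F. x t = y t" and xy: "x \<in> topspace (powertop_complex T)" "y \<in> topspace (powertop_complex T)"
    then have "qpoly_eval P (real_coords x) = (qpoly_eval P (real_coords y) :: real)" using F(3) by blast
    then show "x \<in> {x \<in> topspace (powertop_complex T). qpoly_eval P (real_coords x) \<ge> 0} \<longleftrightarrow>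
        y \<in> {x \<in> topspace (powertop_complex T). qpoly_eval P (real_coords x) \<ge> 0}"
      using xy by simp
  qed
next
  case (compl A)
  then show ?case by (elim exE conjE) (intro exI conjI, assumption+, blast)
next
  case (union A B)
  from union(2) obtain F where F: "finite F" "F \<subseteq> T" "\<forall>x\<in>topspace (powertop_complex T). \<forall>y\<in>topspace (powertop_complex T).
    (\<forall>t\<in>F. x t = y t) \<longrightarrow> (x \<in> A \<longleftrightarrow> y \<in> A)" by (elim exE conjE)
  from union(4) obtain F' where F': "finite F'" "F' \<subseteq> T" "\<forall>x\<in>topspace (powertop_complex T). \<forall>y\<in>topspace (powertop_complex T).
    (\<forall>t\<in>F'. x t = y t) \<longrightarrow> (x \<in> B \<longleftrightarrow> y \<in> B)" by (elim exE conjE)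
  show ?case
  proof (intro exI[of _ "F \<union> F'"] conjI ballI impI)
    fix x y assume xy: "x \<in> topspace (powertop_complex T)" "y \<in> topspace (powertop_complex T)" "\<forall>t\<in>F \<union> F'. x t = y t"
    have "x \<in> A \<longleftrightarrow> y \<in> A" by (rule F(3)[rule_format, OF xy(1,2)]) (simp add: xy(3))
    moreover have "x \<in> B \<longleftrightarrow> y \<in> B" by (rule F'(3)[rule_format, OF xy(1,2)]) (simp add: xy(3))
    ultimately show "x \<in> A \<union> B \<longleftrightarrow> y \<in> A \<union> B" by simp
  qed (use F(1,2) F'(1,2) in auto)
next
  case (inter A B)
  from inter(2) obtain F where F: "finite F" "F \<subseteq> T" "\<forall>x\<in>topspace (powertop_complex T). \<forall>y\<in>topspace (powertop_complex T).
    (\<forall>t\<in>F. x t = y t) \<longrightarrow> (x \<in> A \<longleftrightarrow> y \<in> A)" by (elim exE conjE)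
  from inter(4) obtain F' where F': "finite F'" "F' \<subseteq> T" "\<forall>x\<in>topspace (powertop_complex T). \<forall>y\<in>topspace (powertop_complex T).
    (\<forall>t\<in>F'. x t = y t) \<longrightarrow> (x \<in> B \<longleftrightarrow> y \<in> B)" by (elim exE conjE)
  show ?case
  proof (intro exI[of _ "F \<union> F'"] conjI ballI impI)
    fix x y assume xy: "x \<in> topspace (powertop_complex T)" "y \<in> topspace (powertop_complex T)" "\<forall>t\<in>F \<union> F'. x t = y t"
    have "x \<in> A \<longleftrightarrow> y \<in> A" by (rule F(3)[rule_format, OF xy(1,2)]) (simp add: xy(3))
    moreover have "x \<in> B \<longleftrightarrow> y \<in> B" by (rule F'(3)[rule_format, OF xy(1,2)]) (simp add: xy(3))
    ultimately show "x \<in> A \<inter> B \<longleftrightarrow> y \<in> A \<inter> B" by simp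
  qed (use F(1,2) F'(1,2) in auto)
qed

lemma dist_lookup_le:
  fixes s s' :: "'t \<Rightarrow>\<^sub>0 'b::real_normed_vector"
  shows "dist (icoeff s t) (icoeff s' t) \<le> dist s s'"
proof (cases "t \<in> Poly_Mapping.keys s \<union> Poly_Mapping.keys s'")
  case True
  then show ?thesis unfolding dist_poly_mapping_def by (intro member_le_sum) auto
qed (simp add: in_keys_iff)

lemma continuous_on_lookup: "continuous_on S (\<lambda>s::'t \<Rightarrow>\<^sub>0 'b::real_normed_vector. icoeff s t)"
  unfolding continuous_on_iff by (meson dist_lookup_le le_less_trans)

lemma continuous_on_single: "continuous_on S (\<lambda>a::'b::real_normed_vector. isingle t a)"
proof -
  have "dist (isingle t a) (isingle t b) = dist a b" for a b :: 'b
  proof -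
    have "dist (isingle t a) (isingle t b) = (\<Sum>n\<in>{t}. dist (icoeff (isingle t a) n) (icoeff (isingle t b) n))"
      unfolding dist_poly_mapping_def by (rule sum.mono_neutral_left) auto
    then show ?thesis by simp
  qed
  then show ?thesis unfolding continuous_on_iff by metis
qed

text \<open>The finitely many coordinates that matter span a finite-dimensional section of \<open>U\<close>. It lives
  in the normed space of finitely supported functions, where covering space theory is available.\<close>

lemma separable_root_continuous:
  fixes p :: "('t \<Rightarrow> complex) \<Rightarrow> complex poly"
  assumes U: "openin (powertop_complex T) U" "simply_connectedin (powertop_complex T) U"
    and F: "finite F" "F \<subseteq> T"
    and cyl: "\<And>x y. x \<in> U \<Longrightarrow> y \<in> topspace (powertop_complex T) \<Longrightarrow> (\<forall>t\<in>F. x t = y t) \<Longrightarrow> y \<in> U \<and> p x = p y"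
    and deg: "\<And>x. x \<in> U \<Longrightarrow> Polynomial.degree (p x) = N" "0 < N"
    and monic: "\<And>x. x \<in> U \<Longrightarrow> poly.coeff (p x) N = 1"
    and cont: "\<And>i. continuous_map (subtopology (powertop_complex T) U) euclidean (\<lambda>x. poly.coeff (p x) i)"
    and sep: "\<And>x z. x \<in> U \<Longrightarrow> poly (p x) z = 0 \<Longrightarrow> poly (pderiv (p x)) z \<noteq> 0"
  shows "\<exists>f. continuous_map (subtopology (powertop_complex T) U) euclidean f \<and> (\<forall>x\<in>U. poly (p x) (f x) = 0)"
proof -
  let ?Y = "subtopology (powertop_complex T) U"
  have Ut: "U \<subseteq> topspace (powertop_complex T)" using U(1) openin_subset by blast
  then have tY: "topspace ?Y = U" by (simp only: topspace_subtopology) blast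
  \<comment> \<open>\<open>\<pi>\<close> forgets the coordinates outside \<open>F\<close> and
    \<open>\<iota>\<close> fills them with zero. Their composition on \<open>U\<close> changes only
    coordinates outside \<open>F\<close>, so by \<open>cyl\<close> it stays in \<open>U\<close> and
    preserves the polynomial.\<close>
  define \<iota> where "\<iota> s = (\<lambda>t\<in>T. icoeff s t)" for s :: "'t \<Rightarrow>\<^sub>0 complex"
  define \<pi> where "\<pi> x = (\<Sum>t\<in>F. isingle t (x t))" for x :: "'t \<Rightarrow> complex"
  define W where "W = {s::'t \<Rightarrow>\<^sub>0 complex. Poly_Mapping.keys s \<subseteq> F}"
  define S where "S = {s \<in> W. \<iota> s \<in> U}"
  have lookup_\<pi>: "icoeff (\<pi> x) t = (if t \<in> F then x t else 0)" for x t
    using F(1) by (simp add: \<pi>_def lookup_sum lookup_single when_def)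
  have \<pi>W: "\<pi> x \<in> W" for x by (auto simp: W_def in_keys_iff lookup_\<pi> split: if_splits)
  have \<iota>top: "\<iota> s \<in> topspace (powertop_complex T)" for s by (simp add: \<iota>_def)
  have \<iota>\<pi>: "\<iota> (\<pi> x) t = x t" if "t \<in> F" for x t using that F(2) by (auto simp: \<iota>_def lookup_\<pi>)
  have \<pi>\<iota>: "\<pi> (\<iota> s) = s" if "s \<in> W" for s
    using that F(2) by (intro poly_mapping_eqI) (auto simp: lookup_\<pi> \<iota>_def W_def in_keys_iff)
  have cyl': "\<iota> (\<pi> x) \<in> U" "p (\<iota> (\<pi> x)) = p x" if "x \<in> U" for x
    using cyl[OF that \<iota>top[of "\<pi> x"]] \<iota>\<pi> by auto
  have \<pi>S: "\<pi> x \<in> S" if "x \<in> U" for x using cyl' \<pi>W that by (auto simp: S_def)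
  have cont_\<iota>: "continuous_map (top_of_set A) (powertop_complex T) \<iota>" for A
    unfolding continuous_map_componentwise by (auto simp: \<iota>_def intro: continuous_on_lookup)
  have cont_\<iota>S: "continuous_map (top_of_set S) ?Y \<iota>"
    using cont_\<iota> by (auto simp: continuous_map_in_subtopology S_def)
  have cont_\<pi>: "continuous_map ?Y euclidean \<pi>"
    unfolding \<pi>_def
  proof (intro continuous_map_sum F)
    fix t assume "t \<in> F"
    then have "continuous_map ?Y euclidean (\<lambda>x. x t)"
      using F(2) by (intro continuous_map_from_subtopology continuous_map_product_projection) auto
    moreover have "continuous_map euclidean euclidean (isingle t :: complex \<Rightarrow> _)"
      using continuous_on_single[of UNIV t] by simp
    ultimately have "continuous_map ?Y euclidean (isingle t \<circ> (\<lambda>x. x t))" by (rule continuous_map_compose)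
    then show "continuous_map ?Y euclidean (\<lambda>x. isingle t (x t))" by (simp add: o_def)
  qed
  have cont_\<pi>S: "continuous_map ?Y (top_of_set S) \<pi>"
    using cont_\<pi> \<pi>S by (auto simp: continuous_map_in_subtopology tY)
  have "openin (top_of_set W) S"
    using openin_continuous_map_preimage[OF cont_\<iota>[of W] U(1)] by (simp add: S_def)
  moreover have "convex W"
    unfolding convex_def
  proof (intro ballI allI impI)
    fix s s' :: "'t \<Rightarrow>\<^sub>0 complex" and u v :: real assume W: "s \<in> W" "s' \<in> W"
    have W_iff: "r \<in> W \<longleftrightarrow> (\<forall>t. t \<notin> F \<longrightarrow> icoeff r t = 0)" for r
      by (auto simp: W_def in_keys_iff subset_iff)
    have scale: "icoeff (u *\<^sub>R a) t = u *\<^sub>R icoeff a t" for u t and a :: "'t \<Rightarrow>\<^sub>0 complex"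
    proof -
      have "finite {i. u *\<^sub>R icoeff a i \<noteq> 0}"
        by (rule finite_subset[of _ "Poly_Mapping.keys a"]) (auto simp: in_keys_iff)
      then show ?thesis by (simp add: scaleR_poly_mapping_def)
    qed
    show "u *\<^sub>R s + v *\<^sub>R s' \<in> W"
      using W by (simp add: W_iff lookup_add scale)
  qed
  ultimately have lpc: "locally path_connected S"
    by (intro locally_open_subset[of path_connected W S] convex_imp_locally_path_connected)
  \<comment> \<open>\<open>\<pi>\<close> after \<open>\<iota>\<close> is the identity on
    \<open>S\<close>: loops in \<open>S\<close> are sent to \<open>U\<close>, and a homotopy found
    there is pushed back to \<open>S\<close>.\<close>
  have "simply_connectedin euclidean S"
    unfolding simply_connectedin_def
  proof (intro conjI allI impI, simp, elim conjE)
    fix a b assume a: "pathin (top_of_set S) a" "a 1 = a 0" and b: "pathin (top_of_set S) b" "b 1 = b 0"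
    have "pathin ?Y (\<iota> \<circ> a)" "pathin ?Y (\<iota> \<circ> b)"
      using continuous_map_compose[OF a(1)[unfolded pathin_def] cont_\<iota>S]
        continuous_map_compose[OF b(1)[unfolded pathin_def] cont_\<iota>S]
      by (simp_all only: pathin_def)
    then have "homotopic_with (\<lambda>r. r 1 = r 0) (top_of_set {0..1::real}) ?Y (\<iota> \<circ> a) (\<iota> \<circ> b)"
      using U(2) a(2) b(2) unfolding simply_connectedin_def by simp
    then have h: "homotopic_with (\<lambda>r. r 1 = r 0) (top_of_set {0..1::real}) (top_of_set S) (\<pi> \<circ> (\<iota> \<circ> a)) (\<pi> \<circ> (\<iota> \<circ> b))"
      by (rule homotopic_with_compose_continuous_map_left[OF _ cont_\<pi>S]) simp
    have inS: "c r \<in> S" if "pathin (top_of_set S) c" "r \<in> {0..1}" for c and r :: real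
      using that unfolding pathin_def by (auto simp: Pi_iff)
    have "\<pi> (\<iota> (c r)) = c r" if "pathin (top_of_set S) c" "r \<in> {0..1}" for c and r :: real
      using inS[OF that] \<pi>\<iota> by (simp add: S_def)
    then show "homotopic_with (\<lambda>r. r 1 = r 0) (top_of_set {0..1::real}) (top_of_set S) a b"
      using a b by (intro homotopic_with_eq[OF h]) auto
  qed
  then have sc: "simply_connected S" by (simp add: simply_connectedin_euclidean)
  have "\<exists>f. continuous_on S f \<and> (\<forall>s\<in>S. poly (p (\<iota> s)) (f s) = 0)"
  proof (rule separable_root_section[OF _ deg(2) _ _ _ sc lpc])
    have "continuous_map (top_of_set S) euclidean ((\<lambda>x. poly.coeff (p x) i) \<circ> \<iota>)" for i
      by (rule continuous_map_compose[OF cont_\<iota>S cont])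
    then show "continuous_on S (\<lambda>s. poly.coeff (p (\<iota> s)) i)" for i by (simp add: o_def)
  qed (use deg monic sep in \<open>auto simp: S_def\<close>)
  then obtain f where f: "continuous_on S f" "\<And>s. s \<in> S \<Longrightarrow> poly (p (\<iota> s)) (f s) = 0" by blast
  have "continuous_map ?Y euclidean (f \<circ> \<pi>)"
    using f(1) by (intro continuous_map_compose[OF cont_\<pi>S]) simp
  moreover have "poly (p x) ((f \<circ> \<pi>) x) = 0" if "x \<in> U" for x
    using f(2)[OF \<pi>S[OF that]] cyl'[OF that] by simp
  ultimately show ?thesis by blast
qed

section \<open>Nash functions on the members of a filter\<close>

text \<open>Without the convention on values outside \<open>U\<close>, so that functions can be
  added, multiplied and restricted freely; \<open>extensional\<close> returns only in the
  germs.\<close>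

definition nash_on :: "'t set \<Rightarrow> ('t \<Rightarrow> complex) set \<Rightarrow> (('t \<Rightarrow> complex) \<Rightarrow> complex) \<Rightarrow> bool"
  where "nash_on T U f \<longleftrightarrow> power_holomorphic_on f T U \<and> Q_algebraic_fun T U f"

lemma nash_functions_iff: "f \<in> nash_functions T U \<longleftrightarrow> f \<in> extensional U \<and> nash_on T U f"
  by (simp add: nash_functions_def nash_on_def Q_algebraic_fun_iff_qpoly)

lemma nash_on_cong:
  "openin (powertop_complex T) U \<Longrightarrow> nash_on T U f \<Longrightarrow> (\<And>x. x \<in> U \<Longrightarrow> f x = g x) \<Longrightarrow> nash_on T U g"
  unfolding nash_on_def
  using power_holomorphic_on_cong[of T U f g] Q_algebraic_fun_subset_cong[of T U f U g] by auto

lemma nash_on_subset: "nash_on T U f \<Longrightarrow> V \<subseteq> U \<Longrightarrow> nash_on T V f"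
  unfolding nash_on_def
  using power_holomorphic_on_subset[of f T U V] Q_algebraic_fun_subset_cong[of T U f V f] by auto

lemma nash_on_add: "nash_on T U f \<Longrightarrow> nash_on T U g \<Longrightarrow> nash_on T U (\<lambda>x. f x + g x)"
  unfolding nash_on_def by (auto intro: power_holomorphic_on_add Q_algebraic_fun_add)

lemma nash_on_mult: "nash_on T U f \<Longrightarrow> nash_on T U g \<Longrightarrow> nash_on T U (\<lambda>x. f x * g x)"
  unfolding nash_on_def by (auto intro: power_holomorphic_on_mult Q_algebraic_fun_mult)

lemma nash_on_poly: "ipoly_vars P \<subseteq> T \<Longrightarrow> nash_on T U (ipoly_eval P)"
  unfolding nash_on_def by (auto intro: power_holomorphic_on_poly Q_algebraic_fun_poly)

lemma nash_on_of_int: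
  fixes T :: "'t set"
  shows "nash_on T U (\<lambda>_. of_int k)"
proof -
  have "ipoly_eval (isingle {#} k) = (\<lambda>_::'t \<Rightarrow> complex. of_int k :: complex)" by (rule ext) simp
  moreover have "ipoly_vars (isingle {#} k) \<subseteq> T" by (rule order_trans[OF ipoly_vars_single]) simp
  ultimately show ?thesis using nash_on_poly[of "isingle {#} k" T U] by simp
qed

lemma nash_on_0 [simp]: "nash_on T U (\<lambda>_. 0)" and nash_on_1 [simp]: "nash_on T U (\<lambda>_. 1)"
  using nash_on_of_int[of T U 0] nash_on_of_int[of T U 1] by simp_all

lemma nash_on_of_nat: "nash_on T U (\<lambda>_. of_nat k)"
  using nash_on_of_int[of T U "int k"] by simp

lemma nash_on_uminus: "nash_on T U f \<Longrightarrow> nash_on T U (\<lambda>x. - f x)"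
  using nash_on_mult[OF nash_on_of_int[of T U "-1"], of f] by simp

lemma nash_on_inverse:
  "U \<subseteq> topspace (powertop_complex T) \<Longrightarrow> nash_on T U f \<Longrightarrow> (\<And>x. x \<in> U \<Longrightarrow> f x \<noteq> 0) \<Longrightarrow>
    nash_on T U (\<lambda>x. inverse (f x))"
  unfolding nash_on_def by (auto intro!: power_holomorphic_on_inverse Q_algebraic_fun_inverse)

lemma nash_on_sum: "(\<And>i. i \<in> A \<Longrightarrow> nash_on T U (f i)) \<Longrightarrow> nash_on T U (\<lambda>x. \<Sum>i\<in>A. f i x)"
  by (induct A rule: infinite_finite_induct) (auto intro: nash_on_add)

lemma nash_on_power: "nash_on T U f \<Longrightarrow> nash_on T U (\<lambda>x. f x ^ n)"
  by (induct n) (auto intro: nash_on_mult)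

lemma nash_on_coordinate: "t \<in> T \<Longrightarrow> nash_on T U (\<lambda>x. x t)"
proof -
  assume "t \<in> T"
  moreover have "ipoly_eval (isingle {#t#} 1) = (\<lambda>x. x t :: complex)" by (rule ext) simp
  ultimately show ?thesis
    using nash_on_poly[of "isingle {#t#} 1" T U] by (simp add: ipoly_vars_def)
qed

section \<open>Zeros of polynomials and Nash functions along a c-filter\<close>

locale nash_filter =
  fixes T :: "'t set" and \<Omega> :: "('t \<Rightarrow> complex) set set"
  assumes c_filter: "c_filter T \<Omega>"
begin

lemmas c_filterD = c_filter[unfolded c_filter_def, THEN conjunct1, rule_format]
  c_filter[unfolded c_filter_def, THEN conjunct2, THEN conjunct1, rule_format]
  c_filter[unfolded c_filter_def, THEN conjunct2, THEN conjunct2, THEN conjunct1, rule_format]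
  c_filter[unfolded c_filter_def, THEN conjunct2, THEN conjunct2, THEN conjunct2, rule_format]

lemma filter_open: "U \<in> \<Omega> \<Longrightarrow> openin (powertop_complex T) U"
  and filter_nonempty: "U \<in> \<Omega> \<Longrightarrow> U \<noteq> {}"
  and filter_connected: "U \<in> \<Omega> \<Longrightarrow> connectedin (powertop_complex T) U"
  using c_filterD(1) by simp_all

lemma filter_topspace: "U \<in> \<Omega> \<Longrightarrow> U \<subseteq> topspace (powertop_complex T)"
  by (rule openin_subset[OF filter_open])

lemma filter_inter: "U \<in> \<Omega> \<Longrightarrow> V \<in> \<Omega> \<Longrightarrow> \<exists>W\<in>\<Omega>. W \<subseteq> U \<and> W \<subseteq> V"
  using c_filterD(3)[of U V] by auto

text \<open>The hypersurface of \<open>P\<close> is a proper algebraic set because a nonzero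
  polynomial has a nonzero value, so condition (ii) of a c-filter applies. In this sense the filter
  approaches a generic point.\<close>

lemma avoid_zeros:
  assumes P: "P \<noteq> 0" "ipoly_vars P \<subseteq> T"
  shows "\<exists>V\<in>\<Omega>. \<forall>x\<in>V. ipoly_eval P x \<noteq> 0"
proof -
  obtain Q :: "'t qpoly" where Q: "Poly_Mapping.keys Q = Poly_Mapping.keys P"
    "\<And>x::'t \<Rightarrow> complex. qpoly_eval Q x = ipoly_eval P x"
    using qpoly_of_ipoly[of P, where 'c=complex] by blast
  let ?Z = "{x \<in> topspace (powertop_complex T). \<forall>P\<in>{Q}. qpoly_eval P x = 0}"
  have "qpoly_vars Q \<subseteq> T" using P(2) Q(1) by (simp add: qpoly_vars_def ipoly_vars_def)
  then have "Q_algebraic T ?Z" unfolding Q_algebraic_def by (intro exI[of _ "{Q}"]) auto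
  moreover have "?Z \<subset> topspace (powertop_complex T)"
  proof -
    obtain x :: "'t \<Rightarrow> complex" where x: "ipoly_eval P x \<noteq> 0" using ipoly_nonzero_point[OF P(1)] by blast
    have "ipoly_eval P (restrict x T) = ipoly_eval P x"
      by (rule ipoly_eval_cong) (use P(2) in auto)
    then have "restrict x T \<notin> ?Z" "restrict x T \<in> topspace (powertop_complex T)" using x Q(2) by auto
    then show ?thesis by blast
  qed
  ultimately obtain V where V: "V \<in> \<Omega>" "?Z \<inter> V = {}"
    using c_filterD(2)[of ?Z] by blast
  have "ipoly_eval P x \<noteq> 0" if "x \<in> V" for x
  proof
    assume "ipoly_eval P x = 0"
    then have "x \<in> ?Z" using Q(2) filter_topspace[OF V(1)] that by auto
    then show False using V(2) that by blast
  qed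
  then show ?thesis using V(1) by blast
qed

lemma avoid_zeros_below:
  assumes "P \<noteq> 0" "ipoly_vars P \<subseteq> T" "U \<in> \<Omega>"
  shows "\<exists>V\<in>\<Omega>. V \<subseteq> U \<and> (\<forall>x\<in>V. ipoly_eval P x \<noteq> 0)"
proof -
  obtain V where V: "V \<in> \<Omega>" "\<forall>x\<in>V. ipoly_eval P x \<noteq> 0" using avoid_zeros[OF assms(1,2)] by blast
  obtain W where "W \<in> \<Omega>" "W \<subseteq> U" "W \<subseteq> V" using filter_inter[OF assms(3) V(1)] by blast
  then show ?thesis using V(2) by blast
qed

lemma filter_exists: "\<exists>U. U \<in> \<Omega>"
  using avoid_zeros[of 1] by (auto simp: ipoly_vars_def)

lemma shrink_finite:
  assumes "finite A" "U \<in> \<Omega>"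
    and step: "\<And>i V. i \<in> A \<Longrightarrow> V \<in> \<Omega> \<Longrightarrow> V \<subseteq> U \<Longrightarrow> \<exists>W\<in>\<Omega>. W \<subseteq> V \<and> Q i W"
    and mono: "\<And>i V W. Q i V \<Longrightarrow> W \<subseteq> V \<Longrightarrow> Q i W"
  shows "\<exists>V\<in>\<Omega>. V \<subseteq> U \<and> (\<forall>i\<in>A. Q i V)"
  using assms(1) step
proof (induct A rule: finite_induct)
  case empty
  show ?case using assms(2) by blast
next
  case (insert i A)
  have "\<exists>V\<in>\<Omega>. V \<subseteq> U \<and> (\<forall>i\<in>A. Q i V)" by (rule insert.hyps(3)) (use insert.prems in blast)
  then obtain V where V: "V \<in> \<Omega>" "V \<subseteq> U" "\<forall>i\<in>A. Q i V" by blast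
  obtain W where W: "W \<in> \<Omega>" "W \<subseteq> V" "Q i W" using insert.prems[of i V] V by blast
  have "Q j W" if "j \<in> A" for j using mono[of j V W] V(3) W(2) that by blast
  then show ?case using W V(2) by (intro bexI[of _ W]) auto
qed

text \<open>Dividing a relation for \<open>f\<close> by a power of \<open>f\<close> gives one with constant term \<open>C k\<close>. Where
  \<open>C k\<close> has no zeros, \<open>f\<close> vanishes exactly where the quotient relation does not, so the zero set of
  \<open>f\<close> is clopen.\<close>

lemma nash_zero_or_nonvanishing:
  assumes U: "U \<in> \<Omega>" and f: "nash_on T U f"
  shows "\<exists>V\<in>\<Omega>. V \<subseteq> U \<and> ((\<forall>x\<in>V. f x = 0) \<or> (\<forall>x\<in>V. f x \<noteq> 0))"
proof -
  obtain n C i where C: "\<And>i. ipoly_vars (C i) \<subseteq> T" "i \<le> n" "C i \<noteq> 0"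
    "\<And>x. x \<in> U \<Longrightarrow> (\<Sum>i\<le>n. ipoly_eval (C i) x * f x ^ i) = 0"
    using f unfolding nash_on_def Q_algebraic_fun_def by blast
  define k where "k = (LEAST i. C i \<noteq> 0)"
  have Ck: "C k \<noteq> 0" unfolding k_def by (rule LeastI[of _ i]) (rule C(3))
  have kn: "k \<le> n" using Least_le[of "\<lambda>i. C i \<noteq> 0" i] C(2,3) by (simp add: k_def)
  have less: "C j = 0" if "j < k" for j using not_less_Least[of j "\<lambda>i. C i \<noteq> 0"] that by (simp add: k_def)
  obtain V where V: "V \<in> \<Omega>" "V \<subseteq> U" "\<forall>x\<in>V. ipoly_eval (C k) x \<noteq> 0"
    using avoid_zeros_below[OF Ck C(1) U] by blast
  define g where "g x = (\<Sum>i\<le>n-k. ipoly_eval (C (i + k)) x * f x ^ i)" for x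
  have split: "(\<Sum>i\<le>n. ipoly_eval (C i) x * f x ^ i) = f x ^ k * g x" for x
  proof -
    have "(\<Sum>i\<le>n. ipoly_eval (C i) x * f x ^ i) = (\<Sum>i\<in>{k..n}. ipoly_eval (C i) x * f x ^ i)"
      using less by (intro sum.mono_neutral_right) auto
    also have "\<dots> = (\<Sum>i\<le>n-k. ipoly_eval (C (i + k)) x * f x ^ (i + k))"
      by (rule sum.reindex_bij_witness[of _ "\<lambda>i. i + k" "\<lambda>i. i - k"]) (use kn in auto)
    finally show ?thesis by (simp add: g_def sum_distrib_left power_add algebra_simps)
  qed
  have zero: "f x = 0 \<longleftrightarrow> g x \<noteq> 0" if x: "x \<in> V" for x
  proof
    assume "f x = 0"
    then have "g x = ipoly_eval (C (0 + k)) x" unfolding g_def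
      by (subst sum.atMost_shift) simp
    then show "g x \<noteq> 0" using V(3) x by simp
  next
    assume "g x \<noteq> 0"
    then show "f x = 0" using split[of x] C(4)[of x] V(2) x by auto
  qed
  have fV: "nash_on T V f" using nash_on_subset[OF f V(2)] .
  then have "nash_on T V g" unfolding g_def
    by (intro nash_on_sum nash_on_mult nash_on_power nash_on_poly C(1))
  then have cg: "continuous_map (subtopology (powertop_complex T) V) euclidean g"
    and cf: "continuous_map (subtopology (powertop_complex T) V) euclidean f"
    using fV by (auto simp: nash_on_def power_holomorphic_on_iff)
  have top: "topspace (subtopology (powertop_complex T) V) = V"
    using filter_topspace[OF V(1)] by (simp only: topspace_subtopology) blast
  have "closedin (subtopology (powertop_complex T) V) {x \<in> V. f x \<in> {0}}"
    using closedin_continuous_map_preimage[OF cf, of "{0}", unfolded top] by simp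
  moreover have "openin (subtopology (powertop_complex T) V) {x \<in> V. g x \<in> - {0}}"
    using openin_continuous_map_preimage[OF cg, of "- {0}", unfolded top] by (simp add: open_Compl)
  moreover have "{x \<in> V. g x \<in> - {0}} = {x \<in> V. f x \<in> {0}}" using zero by auto
  moreover have "connected_space (subtopology (powertop_complex T) V)"
    using filter_connected[OF V(1)] by (simp add: connectedin_def)
  ultimately have "{x \<in> V. f x \<in> {0}} = {} \<or> {x \<in> V. f x \<in> {0}} = V"
    unfolding connected_space_clopen_in top by metis
  then show ?thesis using V(1,2) by (intro bexI[of _ V]) auto
qed

text \<open>On a segment along which the coordinates in the relation are fixed, \<open>f\<close>
  takes values among the finitely many roots of one nonzero polynomial, so by continuity it is
  constant there. The segment has to be assumed to lie in \<open>V\<close>, which need not be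
  convex.\<close>

lemma nash_finite_dependence:
  assumes U: "U \<in> \<Omega>" and f: "nash_on T U f"
  shows "\<exists>V\<in>\<Omega>. V \<subseteq> U \<and> (\<exists>F. finite F \<and> F \<subseteq> T \<and> (\<forall>x\<in>V. \<forall>y\<in>V. (\<forall>t\<in>F. x t = y t) \<longrightarrow>
    (\<forall>s::real\<in>{0..1}. cline T x (\<lambda>t. y t - x t) (of_real s) \<in> V) \<longrightarrow> f x = f y))"
proof -
  obtain n C i where C: "\<And>i. ipoly_vars (C i) \<subseteq> T" "i \<le> n" "C i \<noteq> 0"
    "\<And>x. x \<in> U \<Longrightarrow> (\<Sum>i\<le>n. ipoly_eval (C i) x * f x ^ i) = 0"
    using f unfolding nash_on_def Q_algebraic_fun_def by blast
  obtain V where V: "V \<in> \<Omega>" "V \<subseteq> U" "\<forall>x\<in>V. ipoly_eval (C i) x \<noteq> 0"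
    using avoid_zeros_below[OF C(3,1) U] by blast
  have "f x = f y" if x: "x \<in> V" and y: "y \<in> V" and eq: "\<forall>t\<in>(\<Union>i\<le>n. ipoly_vars (C i)). x t = y t"
    and seg: "\<forall>s::real\<in>{0..1}. cline T x (\<lambda>t. y t - x t) (of_real s) \<in> V" for x y
  proof -
    define l where "l s = cline T x (\<lambda>t. y t - x t) (of_real s)" for s :: real
    have xt: "x \<in> topspace (powertop_complex T)" and yt: "y \<in> topspace (powertop_complex T)"
      using filter_topspace[OF V(1)] x y by auto
    have l0: "l 0 = x" using cline_0[OF xt] by (simp add: l_def)
    have l1: "l 1 = y" using yt by (auto simp: l_def cline_def PiE_def extensional_def)
    have "continuous_map (top_of_set {0..1::real}) euclidean (of_real :: real \<Rightarrow> complex)"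
      by (auto intro: continuous_intros)
    then have "continuous_map (top_of_set {0..1::real}) (powertop_complex T) (cline T x (\<lambda>t. y t - x t) \<circ> of_real)"
      using continuous_map_cline by (rule continuous_map_compose)
    then have "continuous_map (top_of_set {0..1::real}) (subtopology (powertop_complex T) V) l"
      using seg by (auto simp: continuous_map_in_subtopology o_def l_def[abs_def])
    moreover have "continuous_map (subtopology (powertop_complex T) V) euclidean f"
      using nash_on_subset[OF f V(2)] by (simp add: nash_on_def power_holomorphic_on_iff)
    ultimately have "continuous_map (top_of_set {0..1::real}) euclidean (f \<circ> l)"
      by (rule continuous_map_compose)
    then have cont: "continuous_on {0..1} (f \<circ> l)" by simp
    have "(f \<circ> l) ` {0..1} \<subseteq> {w. (\<Sum>i\<le>n. ipoly_eval (C i) x * w ^ i) = 0}"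
    proof
      fix w assume "w \<in> (f \<circ> l) ` {0..1}"
      then obtain s where s: "s \<in> {0..1}" "w = f (l s)" by auto
      have "ipoly_eval (C j) (l s) = ipoly_eval (C j) x" if "j \<le> n" for j
        using eq that C(1)[of j] by (intro ipoly_eval_cong) (auto simp: l_def cline_def)
      moreover have "l s \<in> U" using seg s V(2) by (auto simp: l_def)
      ultimately have "(\<Sum>i\<le>n. ipoly_eval (C i) x * w ^ i) = 0"
        using C(4)[of "l s"] s(2) by simp
      then show "w \<in> {w. (\<Sum>i\<le>n. ipoly_eval (C i) x * w ^ i) = 0}" by simp
    qed
    moreover have "finite {w. (\<Sum>i\<le>n. ipoly_eval (C i) x * w ^ i) = 0}"
      using V(3) x C(2) by (intro polyfun_rootbound_finite) auto
    ultimately have "(f \<circ> l) constant_on {0..1}"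
      using finite_subset by (intro continuous_finite_range_constant[OF _ cont]) auto
    then have "(f \<circ> l) 0 = (f \<circ> l) 1" unfolding constant_on_def by (metis atLeastAtMost_iff order_refl zero_le_one)
    then show ?thesis using l0 l1 by simp
  qed
  moreover have "finite (\<Union>i\<le>n. ipoly_vars (C i))" by simp
  moreover have "(\<Union>i\<le>n. ipoly_vars (C i)) \<subseteq> T" using C(1) by (rule UN_least)
  ultimately show ?thesis
    using V(1,2) by (intro bexI[of _ V] conjI exI[of _ "\<Union>i\<le>n. ipoly_vars (C i)"] ballI impI)
qed

section \<open>Splitting monic polynomials over the Nash functions\<close>

definition monic_poly :: "nat \<Rightarrow> (nat \<Rightarrow> ('t \<Rightarrow> complex) \<Rightarrow> complex) \<Rightarrow> ('t \<Rightarrow> complex) \<Rightarrow> complex poly"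
  where "monic_poly n a x = Polynomial.monom 1 n + (\<Sum>i<n. Polynomial.monom (a i x) i)"

lemma coeff_monic_poly: "poly.coeff (monic_poly n a x) i = (if i = n then 1 else if i < n then a i x else 0)"
  by (simp add: monic_poly_def coeff_sum)

lemma degree_monic_poly [simp]: "Polynomial.degree (monic_poly n a x) = n"
  by (rule antisym) (auto intro!: degree_le le_degree simp: coeff_monic_poly)

lemma poly_monic_poly: "poly (monic_poly n a x) w = w ^ n + (\<Sum>i<n. a i x * w ^ i)"
  by (simp add: monic_poly_def poly_sum poly_monom)

lemma monic_poly_eqI:
  assumes "Polynomial.degree (Q x) = n" "poly.coeff (Q x) n = 1"
  shows "monic_poly n (\<lambda>i x. poly.coeff (Q x) i) x = Q x"
  using assms by (intro poly_eqI) (auto simp: coeff_monic_poly coeff_eq_0)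

text \<open>Condition (iv) inserts a simply connected \<open>U0\<close> between two members of the
  filter. Being semialgebraic, \<open>U0\<close> depends on finitely many coordinates and contains
  every segment in the other directions, so that on it the coefficients, too, depend on finitely
  many coordinates. A continuous root on \<open>U0\<close> is then holomorphic and algebraic, and it
  is restricted to the smaller member.\<close>

lemma nash_separable_root:
  assumes U: "U \<in> \<Omega>" and N: "0 < N" and a: "\<And>i. i < N \<Longrightarrow> nash_on T U (a i)"
    and sep: "\<And>x z. x \<in> U \<Longrightarrow> poly (monic_poly N a x) z = 0 \<Longrightarrow> poly (pderiv (monic_poly N a x)) z \<noteq> 0"
  shows "\<exists>V\<in>\<Omega>. V \<subseteq> U \<and> (\<exists>f. nash_on T V f \<and> (\<forall>x\<in>V. poly (monic_poly N a x) (f x) = 0))"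
proof -
  define dep where "dep i V \<longleftrightarrow> (\<exists>F. finite F \<and> F \<subseteq> T \<and> (\<forall>x\<in>V. \<forall>y\<in>V. (\<forall>t\<in>F. x t = y t) \<longrightarrow>
    (\<forall>s::real\<in>{0..1}. cline T x (\<lambda>t. y t - x t) (of_real s) \<in> V) \<longrightarrow> a i x = a i y))" for i V
  have "\<exists>V\<in>\<Omega>. V \<subseteq> U \<and> (\<forall>i\<in>{..<N}. dep i V)"
  proof (rule shrink_finite[OF _ U])
    show "\<exists>W\<in>\<Omega>. W \<subseteq> V \<and> dep i W" if "i \<in> {..<N}" "V \<in> \<Omega>" "V \<subseteq> U" for i V
      unfolding dep_def using a[of i] that nash_on_subset by (intro nash_finite_dependence) auto
    show "dep i W" if dep: "dep i V" and "W \<subseteq> V" for i V W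
    proof -
      obtain F where F: "finite F" "F \<subseteq> T" "\<forall>x\<in>V. \<forall>y\<in>V. (\<forall>t\<in>F. x t = y t) \<longrightarrow>
        (\<forall>s::real\<in>{0..1}. cline T x (\<lambda>t. y t - x t) (of_real s) \<in> V) \<longrightarrow> a i x = a i y"
        using dep unfolding dep_def by (elim exE conjE)
      show ?thesis unfolding dep_def
        by (rule exI[of _ F]) (use F \<open>W \<subseteq> V\<close> in \<open>simp, meson subsetD\<close>)
    qed
  qed simp
  then obtain U1 where U1: "U1 \<in> \<Omega>" "U1 \<subseteq> U" "\<And>i. i < N \<Longrightarrow> dep i U1" by auto
  obtain U0 V where U0: "openin (powertop_complex T) U0"
    "simply_connectedin (powertop_complex T) U0" "Q_semialgebraic T U0" "V \<in> \<Omega>" "V \<subseteq> U0" "U0 \<subseteq> U1"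
    using c_filterD(4)[OF U1(1)] by (elim exE conjE bexE)
  obtain F0 where F0: "finite F0" "F0 \<subseteq> T" "\<forall>x\<in>topspace (powertop_complex T). \<forall>y\<in>topspace (powertop_complex T).
    (\<forall>t\<in>F0. x t = y t) \<longrightarrow> (x \<in> U0 \<longleftrightarrow> y \<in> U0)"
    using Q_semialgebraic_finite_dependence[OF U0(3)] by (elim exE conjE)
  have "\<forall>i. \<exists>F. i < N \<longrightarrow> finite F \<and> F \<subseteq> T \<and> (\<forall>x\<in>U1. \<forall>y\<in>U1. (\<forall>t\<in>F. x t = y t) \<longrightarrow>
    (\<forall>s::real\<in>{0..1}. cline T x (\<lambda>t. y t - x t) (of_real s) \<in> U1) \<longrightarrow> a i x = a i y)"
    using U1(3) unfolding dep_def by simp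
  from choice[OF this] obtain F where F: "\<And>i. i < N \<Longrightarrow> finite (F i) \<and> F i \<subseteq> T \<and>
    (\<forall>x\<in>U1. \<forall>y\<in>U1. (\<forall>t\<in>F i. x t = y t) \<longrightarrow>
    (\<forall>s::real\<in>{0..1}. cline T x (\<lambda>t. y t - x t) (of_real s) \<in> U1) \<longrightarrow> a i x = a i y)" by auto
  define G where "G = F0 \<union> (\<Union>i<N. F i)"
  have G: "finite G" using F0(1) F by (auto simp: G_def)
  have GT: "G \<subseteq> T" unfolding G_def using F0(2) F by (intro Un_least UN_least) auto
  have U0t: "U0 \<subseteq> topspace (powertop_complex T)" using U0(1) by (rule openin_subset)
  have cyl: "y \<in> U0 \<and> monic_poly N a x = monic_poly N a y"
    if x: "x \<in> U0" and y: "y \<in> topspace (powertop_complex T)" and eq: "\<forall>t\<in>G. x t = y t" for x y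
  proof -
    have inU0: "z \<in> U0" if "z \<in> topspace (powertop_complex T)" "\<forall>t\<in>G. x t = z t" for z
      using F0(3)[rule_format, of x z] that x U0t by (auto simp: G_def)
    have yU0: "y \<in> U0" using inU0[OF y eq] .
    \<comment> \<open>Moving only coordinates outside \<open>G\<close> does not leave
      \<open>U0\<close>; this supplies the segments required in \<open>dep\<close>.\<close>
    have seg: "cline T x (\<lambda>t. y t - x t) s \<in> U0" for s
      by (rule inU0) (use eq GT in \<open>auto simp: cline_def\<close>)
    have "a i x = a i y" if i: "i < N" for i
    proof -
      have "\<forall>t\<in>F i. x t = y t" using eq i by (auto simp: G_def)
      then show ?thesis using F[OF i] x yU0 seg U0(6) by (meson subsetD)
    qed
    then show ?thesis using yU0 by (simp add: monic_poly_def)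
  qed
  have sub: "U0 \<subseteq> U" using U0(6) U1(2) by blast
  have cf: "power_holomorphic_on (\<lambda>x. poly.coeff (monic_poly N a x) i) T U0" for i
    using a nash_on_subset[OF _ sub]
    by (cases "i = N"; cases "i < N")
      (auto simp: coeff_monic_poly nash_on_def power_holomorphic_on_const)
  have "\<exists>f. continuous_map (subtopology (powertop_complex T) U0) euclidean f \<and>
      (\<forall>x\<in>U0. poly (monic_poly N a x) (f x) = 0)"
  proof (rule separable_root_continuous[OF U0(1,2) G GT cyl])
    show "continuous_map (subtopology (powertop_complex T) U0) euclidean (\<lambda>x. poly.coeff (monic_poly N a x) i)" for i
      using cf[of i] by (simp add: power_holomorphic_on_iff)
  qed (use N sep sub in \<open>auto simp: coeff_monic_poly\<close>)
  then obtain f where f: "continuous_map (subtopology (powertop_complex T) U0) euclidean f"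
    "\<And>x. x \<in> U0 \<Longrightarrow> poly (monic_poly N a x) (f x) = 0" by blast
  have "power_holomorphic_on f T U0"
  proof (rule separable_root_power_holomorphic[OF U0(1) _ cf f(1,2)])
    show "Polynomial.degree (monic_poly N a x) \<le> N" for x by simp
  qed (use sep sub in auto)
  moreover have "Q_algebraic_fun T U0 f"
  proof (rule Q_algebraic_fun_root[OF N])
    show "Q_algebraic_fun T U0 (\<lambda>x. - a k x)" if "k < N" for k
      using nash_on_uminus[OF nash_on_subset[OF a[OF that] sub]] by (simp add: nash_on_def)
    show "f x ^ N = (\<Sum>k<N. - a k x * f x ^ k)" if "x \<in> U0" for x
      using f(2)[OF that] by (simp add: poly_monic_poly sum_negf eq_neg_iff_add_eq_0)
  qed
  ultimately have "nash_on T U0 f" by (simp add: nash_on_def)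
  then have "nash_on T V f" using U0(5) by (rule nash_on_subset)
  moreover have "V \<subseteq> U" using U0(5) sub by (rule order_trans)
  moreover have "poly (monic_poly N a x) (f x) = 0" if "x \<in> V" for x
    using f(2) U0(5) that by auto
  ultimately show ?thesis
    using U0(4) by (intro bexI[of _ V] conjI exI[of _ f] ballI)
qed

text \<open>The induction hypothesis is used twice: for the normalized derivative, to find a first
  root \<open>f\<close>, and for the quotient by \<open>X - f\<close>, to split the rest.\<close>

lemma nash_splitting:
  assumes "U \<in> \<Omega>" "\<And>i. i < n \<Longrightarrow> nash_on T U (a i)"
  shows "\<exists>V\<in>\<Omega>. V \<subseteq> U \<and> (\<exists>r. (\<forall>i<n. nash_on T V (r i)) \<and>
    (\<forall>x\<in>V. monic_poly n a x = (\<Prod>i<n. [:- r i x, 1:])))"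
  using assms
proof (induct n arbitrary: U a)
  case 0
  then show ?case by (intro bexI[of _ U]) (auto simp: monic_poly_def)
next
  case (Suc n)
  define N where "N = Suc n"
  have N0: "of_nat N \<noteq> (0::complex)" unfolding N_def by (simp only: of_nat_eq_0_iff nat.distinct not_False_eq_True)
  define p where "p = monic_poly N a"
  have aN: "nash_on T U (a i)" if "i < N" for i using Suc.prems(2) that by (simp add: N_def)
  \<comment> \<open>The lower coefficients of the derivative divided by \<open>N\<close>, which is
    monic of degree \<open>n\<close>.\<close>
  define b where "b i x = of_nat (Suc i) * inverse (of_nat N) * a (Suc i) x" for i x
  have "nash_on T U (b i)" if "i < n" for i
    unfolding b_def using that filter_topspace[OF Suc.prems(1)]
    by (intro nash_on_mult nash_on_inverse nash_on_of_nat aN) (auto simp: N_def simp del: of_nat_Suc)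
  then have "\<exists>V\<in>\<Omega>. V \<subseteq> U \<and> (\<exists>r. (\<forall>i<n. nash_on T V (r i)) \<and>
      (\<forall>x\<in>V. monic_poly n b x = (\<Prod>i<n. [:- r i x, 1:])))"
    by (rule Suc.hyps[OF Suc.prems(1)])
  then
  obtain U1 r where U1': "U1 \<in> \<Omega>" "U1 \<subseteq> U" "\<forall>i<n. nash_on T U1 (r i)"
    "\<forall>x\<in>U1. monic_poly n b x = (\<Prod>i<n. [:- r i x, 1:])"
    by (elim bexE exE conjE)
  note U1 = U1'(1,2) U1'(3,4)[rule_format]
  have pder: "pderiv (p x) = Polynomial.smult (of_nat N) (monic_poly n b x)" for x
  proof (rule poly_eqI)
    fix k
    consider "k < n" | "k = n" | "n < k" by linarith
    then show "poly.coeff (pderiv (p x)) k = poly.coeff (Polynomial.smult (of_nat N) (monic_poly n b x)) k"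
    proof cases
      case 1
      show ?thesis
      proof -
        have "poly.coeff (pderiv (p x)) k = of_nat (Suc k) * a (Suc k) x"
          using 1 by (simp add: coeff_pderiv p_def coeff_monic_poly N_def del: of_nat_Suc)
        also have "\<dots> = of_nat N * b k x"
          using N0 by (simp add: b_def del: of_nat_Suc)
        finally show ?thesis using 1 by (simp add: coeff_monic_poly)
      qed
    next
      case 2
      then show ?thesis by (simp add: coeff_pderiv p_def coeff_monic_poly N_def)
    next
      case 3
      then show ?thesis by (simp add: coeff_pderiv p_def coeff_monic_poly N_def)
    qed
  qed
  \<comment> \<open>Each root of the derivative is, after shrinking, a root of \<open>p\<close>
    everywhere or nowhere.\<close>
  define Q where "Q i V \<longleftrightarrow> (\<forall>x\<in>V. poly (p x) (r i x) = 0) \<or> (\<forall>x\<in>V. poly (p x) (r i x) \<noteq> 0)" for i V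
  have "\<exists>V\<in>\<Omega>. V \<subseteq> U1 \<and> (\<forall>i\<in>{..<n}. Q i V)"
  proof (rule shrink_finite[OF _ U1(1)])
    show "\<exists>W\<in>\<Omega>. W \<subseteq> V \<and> Q i W" if "i \<in> {..<n}" "V \<in> \<Omega>" "V \<subseteq> U1" for i V
    proof -
      have rV: "nash_on T V (r i)" using nash_on_subset[OF U1(3) that(3)] that(1) by simp
      have aV: "nash_on T V (a j)" if "j < N" for j
        by (rule nash_on_subset[OF aN[OF that] order_trans[OF \<open>V \<subseteq> U1\<close> U1(2)]])
      have "nash_on T V (\<lambda>x. r i x ^ N + (\<Sum>j<N. a j x * r i x ^ j))"
        by (intro nash_on_add nash_on_sum nash_on_mult nash_on_power rV aV) auto
      then have "nash_on T V (\<lambda>x. poly (p x) (r i x))" by (simp add: p_def poly_monic_poly)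
      then show ?thesis unfolding Q_def by (rule nash_zero_or_nonvanishing[OF that(2)])
    qed
    show "Q i W" if "Q i V" "W \<subseteq> V" for i V W using that unfolding Q_def by blast
  qed simp
  then obtain U2 where U2: "U2 \<in> \<Omega>" "U2 \<subseteq> U1" "\<And>i. i < n \<Longrightarrow> Q i U2" by auto
  have "\<exists>V\<in>\<Omega>. V \<subseteq> U2 \<and> (\<exists>f. nash_on T V f \<and> (\<forall>x\<in>V. poly (p x) (f x) = 0))"
  proof (cases "\<exists>i<n. \<forall>x\<in>U2. poly (p x) (r i x) = 0")
    case True
    then obtain i where i: "i < n" "\<forall>x\<in>U2. poly (p x) (r i x) = 0" by blast
    have "nash_on T U2 (r i)" using nash_on_subset[OF U1(3)[OF i(1)] U2(2)] .
    then show ?thesis using U2(1) i(2) by blast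
  next
    case False
    have nz: "poly (p x) (r i x) \<noteq> 0" if "i < n" "x \<in> U2" for i x
      using False U2(3)[OF that(1)] that unfolding Q_def by blast
    \<comment> \<open>A multiple root of \<open>p\<close> at a point would be the value there of
      some \<open>r i\<close>, which is excluded in this case.\<close>
    have "poly (pderiv (monic_poly N a x)) z \<noteq> 0" if x: "x \<in> U2" and z: "poly (monic_poly N a x) z = 0" for x z
    proof
      assume "poly (pderiv (monic_poly N a x)) z = 0"
      then have "poly (monic_poly n b x) z = 0" using pder[of x] N0 by (simp add: p_def)
      then have "poly (\<Prod>i<n. [:- r i x, 1:]) z = 0" using U1(4)[of x] U2(2) x by auto
      then obtain i where "i < n" "z = r i x" by (auto simp: poly_prod)
      then show False using nz[of i x] x z by (simp add: p_def)
    qed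
    moreover have "nash_on T U2 (a i)" if "i < N" for i
      by (rule nash_on_subset[OF aN[OF that] order_trans[OF U2(2) U1(2)]])
    ultimately show ?thesis unfolding p_def
      by (intro nash_separable_root[OF U2(1)]) (simp_all add: N_def)
  qed
  then obtain U3 f where U3': "U3 \<in> \<Omega>" "U3 \<subseteq> U2" "nash_on T U3 f" "\<forall>x\<in>U3. poly (p x) (f x) = 0"
    by (elim bexE exE conjE)
  note U3 = U3'(1-3) U3'(4)[rule_format]
  have sub: "U3 \<subseteq> U" using U3(2) U2(2) U1(2) by blast
  define q where "q x = synthetic_div (p x) (f x)" for x
  have pq: "p x = [:- f x, 1:] * q x" if "x \<in> U3" for x
    using synthetic_div_correct'[of "f x" "p x"] U3(4)[OF that] by (simp add: q_def)
  have degq: "Polynomial.degree (q x) = n" for x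
    by (simp add: q_def degree_synthetic_div p_def N_def)
  have coeff_rec: "poly.coeff (q x) i = poly.coeff (p x) (Suc i) + f x * poly.coeff (q x) (Suc i)" if "x \<in> U3" for x i
    by (subst pq[OF that]) simp
  have leadq: "poly.coeff (q x) n = 1" if "x \<in> U3" for x
    using coeff_rec[OF that, of n] degq[of x] by (simp add: p_def coeff_monic_poly N_def coeff_eq_0)
  \<comment> \<open>Horner's rule, from the leading coefficient downwards, shows that synthetic
    division by a Nash root keeps the coefficients Nash.\<close>
  have nq: "nash_on T U3 (\<lambda>x. poly.coeff (q x) i)" if "i \<le> n" for i
    using that
  proof (induct rule: inc_induct)
    case base
    show ?case by (rule nash_on_cong[OF filter_open[OF U3(1)] nash_on_1]) (simp add: leadq)
  next
    case (step i)
    have i: "Suc i < N" using step(2) by (simp add: N_def)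
    have "nash_on T U3 (\<lambda>x. a (Suc i) x + f x * poly.coeff (q x) (Suc i))"
      by (intro nash_on_add nash_on_mult U3(3) step(3) nash_on_subset[OF aN[OF i] sub])
    then show ?case
    proof (rule nash_on_cong[OF filter_open[OF U3(1)]])
      fix x assume "x \<in> U3"
      from coeff_rec[OF this, of i] i
      show "a (Suc i) x + f x * poly.coeff (q x) (Suc i) = poly.coeff (q x) i"
        by (simp add: p_def coeff_monic_poly)
    qed
  qed
  have "\<exists>V\<in>\<Omega>. V \<subseteq> U3 \<and> (\<exists>r. (\<forall>i<n. nash_on T V (r i)) \<and>
      (\<forall>x\<in>V. monic_poly n (\<lambda>i x. poly.coeff (q x) i) x = (\<Prod>i<n. [:- r i x, 1:])))"
    by (rule Suc.hyps[OF U3(1)]) (simp add: nq)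
  then obtain V r' where V': "V \<in> \<Omega>" "V \<subseteq> U3" "\<forall>i<n. nash_on T V (r' i)"
    "\<forall>x\<in>V. monic_poly n (\<lambda>i x. poly.coeff (q x) i) x = (\<Prod>i<n. [:- r' i x, 1:])"
    by (elim bexE exE conjE)
  note V = V'(1,2) V'(3,4)[rule_format]
  define r'' where "r'' i = (if i < n then r' i else f)" for i
  have "nash_on T V (r'' i)" for i using V(3) nash_on_subset[OF U3(3) V(2)] by (simp add: r''_def)
  moreover have "p x = (\<Prod>i<N. [:- r'' i x, 1:])" if x: "x \<in> V" for x
  proof -
    have x3: "x \<in> U3" using V(2) x by blast
    have "q x = (\<Prod>i<n. [:- r' i x, 1:])"
      using V(4)[OF x] monic_poly_eqI[of q x n] degq[of x] leadq[OF x3] by simp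
    then show ?thesis using pq[OF x3] by (simp add: N_def r''_def mult.commute)
  qed
  moreover have "V \<subseteq> U" using V(2) sub by (rule order_trans)
  ultimately show ?case
    using V(1) unfolding p_def N_def by (intro bexI[of _ V] conjI exI[of _ r''] allI impI ballI)
qed

end

section \<open>The field of Nash functions\<close>

context nash_filter
begin

abbreviation germ :: "('t \<Rightarrow> complex) set \<Rightarrow> (('t \<Rightarrow> complex) \<Rightarrow> complex) \<Rightarrow> 't local_fun set"
  where "germ \<equiv> nash_germ T \<Omega>"

abbreviation NF :: "'t local_fun set ring"
  where "NF \<equiv> nash_field T \<Omega>"

lemma nash_rel_iff:
  "((U, f), (V, g)) \<in> nash_rel T \<Omega> \<longleftrightarrow> U \<in> \<Omega> \<and> f \<in> nash_functions T U \<and> V \<in> \<Omega> \<and>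
    g \<in> nash_functions T V \<and> (\<exists>W\<in>\<Omega>. W \<subseteq> U \<inter> V \<and> (\<forall>x\<in>W. f x = g x))"
  by (simp add: nash_rel_def)

lemma restrict_nash_functions: "U \<in> \<Omega> \<Longrightarrow> restrict f U \<in> nash_functions T U \<longleftrightarrow> nash_on T U f"
  using nash_on_cong[OF filter_open, of U "restrict f U" f] nash_on_cong[OF filter_open, of U f "restrict f U"]
  by (auto simp: nash_functions_iff)

lemma nash_rel_equiv: "equiv (SIGMA U:\<Omega>. nash_functions T U) (nash_rel T \<Omega>)"
proof (rule equivI)
  show "nash_rel T \<Omega> \<subseteq> (SIGMA U:\<Omega>. nash_functions T U) \<times> (SIGMA U:\<Omega>. nash_functions T U)"
    by (auto simp: nash_rel_def)
  show "refl_on (SIGMA U:\<Omega>. nash_functions T U) (nash_rel T \<Omega>)"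
    by (auto simp: refl_on_def nash_rel_iff)
  show "sym (nash_rel T \<Omega>)"
  proof (rule symI)
    fix a b assume ab: "(a, b) \<in> nash_rel T \<Omega>"
    obtain U f V g where "a = (U, f)" "b = (V, g)" by (cases a; cases b)
    then show "(b, a) \<in> nash_rel T \<Omega>" using ab by (simp add: nash_rel_iff Int_commute eq_commute)
  qed
  show "trans (nash_rel T \<Omega>)"
  proof (rule transI)
    fix a b c assume ab: "(a, b) \<in> nash_rel T \<Omega>" and bc: "(b, c) \<in> nash_rel T \<Omega>"
    obtain U f V g W h where abc: "a = (U, f)" "b = (V, g)" "c = (W, h)" by (cases a; cases b; cases c)
    obtain V1 where V1: "V1 \<in> \<Omega>" "V1 \<subseteq> U \<inter> V" "\<forall>x\<in>V1. f x = g x" using ab by (auto simp: abc nash_rel_iff)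
    obtain V2 where V2: "V2 \<in> \<Omega>" "V2 \<subseteq> V \<inter> W" "\<forall>x\<in>V2. g x = h x" using bc by (auto simp: abc nash_rel_iff)
    obtain V3 where V3: "V3 \<in> \<Omega>" "V3 \<subseteq> V1" "V3 \<subseteq> V2" using filter_inter[OF V1(1) V2(1)] by auto
    have "V3 \<subseteq> U \<inter> W" using V1(2) V2(2) V3 by blast
    moreover have "f x = h x" if x: "x \<in> V3" for x
    proof -
      have "x \<in> V1" "x \<in> V2" using V3 x by auto
      then show ?thesis using V1(3) V2(3) by simp
    qed
    ultimately have "V3 \<subseteq> U \<inter> W" "\<forall>x\<in>V3. f x = h x" by auto
    then show "(a, c) \<in> nash_rel T \<Omega>" using ab bc V3(1) unfolding abc nash_rel_iff by auto
  qed
qed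

lemma germ_eq_iff:
  assumes "U \<in> \<Omega>" "nash_on T U f" "V \<in> \<Omega>" "nash_on T V g"
  shows "germ U f = germ V g \<longleftrightarrow> (\<exists>W\<in>\<Omega>. W \<subseteq> U \<and> W \<subseteq> V \<and> (\<forall>x\<in>W. f x = g x))"
proof -
  have "(U, restrict f U) \<in> (SIGMA U:\<Omega>. nash_functions T U)" "(V, restrict g V) \<in> (SIGMA U:\<Omega>. nash_functions T U)"
    using assms restrict_nash_functions by auto
  then have "germ U f = germ V g \<longleftrightarrow> ((U, restrict f U), (V, restrict g V)) \<in> nash_rel T \<Omega>"
    unfolding nash_germ_def by (rule eq_equiv_class_iff[OF nash_rel_equiv])
  also have "\<dots> \<longleftrightarrow> (\<exists>W\<in>\<Omega>. W \<subseteq> U \<inter> V \<and> (\<forall>x\<in>W. restrict f U x = restrict g V x))"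
    using assms restrict_nash_functions by (simp add: nash_rel_iff)
  also have "\<dots> \<longleftrightarrow> (\<exists>W\<in>\<Omega>. W \<subseteq> U \<and> W \<subseteq> V \<and> (\<forall>x\<in>W. f x = g x))"
    by (intro bex_cong refl) (auto simp: subset_iff)
  finally show ?thesis .
qed

lemma germ_eqI:
  assumes "U \<in> \<Omega>" "nash_on T U f" "V \<in> \<Omega>" "nash_on T V g"
    and "W \<in> \<Omega>" "W \<subseteq> U" "W \<subseteq> V" "\<And>x. x \<in> W \<Longrightarrow> f x = g x"
  shows "germ U f = germ V g"
  using assms by (subst germ_eq_iff) auto

lemma germ_restrict: "U \<in> \<Omega> \<Longrightarrow> nash_on T U f \<Longrightarrow> V \<in> \<Omega> \<Longrightarrow> V \<subseteq> U \<Longrightarrow> germ U f = germ V f"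
  using nash_on_subset by (intro germ_eqI[of U f V f V]) auto

lemma germ_cong: "(\<And>x. x \<in> U \<Longrightarrow> f x = g x) \<Longrightarrow> germ U f = germ U g"
  unfolding nash_germ_def by (metis restrict_ext)

text \<open>The default value of a class: a function that is not Nash contributes nothing to the
  unions that define operations on germs.\<close>

lemma germ_not_nash: "\<not> nash_on T U f \<Longrightarrow> germ U f = {}"
  using restrict_nash_functions[of U f] by (auto simp: nash_germ_def nash_rel_iff)

lemma germ_carrier [simp]: "U \<in> \<Omega> \<Longrightarrow> nash_on T U f \<Longrightarrow> germ U f \<in> carrier NF"
  using restrict_nash_functions by (auto simp: nash_field_def nash_germ_def intro!: quotientI)

lemma germ_cases:
  assumes "\<xi> \<in> carrier NF"
  obtains U f where "U \<in> \<Omega>" "nash_on T U f" "\<xi> = germ U f"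
proof -
  obtain a where a: "a \<in> (SIGMA U:\<Omega>. nash_functions T U)" "\<xi> = nash_rel T \<Omega> `` {a}"
    using assms by (auto simp: nash_field_def elim!: quotientE)
  obtain U f where Uf: "a = (U, f)" by (cases a)
  then have f: "U \<in> \<Omega>" "f \<in> extensional U" "nash_on T U f" using a by (auto simp: nash_functions_iff)
  then have "\<xi> = germ U f" using a Uf by (simp add: nash_germ_def extensional_restrict)
  then show thesis using that f by blast
qed

lemma germ_member:
  assumes "U \<in> \<Omega>" "nash_on T U f" "(V, g) \<in> germ U f"
  shows "V \<in> \<Omega>" "nash_on T V g" "germ V g = germ U f"
proof -
  have *: "((U, restrict f U), (V, g)) \<in> nash_rel T \<Omega>" using assms(3) by (simp add: nash_germ_def)
  then show 1: "V \<in> \<Omega>" "nash_on T V g" by (auto simp: nash_rel_iff nash_functions_iff)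
  obtain W where W: "W \<in> \<Omega>" "W \<subseteq> U \<inter> V" "\<forall>x\<in>W. restrict f U x = g x" using * by (auto simp: nash_rel_iff)
  have "g x = f x" if x: "x \<in> W" for x
  proof -
    have "x \<in> U" using W(2) x by blast
    then show ?thesis using bspec[OF W(3) x] by simp
  qed
  then show "germ V g = germ U f"
    using W(2) by (intro germ_eqI[OF 1 assms(1,2) W(1)]) auto
qed

lemma germ_self: "U \<in> \<Omega> \<Longrightarrow> nash_on T U f \<Longrightarrow> (U, restrict f U) \<in> germ U f"
  using restrict_nash_functions filter_nonempty by (auto simp: nash_germ_def nash_rel_iff)

text \<open>Two choices of representatives agree with \<open>f\<close> and \<open>g\<close> on a
  common smaller member, so every piece of the union is the same class. From here on germs are
  computed with representatives on one domain.\<close>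

lemma nash_lift2_germ:
  assumes op: "\<And>U f g. nash_on T U f \<Longrightarrow> nash_on T U g \<Longrightarrow> nash_on T U (\<lambda>x. op (f x) (g x))"
    and U: "U \<in> \<Omega>" and f: "nash_on T U f" and g: "nash_on T U g"
  shows "nash_lift2 op T \<Omega> (germ U f) (germ U g) = germ U (\<lambda>x. op (f x) (g x))"
proof -
  have piece: "germ W (\<lambda>x. op (f1 x) (g1 x)) = germ U (\<lambda>x. op (f x) (g x))"
    if m: "(U1, f1) \<in> germ U f" "(U2, g1) \<in> germ U g" and W: "W \<in> \<Omega>" "W \<subseteq> U1 \<inter> U2" for U1 f1 U2 g1 W
  proof -
    note m1 = germ_member[OF U f m(1)] and m2 = germ_member[OF U g m(2)]
    obtain V1 where V1: "V1 \<in> \<Omega>" "V1 \<subseteq> U" "\<forall>x\<in>V1. f1 x = f x"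
      using m1(3) germ_eq_iff[OF m1(1,2) U f] by auto
    obtain V2 where V2: "V2 \<in> \<Omega>" "V2 \<subseteq> U" "\<forall>x\<in>V2. g1 x = g x"
      using m2(3) germ_eq_iff[OF m2(1,2) U g] by auto
    obtain V3 where V3: "V3 \<in> \<Omega>" "V3 \<subseteq> V1" "V3 \<subseteq> V2" using filter_inter[OF V1(1) V2(1)] by auto
    obtain V4 where V4: "V4 \<in> \<Omega>" "V4 \<subseteq> V3" "V4 \<subseteq> W" using filter_inter[OF V3(1) W(1)] by auto
    have "nash_on T W f1" "nash_on T W g1" using m1(2) m2(2) W(2) nash_on_subset by auto
    moreover have "op (f1 x) (g1 x) = op (f x) (g x)" if x: "x \<in> V4" for x
    proof -
      have "x \<in> V1" "x \<in> V2" using V3 V4 x by auto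
      then show ?thesis using V1(3) V2(3) by simp
    qed
    moreover have "V4 \<subseteq> U" using V4(2) V3(2) V1(2) by blast
    ultimately show ?thesis
      using V4(3) by (intro germ_eqI[OF W(1) op U op[OF f g] V4(1)])
  qed
  show ?thesis
  proof
    show "nash_lift2 op T \<Omega> (germ U f) (germ U g) \<subseteq> germ U (\<lambda>x. op (f x) (g x))"
    proof
      fix a assume "a \<in> nash_lift2 op T \<Omega> (germ U f) (germ U g)"
      then obtain U1 f1 U2 g1 W where "(U1, f1) \<in> germ U f" "(U2, g1) \<in> germ U g" "W \<in> \<Omega>" "W \<subseteq> U1 \<inter> U2"
        "a \<in> germ W (\<lambda>x. op (f1 x) (g1 x))"
        unfolding nash_lift2_def by (elim UN_E) (auto split: prod.splits)
      then show "a \<in> germ U (\<lambda>x. op (f x) (g x))" using piece by simp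
    qed
    have "germ U (\<lambda>x. op (restrict f U x) (restrict g U x)) \<subseteq> nash_lift2 op T \<Omega> (germ U f) (germ U g)"
    proof
      fix a assume a: "a \<in> germ U (\<lambda>x. op (restrict f U x) (restrict g U x))"
      show "a \<in> nash_lift2 op T \<Omega> (germ U f) (germ U g)"
        unfolding nash_lift2_def
        by (rule UN_I[OF germ_self[OF U f]], simp only: prod.case,
          rule UN_I[OF germ_self[OF U g]], simp only: prod.case, rule UN_I[of U]) (use U a in auto)
    qed
    moreover have "germ U (\<lambda>x. op (restrict f U x) (restrict g U x)) = germ U (\<lambda>x. op (f x) (g x))"
      by (rule germ_cong) simp
    ultimately show "germ U (\<lambda>x. op (f x) (g x)) \<subseteq> nash_lift2 op T \<Omega> (germ U f) (germ U g)" by simp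
  qed
qed

lemma NF_sel:
  "monoid.mult NF = nash_lift2 (*) T \<Omega>" "ring.add NF = nash_lift2 (+) T \<Omega>"
  "monoid.one NF = (\<Union>U\<in>\<Omega>. germ U (\<lambda>_. 1))" "ring.zero NF = (\<Union>U\<in>\<Omega>. germ U (\<lambda>_. 0))"
  by (simp_all add: nash_field_def)

lemma germ_mult [simp]:
  "U \<in> \<Omega> \<Longrightarrow> nash_on T U f \<Longrightarrow> nash_on T U g \<Longrightarrow> germ U f \<otimes>\<^bsub>NF\<^esub> germ U g = germ U (\<lambda>x. f x * g x)"
  unfolding NF_sel by (rule nash_lift2_germ[of "(*)", OF nash_on_mult])

lemma germ_add [simp]:
  "U \<in> \<Omega> \<Longrightarrow> nash_on T U f \<Longrightarrow> nash_on T U g \<Longrightarrow> germ U f \<oplus>\<^bsub>NF\<^esub> germ U g = germ U (\<lambda>x. f x + g x)"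
  unfolding NF_sel by (rule nash_lift2_germ[of "(+)", OF nash_on_add])

lemma germ_const_union:
  assumes U: "U \<in> \<Omega>" and c: "\<And>V. nash_on T V (\<lambda>_. c)"
  shows "(\<Union>V\<in>\<Omega>. germ V (\<lambda>_. c)) = germ U (\<lambda>_. c)"
proof -
  have e: "germ V (\<lambda>_. c) = germ U (\<lambda>_. c)" if V: "V \<in> \<Omega>" for V
  proof -
    obtain W where W: "W \<in> \<Omega>" "W \<subseteq> U" "W \<subseteq> V" using filter_inter[OF U V] by (elim bexE conjE)
    show ?thesis by (rule germ_eqI[OF V c U c W(1,3,2)]) (rule refl)
  qed
  show ?thesis
  proof (rule antisym)
    show "(\<Union>V\<in>\<Omega>. germ V (\<lambda>_. c)) \<subseteq> germ U (\<lambda>_. c)"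
      by (rule UN_least) (rule eq_refl[OF e])
    show "germ U (\<lambda>_. c) \<subseteq> (\<Union>V\<in>\<Omega>. germ V (\<lambda>_. c))"
      by (rule UN_upper[OF U])
  qed
qed

lemma germ_one: "U \<in> \<Omega> \<Longrightarrow> \<one>\<^bsub>NF\<^esub> = germ U (\<lambda>_. 1)"
  using germ_const_union[OF _ nash_on_1] by (simp only: NF_sel)

lemma germ_zero: "U \<in> \<Omega> \<Longrightarrow> \<zero>\<^bsub>NF\<^esub> = germ U (\<lambda>_. 0)"
  using germ_const_union[OF _ nash_on_0] by (simp only: NF_sel)

text \<open>A common domain for finitely many germs, on which ring laws and polynomial relations
  become pointwise.\<close>

lemma germ_family:
  assumes "finite A" "\<And>i. i \<in> A \<Longrightarrow> \<xi> i \<in> carrier NF"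
  shows "\<exists>U f. U \<in> \<Omega> \<and> (\<forall>i\<in>A. nash_on T U (f i) \<and> \<xi> i = germ U (f i))"
  using assms
proof (induct A rule: finite_induct)
  case empty
  then show ?case using filter_exists by auto
next
  case (insert i A)
  then obtain U f where U: "U \<in> \<Omega>" "\<forall>i\<in>A. nash_on T U (f i) \<and> \<xi> i = germ U (f i)" by auto
  have "\<xi> i \<in> carrier NF" using insert.prems by simp
  then obtain V g where V: "V \<in> \<Omega>" "nash_on T V g" "\<xi> i = germ V g" by (rule germ_cases)
  obtain W where W: "W \<in> \<Omega>" "W \<subseteq> U" "W \<subseteq> V" using filter_inter[OF U(1) V(1)] by auto
  have "nash_on T W (if j = i then g else f j) \<and> \<xi> j = germ W (if j = i then g else f j)" if "j \<in> insert i A" for j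
    using that U V W germ_restrict[of U "f j" W] germ_restrict[of V g W] nash_on_subset[of T U "f j" W] nash_on_subset[of T V g W]
    by auto
  then show ?case using W(1) by (intro exI[of _ W] exI[of _ "\<lambda>j. if j = i then g else f j"]) auto
qed

lemma germ_cases2:
  assumes "\<xi> \<in> carrier NF" "\<eta> \<in> carrier NF"
  obtains U f g where "U \<in> \<Omega>" "nash_on T U f" "nash_on T U g" "\<xi> = germ U f" "\<eta> = germ U g"
proof -
  have "\<exists>U f. U \<in> \<Omega> \<and> (\<forall>i\<in>{0,1::nat}. nash_on T U (f i) \<and> (if i = 0 then \<xi> else \<eta>) = germ U (f i))"
    by (rule germ_family) (simp_all add: assms)
  then obtain U f where "U \<in> \<Omega>" "\<forall>i\<in>{0,1::nat}. nash_on T U (f i) \<and> (if i = 0 then \<xi> else \<eta>) = germ U (f i)"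
    by (elim exE conjE)
  then show thesis using that[of U "f 0" "f 1"] by simp
qed

lemma germ_cases3:
  assumes "\<xi> \<in> carrier NF" "\<eta> \<in> carrier NF" "\<zeta> \<in> carrier NF"
  obtains U f g h where "U \<in> \<Omega>" "nash_on T U f" "nash_on T U g" "nash_on T U h"
    "\<xi> = germ U f" "\<eta> = germ U g" "\<zeta> = germ U h"
proof -
  have "\<exists>U f. U \<in> \<Omega> \<and> (\<forall>i\<in>{0,1,2::nat}. nash_on T U (f i) \<and>
      (if i = 0 then \<xi> else if i = 1 then \<eta> else \<zeta>) = germ U (f i))"
    by (rule germ_family) (simp_all add: assms)
  then obtain U f where "U \<in> \<Omega>"
    "\<forall>i\<in>{0,1,2::nat}. nash_on T U (f i) \<and> (if i = 0 then \<xi> else if i = 1 then \<eta> else \<zeta>) = germ U (f i)"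
    by (elim exE conjE)
  then show thesis using that[of U "f 0" "f 1" "f 2"] by simp
qed

lemma germ_eq_zero_iff:
  assumes "U \<in> \<Omega>" "nash_on T U f"
  shows "germ U f = \<zero>\<^bsub>NF\<^esub> \<longleftrightarrow> (\<exists>V\<in>\<Omega>. V \<subseteq> U \<and> (\<forall>x\<in>V. f x = 0))"
  using assms by (simp add: germ_zero[OF assms(1)] germ_eq_iff)

text \<open>The dichotomy between vanishing identically and vanishing nowhere is what makes nonzero
  germs invertible.\<close>

lemma germ_nonzeroD:
  assumes "U \<in> \<Omega>" "nash_on T U f" "germ U f \<noteq> \<zero>\<^bsub>NF\<^esub>"
  shows "\<exists>V\<in>\<Omega>. V \<subseteq> U \<and> (\<forall>x\<in>V. f x \<noteq> 0)"
  using nash_zero_or_nonvanishing[OF assms(1,2)] assms(3) germ_eq_zero_iff[OF assms(1,2)] by blast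

lemma cring_NF: "cring NF"
proof (rule cringI)
  show "abelian_group NF"
  proof (rule abelian_groupI)
    fix \<xi> \<eta> \<zeta> assume "\<xi> \<in> carrier NF" "\<eta> \<in> carrier NF" "\<zeta> \<in> carrier NF"
    then show "\<xi> \<oplus>\<^bsub>NF\<^esub> \<eta> \<oplus>\<^bsub>NF\<^esub> \<zeta> = \<xi> \<oplus>\<^bsub>NF\<^esub> (\<eta> \<oplus>\<^bsub>NF\<^esub> \<zeta>)"
      by (rule germ_cases3) (simp add: nash_on_add add.assoc)
  next
    fix \<xi> \<eta> assume "\<xi> \<in> carrier NF" "\<eta> \<in> carrier NF"
    then show "\<xi> \<oplus>\<^bsub>NF\<^esub> \<eta> \<in> carrier NF" by (rule germ_cases2) (simp add: nash_on_add)
  next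
    fix \<xi> \<eta> assume "\<xi> \<in> carrier NF" "\<eta> \<in> carrier NF"
    then show "\<xi> \<oplus>\<^bsub>NF\<^esub> \<eta> = \<eta> \<oplus>\<^bsub>NF\<^esub> \<xi>" by (rule germ_cases2) (simp add: add.commute)
  next
    obtain U where "U \<in> \<Omega>" using filter_exists by auto
    then show "\<zero>\<^bsub>NF\<^esub> \<in> carrier NF" by (simp add: germ_zero)
  next
    fix \<xi> assume "\<xi> \<in> carrier NF"
    then show "\<zero>\<^bsub>NF\<^esub> \<oplus>\<^bsub>NF\<^esub> \<xi> = \<xi>" by (rule germ_cases) (simp add: germ_zero)
  next
    fix \<xi> assume "\<xi> \<in> carrier NF"
    then obtain U f where U: "U \<in> \<Omega>" "nash_on T U f" "\<xi> = germ U f" by (rule germ_cases)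
    then have "germ U (\<lambda>x. - f x) \<oplus>\<^bsub>NF\<^esub> \<xi> = \<zero>\<^bsub>NF\<^esub>" by (simp add: nash_on_uminus germ_zero)
    then show "\<exists>y\<in>carrier NF. y \<oplus>\<^bsub>NF\<^esub> \<xi> = \<zero>\<^bsub>NF\<^esub>" using U
      by (intro bexI[of _ "germ U (\<lambda>x. - f x)"] germ_carrier nash_on_uminus) simp_all
  qed
  show "comm_monoid NF"
  proof (rule comm_monoidI)
    fix \<xi> \<eta> \<zeta> assume "\<xi> \<in> carrier NF" "\<eta> \<in> carrier NF" "\<zeta> \<in> carrier NF"
    then show "\<xi> \<otimes>\<^bsub>NF\<^esub> \<eta> \<otimes>\<^bsub>NF\<^esub> \<zeta> = \<xi> \<otimes>\<^bsub>NF\<^esub> (\<eta> \<otimes>\<^bsub>NF\<^esub> \<zeta>)"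
      by (rule germ_cases3) (simp add: nash_on_mult mult.assoc)
  next
    fix \<xi> \<eta> assume "\<xi> \<in> carrier NF" "\<eta> \<in> carrier NF"
    then show "\<xi> \<otimes>\<^bsub>NF\<^esub> \<eta> \<in> carrier NF" by (rule germ_cases2) (simp add: nash_on_mult)
  next
    fix \<xi> \<eta> assume "\<xi> \<in> carrier NF" "\<eta> \<in> carrier NF"
    then show "\<xi> \<otimes>\<^bsub>NF\<^esub> \<eta> = \<eta> \<otimes>\<^bsub>NF\<^esub> \<xi>" by (rule germ_cases2) (simp add: mult.commute)
  next
    obtain U where "U \<in> \<Omega>" using filter_exists by auto
    then show "\<one>\<^bsub>NF\<^esub> \<in> carrier NF" by (simp add: germ_one)
  next
    fix \<xi> assume "\<xi> \<in> carrier NF"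
    then show "\<one>\<^bsub>NF\<^esub> \<otimes>\<^bsub>NF\<^esub> \<xi> = \<xi>" by (rule germ_cases) (simp add: germ_one)
  qed
  fix \<xi> \<eta> \<zeta> assume "\<xi> \<in> carrier NF" "\<eta> \<in> carrier NF" "\<zeta> \<in> carrier NF"
  then show "(\<xi> \<oplus>\<^bsub>NF\<^esub> \<eta>) \<otimes>\<^bsub>NF\<^esub> \<zeta> = \<xi> \<otimes>\<^bsub>NF\<^esub> \<zeta> \<oplus>\<^bsub>NF\<^esub> \<eta> \<otimes>\<^bsub>NF\<^esub> \<zeta>"
    by (rule germ_cases3) (simp add: nash_on_mult nash_on_add distrib_right)
qed

lemma field_NF: "field NF"
proof (rule cring.cring_fieldI2[OF cring_NF])
  obtain U where U: "U \<in> \<Omega>" using filter_exists by auto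
  show "\<zero>\<^bsub>NF\<^esub> \<noteq> \<one>\<^bsub>NF\<^esub>"
  proof
    assume "\<zero>\<^bsub>NF\<^esub> = \<one>\<^bsub>NF\<^esub>"
    then have "germ U (\<lambda>_. 1) = \<zero>\<^bsub>NF\<^esub>" by (simp only: germ_one[OF U])
    then have "\<exists>V\<in>\<Omega>. V \<subseteq> U \<and> (\<forall>x\<in>V. (1::complex) = 0)"
      by (simp only: germ_eq_zero_iff[OF U nash_on_1])
    then show False using filter_nonempty by fastforce
  qed
  fix \<xi> assume "\<xi> \<in> carrier NF" and nz: "\<xi> \<noteq> \<zero>\<^bsub>NF\<^esub>"
  from this(1) obtain U f where U: "U \<in> \<Omega>" "nash_on T U f" "\<xi> = germ U f" by (rule germ_cases)
  obtain V where V: "V \<in> \<Omega>" "V \<subseteq> U" "\<forall>x\<in>V. f x \<noteq> 0"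
    using germ_nonzeroD[OF U(1,2) nz[unfolded U(3)]] by (elim bexE conjE)
  have fV: "nash_on T V f" by (rule nash_on_subset[OF U(2) V(2)])
  have iV: "nash_on T V (\<lambda>x. inverse (f x))"
    by (rule nash_on_inverse[OF filter_topspace[OF V(1)] fV]) (rule bspec[OF V(3)])
  have "\<xi> = germ V f" unfolding U(3) by (rule germ_restrict[OF U(1,2) V(1,2)])
  then have "\<xi> \<otimes>\<^bsub>NF\<^esub> germ V (\<lambda>x. inverse (f x)) = germ V (\<lambda>x. f x * inverse (f x))"
    by (simp only: germ_mult[OF V(1) fV iV])
  also have "\<dots> = germ V (\<lambda>_. 1)"
    by (rule germ_cong) (rule right_inverse, rule bspec[OF V(3)])
  finally have "\<xi> \<otimes>\<^bsub>NF\<^esub> germ V (\<lambda>x. inverse (f x)) = \<one>\<^bsub>NF\<^esub>" by (simp only: germ_one[OF V(1)])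
  then show "\<exists>b\<in>carrier NF. \<xi> \<otimes>\<^bsub>NF\<^esub> b = \<one>\<^bsub>NF\<^esub>" by (rule bexI[OF _ germ_carrier[OF V(1) iV]])
qed

end

sublocale nash_filter \<subseteq> NF: field "nash_field T \<Omega>"
  by (rule field_NF)

context nash_filter
begin

lemma germ_power: "U \<in> \<Omega> \<Longrightarrow> nash_on T U f \<Longrightarrow> germ U f [^]\<^bsub>NF\<^esub> (n::nat) = germ U (\<lambda>x. f x ^ n)"
  by (induct n) (auto simp: germ_one nash_on_power mult.commute)

lemma germ_finsum:
  assumes U: "U \<in> \<Omega>" and "finite A" "\<And>i. i \<in> A \<Longrightarrow> nash_on T U (f i)"
  shows "(\<Oplus>\<^bsub>NF\<^esub>i\<in>A. germ U (f i)) = germ U (\<lambda>x. \<Sum>i\<in>A. f i x)"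
  using assms(2,3)
  by (induct A rule: finite_induct) (auto simp: germ_zero[OF U] U nash_on_sum Pi_def)

lemma germ_uminus: "U \<in> \<Omega> \<Longrightarrow> nash_on T U f \<Longrightarrow> \<ominus>\<^bsub>NF\<^esub> germ U f = germ U (\<lambda>x. - f x)"
  by (rule NF.minus_equality) (auto simp: nash_on_uminus germ_zero)

lemma germ_int_multiple:
  assumes "U \<in> \<Omega>" "nash_on T U f"
  shows "[(k::int)] \<cdot>\<^bsub>NF\<^esub> germ U f = germ U (\<lambda>x. of_int k * f x)"
proof -
  have nat: "[(n::nat)] \<cdot>\<^bsub>NF\<^esub> germ U f = germ U (\<lambda>x. of_nat n * f x)" for n
    using assms by (induct n) (auto simp: germ_zero nash_on_mult nash_on_of_nat algebra_simps)
  show ?thesis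
  proof (cases "k \<ge> 0")
    case True
    then show ?thesis by (simp add: add_pow_int_ge nat)
  next
    case False
    then show ?thesis
      using assms by (simp add: add_pow_int_lt nat germ_uminus nash_on_mult nash_on_of_int nash_on_uminus)
  qed
qed

lemma char_zero_NF: "0 < (n::nat) \<Longrightarrow> [n] \<cdot>\<^bsub>NF\<^esub> \<one>\<^bsub>NF\<^esub> \<noteq> \<zero>\<^bsub>NF\<^esub>"
proof -
  assume n: "0 < n"
  obtain U where U: "U \<in> \<Omega>" using filter_exists by auto
  have "[(int n)] \<cdot>\<^bsub>NF\<^esub> \<one>\<^bsub>NF\<^esub> = germ U (\<lambda>_. of_nat n)"
    by (simp add: germ_one[OF U] germ_int_multiple[OF U])
  moreover have "germ U (\<lambda>_. of_nat n) \<noteq> \<zero>\<^bsub>NF\<^esub>"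
    using germ_eq_zero_iff[OF U nash_on_of_nat, of n] n filter_nonempty by auto
  ultimately show "[n] \<cdot>\<^bsub>NF\<^esub> \<one>\<^bsub>NF\<^esub> \<noteq> \<zero>\<^bsub>NF\<^esub>" by (simp add: add_pow_int_ge)
qed

text \<open>The leading coefficient has no zeros on a small member, so the polynomial can be made
  monic there and split; any of its factors provides a root.\<close>

lemma has_roots_NF: "has_roots NF"
  unfolding has_roots_def
proof (intro allI impI, elim conjE)
  fix n :: nat and c assume n: "0 < n" and c: "c \<in> {..n} \<rightarrow> carrier NF" and cn: "c n \<noteq> \<zero>\<^bsub>NF\<^esub>"
  obtain U f where U: "U \<in> \<Omega>" and f: "\<forall>i\<in>{..n}. nash_on T U (f i) \<and> c i = germ U (f i)"
    using germ_family[of "{..n}" c] c by auto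
  obtain V where V: "V \<in> \<Omega>" "V \<subseteq> U" "\<forall>x\<in>V. f n x \<noteq> 0"
    using germ_nonzeroD[OF U, of "f n"] f cn by auto
  have fV: "nash_on T V (f i)" if "i \<le> n" for i using f nash_on_subset[OF _ V(2)] that by auto
  define a where "a i x = f i x * inverse (f n x)" for i x
  have "nash_on T V (a i)" if "i < n" for i
    unfolding a_def using fV that V(3)
    by (intro nash_on_mult nash_on_inverse filter_topspace[OF V(1)]) auto
  then have "\<exists>W\<in>\<Omega>. W \<subseteq> V \<and> (\<exists>r. (\<forall>i<n. nash_on T W (r i)) \<and>
      (\<forall>x\<in>W. monic_poly n a x = (\<Prod>i<n. [:- r i x, 1:])))"
    by (rule nash_splitting[OF V(1)])
  then obtain W r where W: "W \<in> \<Omega>" "W \<subseteq> V" "\<forall>i<n. nash_on T W (r i)"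
    "\<forall>x\<in>W. monic_poly n a x = (\<Prod>i<n. [:- r i x, 1:])" by (elim bexE exE conjE)
  have r0: "nash_on T W (r 0)" using W(3) n by simp
  have fW: "nash_on T W (f i)" if "i \<le> n" for i by (rule nash_on_subset[OF fV[OF that] W(2)])
  have cW: "c i = germ W (f i)" if "i \<le> n" for i
    using f that germ_restrict[OF U _ W(1) order_trans[OF W(2) V(2)]] by auto
  have root: "(\<Sum>i\<le>n. f i x * r 0 x ^ i) = 0" if x: "x \<in> W" for x
  proof -
    have fn: "f n x \<noteq> 0" using V(3) W(2) x by auto
    have "poly (monic_poly n a x) (r 0 x) = 0"
      using W(4) x n by (auto simp: poly_prod)
    then have "f n x * (r 0 x ^ n + (\<Sum>i<n. a i x * r 0 x ^ i)) = 0" by (simp add: poly_monic_poly)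
    then have "f n x * r 0 x ^ n + (\<Sum>i<n. f i x * r 0 x ^ i) = 0"
      using fn by (simp add: distrib_left sum_distrib_left a_def field_simps)
    then show ?thesis by (simp add: lessThan_Suc_atMost[symmetric] add.commute)
  qed
  have "(\<Oplus>\<^bsub>NF\<^esub>i\<in>{..n}. c i \<otimes>\<^bsub>NF\<^esub> germ W (r 0) [^]\<^bsub>NF\<^esub> i) = (\<Oplus>\<^bsub>NF\<^esub>i\<in>{..n}. germ W (\<lambda>x. f i x * r 0 x ^ i))"
    using fW r0 W(1)
    by (intro NF.finsum_cong') (auto simp: cW germ_power nash_on_power nash_on_mult)
  also have "\<dots> = germ W (\<lambda>x. \<Sum>i\<le>n. f i x * r 0 x ^ i)"
    using fW r0 by (intro germ_finsum W(1)) (auto intro: nash_on_mult nash_on_power)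
  also have "\<dots> = \<zero>\<^bsub>NF\<^esub>" unfolding germ_zero[OF W(1)] by (rule germ_cong) (rule root)
  finally show "\<exists>b\<in>carrier NF. (\<Oplus>\<^bsub>NF\<^esub>i\<in>{..n}. c i \<otimes>\<^bsub>NF\<^esub> b [^]\<^bsub>NF\<^esub> i) = \<zero>\<^bsub>NF\<^esub>"
    using W(1) r0 by (intro bexI[of _ "germ W (r 0)"]) auto
qed

section \<open>The coordinate functions as a transcendence basis\<close>

definition Lam :: "'t \<Rightarrow> 't local_fun set"
  where "Lam v = germ (SOME U. U \<in> \<Omega>) (\<lambda>x. if v \<in> T then x v else 0)"

lemma nash_on_coordinate_or_zero: "nash_on T U (\<lambda>x. if v \<in> T then x v else 0)"
  by (cases "v \<in> T") (simp_all add: nash_on_coordinate)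

text \<open>The member chosen in the definition does not matter. Indices outside \<open>T\<close>
  get the value zero, which makes \<open>Lam\<close> a total assignment for evaluation.\<close>

lemma Lam_germ: "U \<in> \<Omega> \<Longrightarrow> Lam v = germ U (\<lambda>x. if v \<in> T then x v else 0)"
proof -
  assume U: "U \<in> \<Omega>"
  then have S: "(SOME U. U \<in> \<Omega>) \<in> \<Omega>" by (rule someI)
  obtain W where W: "W \<in> \<Omega>" "W \<subseteq> (SOME U. U \<in> \<Omega>)" "W \<subseteq> U" using filter_inter[OF S U] by auto
  show ?thesis unfolding Lam_def
    by (rule germ_eqI[OF S nash_on_coordinate_or_zero U nash_on_coordinate_or_zero W]) simp
qed

lemma Lam_closed [simp]: "Lam v \<in> carrier NF"
  using filter_exists Lam_germ nash_on_coordinate_or_zero by auto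

lemma ring_poly_eval_Lam:
  assumes U: "U \<in> \<Omega>" and P: "ipoly_vars P \<subseteq> T"
  shows "ring_poly_eval NF Lam P = germ U (ipoly_eval P)"
proof -
  define e where "e x v = (if v \<in> T then x v else (0::complex))" for x and v :: 't
  have mon: "nash_on T U (\<lambda>x. \<Prod>v\<in>#m. e x v) \<and> ring_monomial NF Lam m = germ U (\<lambda>x. \<Prod>v\<in>#m. e x v)" for m
  proof (induct m)
    case empty
    then show ?case by (simp add: NF.ring_monomial_empty germ_one[OF U])
  next
    case (add v m)
    have "nash_on T U (\<lambda>x. e x v)" unfolding e_def by (rule nash_on_coordinate_or_zero)
    moreover have "Lam v = germ U (\<lambda>x. e x v)" unfolding e_def by (rule Lam_germ[OF U])
    ultimately show ?case using add U by (simp add: NF.ring_monomial_add_mset nash_on_mult)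
  qed
  have "nash_on T U (\<lambda>x. ipoly_eval P (e x)) \<and> ring_poly_eval NF Lam P = germ U (\<lambda>x. ipoly_eval P (e x))"
  proof (induct P rule: poly_mapping_single_induct)
    case zero
    then show ?case by (simp add: NF.ring_poly_eval_zero germ_zero[OF U])
  next
    case (single m c)
    then show ?case using mon[of m] U
      by (simp add: NF.ring_poly_eval_single germ_int_multiple nash_on_mult nash_on_of_int)
  next
    case (add P P')
    then show ?case using U by (simp add: NF.ring_poly_eval_add nash_on_add)
  qed
  moreover have "ipoly_eval P (e x) = ipoly_eval P x" for x
    by (rule ipoly_eval_cong) (use P in \<open>auto simp: e_def\<close>)
  ultimately show ?thesis by simp
qed

text \<open>Independence of the coordinates: a nonzero polynomial has no zeros on some member of the
  filter, so its germ is not zero.\<close>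

lemma ring_poly_eval_Lam_eq_zero:
  assumes P: "ipoly_vars P \<subseteq> T" and z: "ring_poly_eval NF Lam P = \<zero>\<^bsub>NF\<^esub>"
  shows "P = 0"
proof (rule ccontr)
  assume "P \<noteq> 0"
  then obtain U where U: "U \<in> \<Omega>" "\<forall>x\<in>U. ipoly_eval P x \<noteq> 0" using avoid_zeros P by blast
  have "germ U (ipoly_eval P) = \<zero>\<^bsub>NF\<^esub>" using z ring_poly_eval_Lam[OF U(1) P] by simp
  then obtain V where "V \<in> \<Omega>" "V \<subseteq> U" "\<forall>x\<in>V. ipoly_eval P x = 0"
    using germ_eq_zero_iff[OF U(1) nash_on_poly[OF P]] by auto
  then show False using U(2) filter_nonempty[of V] by auto
qed

lemma NF_algebraic:
  assumes "\<xi> \<in> carrier NF"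
  shows "\<exists>(n::nat) C. (\<forall>i. ipoly_vars (C i) \<subseteq> T) \<and> (\<exists>i\<le>n. C i \<noteq> 0) \<and>
    (\<Oplus>\<^bsub>NF\<^esub>i\<in>{..n}. ring_poly_eval NF Lam (C i) \<otimes>\<^bsub>NF\<^esub> \<xi> [^]\<^bsub>NF\<^esub> i) = \<zero>\<^bsub>NF\<^esub>"
proof -
  obtain U f where U: "U \<in> \<Omega>" and f: "nash_on T U f" and \<xi>: "\<xi> = germ U f" using assms by (rule germ_cases)
  obtain n C i where C: "\<forall>i. ipoly_vars (C i) \<subseteq> T" "i \<le> n" "C i \<noteq> 0"
    "\<forall>x\<in>U. (\<Sum>i\<le>n. ipoly_eval (C i) x * f x ^ i) = 0"
    using f unfolding nash_on_def Q_algebraic_fun_def by (elim exE conjE)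
  have nC: "nash_on T U (ipoly_eval (C i))" for i by (rule nash_on_poly) (rule spec[OF C(1)])
  have "(\<Oplus>\<^bsub>NF\<^esub>i\<in>{..n}. ring_poly_eval NF Lam (C i) \<otimes>\<^bsub>NF\<^esub> \<xi> [^]\<^bsub>NF\<^esub> i) =
      (\<Oplus>\<^bsub>NF\<^esub>i\<in>{..n}. germ U (\<lambda>x. ipoly_eval (C i) x * f x ^ i))"
    using C(1) U f nC
    by (intro NF.finsum_cong') (auto simp: \<xi> ring_poly_eval_Lam[OF U] germ_power nash_on_power nash_on_mult)
  also have "\<dots> = germ U (\<lambda>x. \<Sum>i\<le>n. ipoly_eval (C i) x * f x ^ i)"
    using nC f by (intro germ_finsum U) (auto intro: nash_on_mult nash_on_power)
  also have "\<dots> = \<zero>\<^bsub>NF\<^esub>" unfolding germ_zero[OF U] by (rule germ_cong) (use C(4) in simp)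
  finally have z: "(\<Oplus>\<^bsub>NF\<^esub>i\<in>{..n}. ring_poly_eval NF Lam (C i) \<otimes>\<^bsub>NF\<^esub> \<xi> [^]\<^bsub>NF\<^esub> i) = \<zero>\<^bsub>NF\<^esub>" .
  have ex: "\<exists>i\<le>n. C i \<noteq> 0" by (rule exI[of _ i]) (rule conjI[OF C(2,3)])
  show ?thesis by (rule exI[of _ n], rule exI[of _ C]) (rule conjI[OF C(1) conjI[OF ex z]])
qed

end

section \<open>Derivations of the field of Nash functions\<close>

context nash_filter
begin

text \<open>Changing one coordinate means moving along a line in that direction, so holomorphy along
  lines provides partial derivatives.\<close>

lemma fun_upd_cline:
  assumes "x \<in> topspace (powertop_complex T)" "t \<in> T"
  shows "x(t := z) = cline T x (\<lambda>s\<in>T. if s = t then 1 else 0) (z - x t)"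
proof
  fix s
  show "(x(t := z)) s = cline T x (\<lambda>s\<in>T. if s = t then 1 else 0) (z - x t) s"
    using assms by (cases "s \<in> T") (auto simp: cline_def PiE_def extensional_def)
qed

lemma eventually_fun_upd:
  assumes "U \<in> \<Omega>" "x \<in> U" "t \<in> T"
  shows "\<forall>\<^sub>F z in nhds (x t). x(t := z) \<in> U"
proof -
  have xt: "x \<in> topspace (powertop_complex T)" using filter_topspace assms by blast
  let ?h = "\<lambda>s\<in>T. if s = t then 1 else (0::complex)"
  have "\<forall>\<^sub>F z in nhds 0. cline T x ?h z \<in> U"
    by (rule eventually_cline[OF filter_open[OF assms(1)] assms(2)])
  moreover have "((\<lambda>z. z - x t) \<longlongrightarrow> x t - x t) (nhds (x t))"
    by (intro tendsto_diff tendsto_const filterlim_ident)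
  then have "filterlim (\<lambda>z. z - x t) (nhds 0) (nhds (x t))" by simp
  ultimately have "\<forall>\<^sub>F z in nhds (x t). cline T x ?h (z - x t) \<in> U"
    by (rule eventually_compose_filterlim)
  then show ?thesis using fun_upd_cline[OF xt assms(3)] by simp
qed

lemma partial_differentiable:
  assumes "U \<in> \<Omega>" "nash_on T U f" "x \<in> U" "t \<in> T"
  shows "\<exists>d. ((\<lambda>z. f (x(t := z))) has_field_derivative d) (at (x t))"
proof -
  have xt: "x \<in> topspace (powertop_complex T)" using filter_topspace assms by blast
  let ?h = "\<lambda>s\<in>T. if s = t then 1 else (0::complex)"
  have "?h \<in> topspace (powertop_complex T)" by simp
  then obtain d where "((\<lambda>z. f (cline T x ?h z)) has_field_derivative d) (at 0)"
    using assms(2,3) unfolding nash_on_def power_holomorphic_on_iff field_differentiable_def by blast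
  then have "((\<lambda>z. f (cline T x ?h z)) has_field_derivative d) (at (x t + - x t))" by simp
  then have "((\<lambda>z. f (cline T x ?h (z + - x t))) has_field_derivative d) (at (x t))"
    by (simp only: DERIV_shift)
  then show ?thesis using fun_upd_cline[OF xt assms(4)] by auto
qed

lemma poly_partial:
  assumes P: "ipoly_vars P \<subseteq> T"
  shows "\<exists>g. (\<forall>U. nash_on T U g) \<and>
    (\<forall>x. ((\<lambda>z. ipoly_eval P (x(t := z))) has_field_derivative g x) (at (x t)))"
proof -
  have mon: "\<exists>g. (\<forall>U. nash_on T U g) \<and> (\<forall>U. nash_on T U (\<lambda>x. \<Prod>v\<in>#m. x v)) \<and>
      (\<forall>x. ((\<lambda>z. \<Prod>v\<in>#m. (x(t := z)) v) has_field_derivative g x) (at (x t)))"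
    if "set_mset m \<subseteq> T" for m
    using that
  proof (induct m)
    case empty
    show ?case by (intro exI[of _ "\<lambda>_. 0"]) auto
  next
    case (add v m)
    then obtain g where g: "\<And>U. nash_on T U g" "\<And>U. nash_on T U (\<lambda>x. \<Prod>v\<in>#m. x v)"
      "\<And>x. ((\<lambda>z. \<Prod>v\<in>#m. (x(t := z)) v) has_field_derivative g x) (at (x t))" by auto
    let ?e = "of_nat (if v = t then 1 else 0) :: complex"
    have v: "((\<lambda>z. (x(t := z)) v) has_field_derivative ?e) (at (x t))" for x
      by (cases "v = t") auto
    have "((\<lambda>z. (x(t := z)) v * (\<Prod>v\<in>#m. (x(t := z)) v)) has_field_derivative
        (?e * (\<Prod>v\<in>#m. x v) + g x * x v)) (at (x t))" for x
      using DERIV_mult[OF v[of x] g(3)[of x]] by simp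
    moreover have "nash_on T U (\<lambda>x. ?e * (\<Prod>v\<in>#m. x v) + g x * x v)"
      and "nash_on T U (\<lambda>x. x v * (\<Prod>v\<in>#m. x v))" for U
      using add.prems by (intro nash_on_add nash_on_mult nash_on_of_nat g nash_on_coordinate; simp)+
    ultimately show ?case
      by (intro exI[of _ "\<lambda>x. ?e * (\<Prod>v\<in>#m. x v) + g x * x v"]) (simp add: fun_upd_def cong: if_cong)
  qed
  have "\<forall>m. \<exists>g. m \<in> Poly_Mapping.keys P \<longrightarrow> (\<forall>U. nash_on T U g) \<and>
      (\<forall>x. ((\<lambda>z. \<Prod>v\<in>#m. (x(t := z)) v) has_field_derivative g x) (at (x t)))"
  proof
    fix m
    show "\<exists>g. m \<in> Poly_Mapping.keys P \<longrightarrow> (\<forall>U. nash_on T U g) \<and>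
      (\<forall>x. ((\<lambda>z. \<Prod>v\<in>#m. (x(t := z)) v) has_field_derivative g x) (at (x t)))"
    proof (cases "m \<in> Poly_Mapping.keys P")
      case True
      then have "set_mset m \<subseteq> T" using P by (auto simp: ipoly_vars_def)
      from mon[OF this] show ?thesis by (elim exE conjE) (intro exI impI conjI, assumption+)
    qed simp
  qed
  from choice[OF this] obtain G where G: "\<forall>m. m \<in> Poly_Mapping.keys P \<longrightarrow> (\<forall>U. nash_on T U (G m)) \<and>
      (\<forall>x. ((\<lambda>z. \<Prod>v\<in>#m. (x(t := z)) v) has_field_derivative G m x) (at (x t)))" by (rule exE)
  show ?thesis
  proof (intro exI[of _ "\<lambda>x. \<Sum>m\<in>Poly_Mapping.keys P. of_int (icoeff P m) * G m x"] conjI allI)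
    show "nash_on T U (\<lambda>x. \<Sum>m\<in>Poly_Mapping.keys P. of_int (icoeff P m) * G m x)" for U
      using G by (intro nash_on_sum nash_on_mult nash_on_of_int) simp
    show "((\<lambda>z. ipoly_eval P (x(t := z))) has_field_derivative
        (\<Sum>m\<in>Poly_Mapping.keys P. of_int (icoeff P m) * G m x)) (at (x t))" for x
      unfolding ipoly_eval_def
      by (intro DERIV_sum DERIV_cmult) (rule G[THEN spec, THEN mp, THEN conjunct2, THEN spec])
  qed
qed

text \<open>The formal derivative of the relation at \<open>f\<close> is a Nash function, so on a
  small member it vanishes nowhere or identically. In the second case it is itself a relation for
  \<open>f\<close>, of lower degree.\<close>

lemma nash_separable_relation:
  assumes "U \<in> \<Omega>" "nash_on T U f" "\<forall>i. ipoly_vars (C i) \<subseteq> T" "\<exists>i\<le>n. C i \<noteq> 0"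
    "\<forall>x\<in>U. (\<Sum>i\<le>n. ipoly_eval (C i) x * f x ^ i) = 0"
  shows "\<exists>V\<in>\<Omega>. V \<subseteq> U \<and> (\<exists>n C. (\<forall>i. ipoly_vars (C i) \<subseteq> T) \<and>
    (\<forall>x\<in>V. (\<Sum>i\<le>n. ipoly_eval (C i) x * f x ^ i) = 0) \<and>
    (\<forall>x\<in>V. (\<Sum>i\<le>n. ipoly_eval (C i) x * (of_nat i * f x ^ (i - 1))) \<noteq> 0))"
  using assms
proof (induct n arbitrary: C U)
  case 0
  \<comment> \<open>A relation of degree zero is impossible: its only coefficient is nonzero, yet
    vanishes on \<open>U\<close>.\<close>
  then have C0: "C 0 \<noteq> 0" by simp
  obtain V where V: "V \<in> \<Omega>" "V \<subseteq> U" "\<forall>x\<in>V. ipoly_eval (C 0) x \<noteq> 0"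
    using avoid_zeros_below[OF C0 _ 0(1)] 0(3) by auto
  obtain x where "x \<in> V" using filter_nonempty[OF V(1)] by auto
  then have "ipoly_eval (C 0) x \<noteq> 0" "x \<in> U" using V by auto
  then show ?case using 0(5) by auto
next
  case (Suc n)
  define E where "E x = (\<Sum>i\<le>Suc n. ipoly_eval (C i) x * (of_nat i * f x ^ (i - 1)))" for x
  have CT: "ipoly_vars (C i) \<subseteq> T" for i using Suc.prems(3) by simp
  have nE: "nash_on T U E" unfolding E_def
    by (intro nash_on_sum nash_on_mult nash_on_of_nat nash_on_power nash_on_poly CT Suc.prems(2))
  obtain V where V: "V \<in> \<Omega>" "V \<subseteq> U" "(\<forall>x\<in>V. E x = 0) \<or> (\<forall>x\<in>V. E x \<noteq> 0)"
    using nash_zero_or_nonvanishing[OF Suc.prems(1) nE] by (elim bexE conjE)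
  have fV: "nash_on T V f" by (rule nash_on_subset[OF Suc.prems(2) V(2)])
  from V(3) show ?case
  proof
    assume "\<forall>x\<in>V. E x \<noteq> 0"
    moreover have "\<forall>x\<in>V. (\<Sum>i\<le>Suc n. ipoly_eval (C i) x * f x ^ i) = 0"
      using Suc.prems(5) V(2) by blast
    ultimately show ?thesis unfolding E_def using Suc.prems(3) V(1,2)
      by (intro bexI[of _ V] conjI exI[of _ "Suc n"] exI[of _ C])
  next
    assume E0: "\<forall>x\<in>V. E x = 0"
    define C' where "C' i = isingle {#} (int (Suc i)) * C (Suc i)" for i
    have C'T: "\<forall>i. ipoly_vars (C' i) \<subseteq> T"
    proof
      fix i
      have "ipoly_vars (isingle ({#} :: 't multiset) (int (Suc i))) \<subseteq> {}" by (rule order_trans[OF ipoly_vars_single]) simp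
      then show "ipoly_vars (C' i) \<subseteq> T"
        using ipoly_vars_mult[of "isingle {#} (int (Suc i))" "C (Suc i)"] CT[of "Suc i"] unfolding C'_def by blast
    qed
    have C'0: "\<forall>x\<in>V. (\<Sum>i\<le>n. ipoly_eval (C' i) x * f x ^ i) = 0"
    proof
      fix x assume "x \<in> V"
      have "E x = (\<Sum>i\<le>n. ipoly_eval (C (Suc i)) x * (of_nat (Suc i) * f x ^ i))"
        unfolding E_def by (subst sum.atMost_Suc_shift) simp
      also have "\<dots> = (\<Sum>i\<le>n. ipoly_eval (C' i) x * f x ^ i)"
        by (simp add: C'_def algebra_simps)
      finally show "(\<Sum>i\<le>n. ipoly_eval (C' i) x * f x ^ i) = 0" using E0 \<open>x \<in> V\<close> by simp
    qed
    have "\<exists>i\<le>n. C' i \<noteq> 0"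
    \<comment> \<open>If the derived relation were trivial, only \<open>C 0\<close> would remain,
      again a nonzero polynomial vanishing on a member of the filter.\<close>
    proof (rule ccontr)
      assume no: "\<not> (\<exists>i\<le>n. C' i \<noteq> 0)"
      have "C (Suc i) = 0" if "i \<le> n" for i
      proof -
        have "isingle {#} (int (Suc i)) * C (Suc i) = 0" using no that by (simp add: C'_def)
        moreover have "isingle ({#} :: 't multiset) (int (Suc i)) \<noteq> 0"
          by (metis keys_single keys_zero insert_not_empty of_nat_eq_0_iff nat.distinct(2))
        ultimately show ?thesis using ipoly_no_zero_divisors by blast
      qed
      then have CS: "C i = 0" if "0 < i" "i \<le> Suc n" for i using that by (cases i) auto
      then have C0: "C 0 \<noteq> 0" using Suc.prems(4) by (metis gr0I)
      obtain W where W: "W \<in> \<Omega>" "W \<subseteq> U" "\<forall>x\<in>W. ipoly_eval (C 0) x \<noteq> 0"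
        using avoid_zeros_below[OF C0 CT Suc.prems(1)] by auto
      obtain x where x: "x \<in> W" using filter_nonempty[OF W(1)] by auto
      have "(\<Sum>i\<le>Suc n. ipoly_eval (C i) x * f x ^ i) = (\<Sum>i\<in>{0}. ipoly_eval (C i) x * f x ^ i)"
        using CS by (intro sum.mono_neutral_right) auto
      moreover have "(\<Sum>i\<le>Suc n. ipoly_eval (C i) x * f x ^ i) = 0"
        using Suc.prems(5) W(2) x by blast
      ultimately show False using W(3) x by simp
    qed
    from Suc.hyps[OF V(1) fV C'T this C'0] obtain W where W: "W \<in> \<Omega>" "W \<subseteq> V"
      "\<exists>n C. (\<forall>i. ipoly_vars (C i) \<subseteq> T) \<and>
      (\<forall>x\<in>W. (\<Sum>i\<le>n. ipoly_eval (C i) x * f x ^ i) = 0) \<and>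
      (\<forall>x\<in>W. (\<Sum>i\<le>n. ipoly_eval (C i) x * (of_nat i * f x ^ (i - 1))) \<noteq> 0)" by (elim bexE conjE)
    then show ?thesis using order_trans[OF W(2) V(2)] by (intro bexI[of _ W] conjI)
  qed
qed

text \<open>Holomorphy gives the derivative; the point is that it is again a Nash function.
  Differentiating a separable relation expresses it as \<open>- A / E\<close> with Nash functions
  \<open>A\<close> and \<open>E\<close>, where \<open>E\<close> has no zeros on
  \<open>V\<close>.\<close>

lemma nash_partial_exists:
  assumes U: "U \<in> \<Omega>" and f: "nash_on T U f" and t: "t \<in> T"
  shows "\<exists>V\<in>\<Omega>. V \<subseteq> U \<and> (\<exists>g. nash_on T V g \<and>
    (\<forall>x\<in>V. ((\<lambda>z. f (x(t := z))) has_field_derivative g x) (at (x t))))"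
proof -
  obtain n0 C0 i0 where C0: "\<forall>i. ipoly_vars (C0 i) \<subseteq> T" "i0 \<le> n0" "C0 i0 \<noteq> 0"
    "\<forall>x\<in>U. (\<Sum>i\<le>n0. ipoly_eval (C0 i) x * f x ^ i) = 0"
    using f unfolding nash_on_def Q_algebraic_fun_def by (elim exE conjE)
  then have "\<exists>i\<le>n0. C0 i \<noteq> 0" by auto
  from nash_separable_relation[OF U f C0(1) this C0(4)]
  obtain V n C where V: "V \<in> \<Omega>" "V \<subseteq> U" and C: "\<forall>i. ipoly_vars (C i) \<subseteq> T"
    "\<forall>x\<in>V. (\<Sum>i\<le>n. ipoly_eval (C i) x * f x ^ i) = 0"
    "\<forall>x\<in>V. (\<Sum>i\<le>n. ipoly_eval (C i) x * (of_nat i * f x ^ (i - 1))) \<noteq> 0" by (elim bexE exE conjE)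
  have fV: "nash_on T V f" by (rule nash_on_subset[OF f V(2)])
  have "\<forall>i. \<exists>g. (\<forall>U. nash_on T U g) \<and>
    (\<forall>x. ((\<lambda>z. ipoly_eval (C i) (x(t := z))) has_field_derivative g x) (at (x t)))"
    using poly_partial C(1) by simp
  from choice[OF this] obtain G where G: "\<forall>i. (\<forall>U. nash_on T U (G i)) \<and>
    (\<forall>x. ((\<lambda>z. ipoly_eval (C i) (x(t := z))) has_field_derivative G i x) (at (x t)))" by (rule exE)
  define E where "E x = (\<Sum>i\<le>n. ipoly_eval (C i) x * (of_nat i * f x ^ (i - 1)))" for x
  define A where "A x = (\<Sum>i\<le>n. G i x * f x ^ i)" for x
  have nE: "nash_on T V E" unfolding E_def using C(1)
    by (intro nash_on_sum nash_on_mult nash_on_of_nat nash_on_power nash_on_poly fV) simp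
  have nA: "nash_on T V A" unfolding A_def using G
    by (intro nash_on_sum nash_on_mult nash_on_power fV) simp
  have E0: "E x \<noteq> 0" if "x \<in> V" for x using C(3) that by (simp add: E_def)
  have "nash_on T V (\<lambda>x. - (A x * inverse (E x)))"
    by (intro nash_on_uminus nash_on_mult nA nash_on_inverse filter_topspace V(1) nE E0)
  moreover have "((\<lambda>z. f (x(t := z))) has_field_derivative - (A x * inverse (E x))) (at (x t))" if x: "x \<in> V" for x
  proof -
    obtain d where d: "((\<lambda>z. f (x(t := z))) has_field_derivative d) (at (x t))"
      using partial_differentiable[OF V(1) fV x t] by (rule exE)
    have term_deriv: "((\<lambda>z. ipoly_eval (C i) (x(t := z)) * f (x(t := z)) ^ i) has_field_derivative
        (G i x * f x ^ i + (of_nat i * (d * f x ^ (i - 1))) * ipoly_eval (C i) x)) (at (x t))" for i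
    proof -
      have "((\<lambda>z. f (x(t := z)) ^ i) has_field_derivative of_nat i * (d * f x ^ (i - 1))) (at (x t))"
        using DERIV_power[OF d, of i] by simp
      from DERIV_mult[OF G[THEN spec, of i, THEN conjunct2, THEN spec, of x] this] show ?thesis by simp
    qed
    have der: "((\<lambda>z. \<Sum>i\<le>n. ipoly_eval (C i) (x(t := z)) * f (x(t := z)) ^ i) has_field_derivative
        (\<Sum>i\<le>n. G i x * f x ^ i + (of_nat i * (d * f x ^ (i - 1))) * ipoly_eval (C i) x)) (at (x t))"
      by (intro DERIV_sum term_deriv)
    \<comment> \<open>The relation holds for all nearby values of the coordinate, so its left side
      has derivative zero.\<close>
    have ev: "\<forall>\<^sub>F z in nhds (x t). (\<Sum>i\<le>n. ipoly_eval (C i) (x(t := z)) * f (x(t := z)) ^ i) = 0"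
      using eventually_fun_upd[OF V(1) x t] by eventually_elim (use C(2) in simp)
    have "((\<lambda>z. 0) has_field_derivative
        (\<Sum>i\<le>n. G i x * f x ^ i + (of_nat i * (d * f x ^ (i - 1))) * ipoly_eval (C i) x)) (at (x t))"
      by (rule iffD1[OF DERIV_cong_ev[OF refl ev refl] der])
    then have "(\<Sum>i\<le>n. G i x * f x ^ i + (of_nat i * (d * f x ^ (i - 1))) * ipoly_eval (C i) x) = 0"
      by (rule DERIV_unique[OF _ DERIV_const])
    then have "A x + d * E x = 0"
      by (simp add: A_def E_def sum.distrib sum_distrib_left algebra_simps)
    then have "d = - (A x * inverse (E x))" using E0[OF x] by (simp add: field_simps add_eq_0_iff)
    then show ?thesis using d by simp
  qed
  ultimately show ?thesis using V by (intro bexI[of _ V] conjI exI ballI)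
qed

text \<open>A representative whose derivative were not Nash on its whole domain would contribute the
  empty set; every other one agrees with \<open>f\<close>, and hence its derivative with
  \<open>g\<close>, on a smaller member.\<close>

lemma nash_partial_germ:
  assumes U: "U \<in> \<Omega>" and f: "nash_on T U f" and g: "nash_on T U g" and t: "t \<in> T"
    and deriv: "\<And>x. x \<in> U \<Longrightarrow> ((\<lambda>z. f (x(t := z))) has_field_derivative g x) (at (x t))"
  shows "nash_partial T \<Omega> t (germ U f) = germ U g"
proof -
  define D where "D f1 x = deriv (\<lambda>z. f1 (x(t := z))) (x t)" for f1 :: "('t \<Rightarrow> complex) \<Rightarrow> complex" and x
  have D: "D f1 x = g x" if W: "W \<in> \<Omega>" "W \<subseteq> U" "\<forall>x\<in>W. f1 x = f x" and x: "x \<in> W" for f1 W x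
  proof -
    have "\<forall>\<^sub>F z in nhds (x t). f (x(t := z)) = f1 (x(t := z))"
      using eventually_fun_upd[OF W(1) x t] by eventually_elim (use W(3) in simp)
    then have "((\<lambda>z. f1 (x(t := z))) has_field_derivative g x) (at (x t))"
      using deriv[of x] W(2) x DERIV_cong_ev[OF refl _ refl, of "\<lambda>z. f (x(t := z))" "\<lambda>z. f1 (x(t := z))"] by blast
    then show ?thesis unfolding D_def by (rule DERIV_imp_deriv)
  qed
  have piece: "germ V (D f1) \<subseteq> germ U g" if m: "(V, f1) \<in> germ U f" for V f1
  proof (cases "nash_on T V (D f1)")
    case True
    note m' = germ_member[OF U f m]
    obtain W where W: "W \<in> \<Omega>" "W \<subseteq> V" "W \<subseteq> U" "\<forall>x\<in>W. f1 x = f x"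
      using m'(3) unfolding germ_eq_iff[OF m'(1,2) U f] by (elim bexE conjE)
    have "germ V (D f1) = germ U g"
      by (rule germ_eqI[OF m'(1) True U g W(1,2,3)]) (rule D[OF W(1,3,4)])
    then show ?thesis by simp
  next
    case False
    then show ?thesis by (simp add: germ_not_nash)
  qed
  show ?thesis
  proof (rule antisym)
    show "nash_partial T \<Omega> t (germ U f) \<subseteq> germ U g"
    proof
      fix a assume "a \<in> nash_partial T \<Omega> t (germ U f)"
      then obtain V f1 where "(V, f1) \<in> germ U f" "a \<in> germ V (D f1)"
        unfolding nash_partial_def D_def by (elim UN_E) (auto split: prod.splits)
      then show "a \<in> germ U g" using piece by blast
    qed
    have "germ U (D (restrict f U)) = germ U g"
      by (rule germ_cong) (rule D[OF U order_refl], simp_all)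
    moreover have "germ U (D (restrict f U)) \<subseteq> nash_partial T \<Omega> t (germ U f)"
    proof
      fix a assume a: "a \<in> germ U (D (restrict f U))"
      show "a \<in> nash_partial T \<Omega> t (germ U f)"
        unfolding nash_partial_def
        by (rule UN_I[OF germ_self[OF U f]]) (use a in \<open>simp add: D_def[abs_def]\<close>)
    qed
    ultimately show "germ U g \<subseteq> nash_partial T \<Omega> t (germ U f)" by simp
  qed
qed

lemma nash_partial_cases:
  assumes \<xi>: "\<xi> \<in> carrier NF" and \<eta>: "\<eta> \<in> carrier NF" and t: "t \<in> T"
  obtains U f f' g g' where "U \<in> \<Omega>" "nash_on T U f" "nash_on T U f'" "nash_on T U g" "nash_on T U g'"
    "\<xi> = germ U f" "\<eta> = germ U g"
    "\<forall>x\<in>U. ((\<lambda>z. f (x(t := z))) has_field_derivative f' x) (at (x t))"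
    "\<forall>x\<in>U. ((\<lambda>z. g (x(t := z))) has_field_derivative g' x) (at (x t))"
proof -
  obtain U f g where U: "U \<in> \<Omega>" "nash_on T U f" "nash_on T U g" "\<xi> = germ U f" "\<eta> = germ U g"
    using \<xi> \<eta> by (rule germ_cases2)
  from nash_partial_exists[OF U(1,2) t] obtain V f' where V: "V \<in> \<Omega>" "V \<subseteq> U" "nash_on T V f'"
    "\<forall>x\<in>V. ((\<lambda>z. f (x(t := z))) has_field_derivative f' x) (at (x t))" by (elim bexE exE conjE)
  from nash_partial_exists[OF V(1) nash_on_subset[OF U(3) V(2)] t] obtain W g' where W: "W \<in> \<Omega>" "W \<subseteq> V" "nash_on T W g'"
    "\<forall>x\<in>W. ((\<lambda>z. g (x(t := z))) has_field_derivative g' x) (at (x t))" by (elim bexE exE conjE)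
  have WU: "W \<subseteq> U" using W(2) V(2) by (rule order_trans)
  show thesis
  proof (rule that[of W f f' g g'])
    show "\<xi> = germ W f" "\<eta> = germ W g" using U germ_restrict[OF U(1) _ W(1) WU] by auto
    show "\<forall>x\<in>W. ((\<lambda>z. f (x(t := z))) has_field_derivative f' x) (at (x t))"
      using V(4) W(2) by blast
    show "\<forall>x\<in>W. ((\<lambda>z. g (x(t := z))) has_field_derivative g' x) (at (x t))" by (rule W(4))
  qed (use W U(2,3) V(3) WU in \<open>auto intro: nash_on_subset\<close>)
qed

lemma differential_field_partial:
  assumes t: "t \<in> T"
  shows "differential_field NF (nash_partial T \<Omega> t)"
proof (intro differential_field.intro differential_field_axioms.intro field_NF char_zero_NF)
  fix \<xi> \<eta> assume x: "\<xi> \<in> carrier NF" "\<eta> \<in> carrier NF"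
  from x t obtain U f f' g g' where U: "U \<in> \<Omega>" and n: "nash_on T U f" "nash_on T U f'" "nash_on T U g" "nash_on T U g'"
    and e: "\<xi> = germ U f" "\<eta> = germ U g"
    and d: "\<forall>x\<in>U. ((\<lambda>z. f (x(t := z))) has_field_derivative f' x) (at (x t))"
    "\<forall>x\<in>U. ((\<lambda>z. g (x(t := z))) has_field_derivative g' x) (at (x t))"
    by (rule nash_partial_cases)
  note d = d[THEN bspec]
  have p: "nash_partial T \<Omega> t \<xi> = germ U f'" "nash_partial T \<Omega> t \<eta> = germ U g'"
    unfolding e by (rule nash_partial_germ[OF U _ _ t]; (rule n d; assumption?))+
  have "nash_partial T \<Omega> t (germ U (\<lambda>x. f x + g x)) = germ U (\<lambda>x. f' x + g' x)"
    by (rule nash_partial_germ[OF U _ _ t]) (auto intro: nash_on_add n DERIV_add d)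
  then show "nash_partial T \<Omega> t (\<xi> \<oplus>\<^bsub>NF\<^esub> \<eta>) = nash_partial T \<Omega> t \<xi> \<oplus>\<^bsub>NF\<^esub> nash_partial T \<Omega> t \<eta>"
    unfolding p using e U n by simp
  have "nash_partial T \<Omega> t (germ U (\<lambda>x. f x * g x)) = germ U (\<lambda>x. f' x * g x + f x * g' x)"
  proof (rule nash_partial_germ[OF U _ _ t])
    show "((\<lambda>z. f (x(t := z)) * g (x(t := z))) has_field_derivative f' x * g x + f x * g' x) (at (x t))" if "x \<in> U" for x
      using DERIV_mult[OF d(1)[OF that] d(2)[OF that]] by (simp add: mult.commute)
    show "nash_on T U (\<lambda>x. f x * g x)" "nash_on T U (\<lambda>x. f' x * g x + f x * g' x)"
      by (intro nash_on_add nash_on_mult n)+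
  qed
  then show "nash_partial T \<Omega> t (\<xi> \<otimes>\<^bsub>NF\<^esub> \<eta>) =
      nash_partial T \<Omega> t \<xi> \<otimes>\<^bsub>NF\<^esub> \<eta> \<oplus>\<^bsub>NF\<^esub> \<xi> \<otimes>\<^bsub>NF\<^esub> nash_partial T \<Omega> t \<eta>"
    unfolding p using e U n by (simp add: nash_on_mult)
next
  fix \<xi> assume x: "\<xi> \<in> carrier NF"
  from x x t obtain U f f' g g' where "U \<in> \<Omega>" "nash_on T U f" "nash_on T U f'" "nash_on T U g" "nash_on T U g'"
    "\<xi> = germ U f" "\<xi> = germ U g"
    "\<forall>x\<in>U. ((\<lambda>z. f (x(t := z))) has_field_derivative f' x) (at (x t))"
    "\<forall>x\<in>U. ((\<lambda>z. g (x(t := z))) has_field_derivative g' x) (at (x t))"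
    by (rule nash_partial_cases)
  then show "nash_partial T \<Omega> t \<xi> \<in> carrier NF"
    using nash_partial_germ[of U f f' t] t by simp
qed

lemma nash_partial_Lam:
  assumes t: "t \<in> T" and s: "s \<in> T"
  shows "nash_partial T \<Omega> t (Lam s) = (if s = t then \<one>\<^bsub>NF\<^esub> else \<zero>\<^bsub>NF\<^esub>)"
proof -
  obtain U where U: "U \<in> \<Omega>" using filter_exists by auto
  have "nash_partial T \<Omega> t (germ U (\<lambda>x. x s)) = germ U (\<lambda>_. of_nat (if s = t then 1 else 0))"
  proof (rule nash_partial_germ[OF U nash_on_coordinate[OF s] nash_on_of_nat t])
    show "((\<lambda>z. (x(t := z)) s) has_field_derivative of_nat (if s = t then 1 else 0)) (at (x t))" for x
      by (cases "s = t") auto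
  qed
  moreover have "Lam s = germ U (\<lambda>x. x s)" using Lam_germ[OF U, of s] s by simp
  ultimately show ?thesis by (simp add: germ_one[OF U] germ_zero[OF U])
qed

text \<open>\<open>F\<close> consists of the coordinates in an algebraic relation for
  \<open>\<xi>\<close>: a derivation that kills them kills the coefficients and therefore
  \<open>\<xi>\<close>. Since \<open>F\<close> is chosen before \<open>D\<close>, this gives both
  the uniqueness of derivations and the finiteness of the sum in
  \<open>nash_derivation\<close>.\<close>

lemma deriv_determined_by_coordinates:
  assumes \<xi>: "\<xi> \<in> carrier NF"
  shows "\<exists>F. finite F \<and> F \<subseteq> T \<and> (\<forall>D. differential_field NF D \<longrightarrow> (\<forall>s\<in>F. D (Lam s) = \<zero>\<^bsub>NF\<^esub>) \<longrightarrow> D \<xi> = \<zero>\<^bsub>NF\<^esub>)"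
proof -
  obtain n :: nat and C where nC: "(\<forall>i. ipoly_vars (C i) \<subseteq> T) \<and> (\<exists>i\<le>n. C i \<noteq> 0) \<and>
    (\<Oplus>\<^bsub>NF\<^esub>i\<in>{..n}. ring_poly_eval NF Lam (C i) \<otimes>\<^bsub>NF\<^esub> \<xi> [^]\<^bsub>NF\<^esub> i) = \<zero>\<^bsub>NF\<^esub>"
    using NF_algebraic[OF \<xi>] by (elim exE)
  obtain i where i: "i \<le> n" "C i \<noteq> 0" using nC[THEN conjunct2, THEN conjunct1] by (elim exE conjE)
  note C = nC[THEN conjunct1] i nC[THEN conjunct2, THEN conjunct2]
  \<comment> \<open>Coefficients beyond \<open>n\<close> are set to zero because
    \<open>deriv_algebraic_eq_zero\<close> wants the whole sequence killed by
    \<open>D\<close>.\<close>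
  define C' where "C' i = (if i \<le> n then C i else 0)" for i
  show ?thesis
  proof (intro exI[of _ "\<Union>i\<le>n. ipoly_vars (C i)"] conjI allI impI)
    show "(\<Union>i\<le>n. ipoly_vars (C i)) \<subseteq> T" using C(1) by auto
    fix D assume "differential_field NF D" and D0: "\<forall>s\<in>\<Union>i\<le>n. ipoly_vars (C i). D (Lam s) = \<zero>\<^bsub>NF\<^esub>"
    then interpret D: differential_field NF D by simp
    show "D \<xi> = \<zero>\<^bsub>NF\<^esub>"
    proof (rule D.deriv_algebraic_eq_zero[OF \<xi>])
      show "ring_poly_eval NF Lam (C' i) \<in> carrier NF" for i by (rule NF.ring_poly_eval_closed) simp
      show "D (ring_poly_eval NF Lam (C' i)) = \<zero>\<^bsub>NF\<^esub>" for i
        by (rule D.deriv_poly_eval_eq_zero) (use D0 in \<open>auto simp: C'_def split: if_splits\<close>)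
      have "ring_poly_eval NF Lam (C' i) \<noteq> \<zero>\<^bsub>NF\<^esub>"
        using ring_poly_eval_Lam_eq_zero[of "C i"] C(1-3) by (auto simp: C'_def)
      then show "\<exists>i\<le>n. ring_poly_eval NF Lam (C' i) \<noteq> \<zero>\<^bsub>NF\<^esub>" using C(2) by blast
      have "(\<Oplus>\<^bsub>NF\<^esub>i\<in>{..n}. ring_poly_eval NF Lam (C' i) \<otimes>\<^bsub>NF\<^esub> \<xi> [^]\<^bsub>NF\<^esub> i) =
          (\<Oplus>\<^bsub>NF\<^esub>i\<in>{..n}. ring_poly_eval NF Lam (C i) \<otimes>\<^bsub>NF\<^esub> \<xi> [^]\<^bsub>NF\<^esub> i)"
        using \<xi> by (intro NF.finsum_cong') (auto simp: C'_def NF.ring_poly_eval_closed)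
      then show "(\<Oplus>\<^bsub>NF\<^esub>i\<in>{..n}. ring_poly_eval NF Lam (C' i) \<otimes>\<^bsub>NF\<^esub> \<xi> [^]\<^bsub>NF\<^esub> i) = \<zero>\<^bsub>NF\<^esub>"
        using C(4) by simp
    qed
  qed simp
qed

end

section \<open>Uniqueness of derivations and sums of partial derivatives\<close>

context nash_filter
begin

lemma deriv_eqI:
  assumes D: "differential_field NF D" "differential_field NF D'"
    and eq: "\<And>t. t \<in> T \<Longrightarrow> D (Lam t) = D' (Lam t)" and \<xi>: "\<xi> \<in> carrier NF"
  shows "D \<xi> = D' \<xi>"
proof -
  interpret D: differential_field NF D by fact
  interpret D': differential_field NF D' by fact
  have diff: "differential_field NF (\<lambda>a. D a \<ominus>\<^bsub>NF\<^esub> D' a)"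
    by (rule D.differential_field_diff[OF D(2)])
  obtain F where F: "F \<subseteq> T"
    "\<forall>D. differential_field NF D \<longrightarrow> (\<forall>s\<in>F. D (Lam s) = \<zero>\<^bsub>NF\<^esub>) \<longrightarrow> D \<xi> = \<zero>\<^bsub>NF\<^esub>"
    using deriv_determined_by_coordinates[OF \<xi>] by (elim exE conjE)
  have "\<forall>s\<in>F. D (Lam s) \<ominus>\<^bsub>NF\<^esub> D' (Lam s) = \<zero>\<^bsub>NF\<^esub>"
  proof
    fix s assume "s \<in> F"
    then have "D (Lam s) = D' (Lam s)" using F(1) by (intro eq) auto
    then show "D (Lam s) \<ominus>\<^bsub>NF\<^esub> D' (Lam s) = \<zero>\<^bsub>NF\<^esub>"
      using D'.deriv_closed[OF Lam_closed] by (simp add: NF.minus_eq NF.r_neg)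
  qed
  then have "D \<xi> \<ominus>\<^bsub>NF\<^esub> D' \<xi> = \<zero>\<^bsub>NF\<^esub>" using F(2)[THEN spec, THEN mp, OF diff] by simp
  then show ?thesis using D.deriv_closed[OF \<xi>] D'.deriv_closed[OF \<xi>] by simp
qed

text \<open>For \<open>t\<close> outside \<open>F\<close> the partial derivative kills all
  coordinates in \<open>F\<close>, and hence \<open>\<xi>\<close>.\<close>

lemma nash_partial_support:
  assumes \<xi>: "\<xi> \<in> carrier NF"
  shows "\<exists>F. finite F \<and> F \<subseteq> T \<and> (\<forall>t\<in>T - F. nash_partial T \<Omega> t \<xi> = \<zero>\<^bsub>NF\<^esub>)"
proof -
  obtain F where F: "finite F" "F \<subseteq> T"
    "\<forall>D. differential_field NF D \<longrightarrow> (\<forall>s\<in>F. D (Lam s) = \<zero>\<^bsub>NF\<^esub>) \<longrightarrow> D \<xi> = \<zero>\<^bsub>NF\<^esub>"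
    using deriv_determined_by_coordinates[OF \<xi>] by (elim exE conjE)
  have "nash_partial T \<Omega> t \<xi> = \<zero>\<^bsub>NF\<^esub>" if t: "t \<in> T - F" for t
  proof -
    have "\<forall>s\<in>F. nash_partial T \<Omega> t (Lam s) = \<zero>\<^bsub>NF\<^esub>"
    proof
      fix s assume "s \<in> F"
      then have "s \<in> T" "s \<noteq> t" using F(2) t by auto
      then show "nash_partial T \<Omega> t (Lam s) = \<zero>\<^bsub>NF\<^esub>" using nash_partial_Lam[of t s] t by simp
    qed
    then show ?thesis using F(3)[THEN spec, THEN mp, OF differential_field_partial] t by simp
  qed
  then show ?thesis using F(1,2) by (intro exI[of _ F] conjI ballI)
qed

text \<open>Any \<open>F\<close> outside which the partial derivatives vanish is allowed, so that
  two germs, their sum and their product can share one finite index set.\<close>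

lemma nash_derivation_eq_finsum:
  assumes g: "\<And>t. t \<in> T \<Longrightarrow> g t \<in> carrier NF" and \<xi>: "\<xi> \<in> carrier NF"
    and F: "finite F" "F \<subseteq> T" "\<forall>t\<in>T - F. nash_partial T \<Omega> t \<xi> = \<zero>\<^bsub>NF\<^esub>"
  shows "nash_derivation T \<Omega> g \<xi> = (\<Oplus>\<^bsub>NF\<^esub>t\<in>F. g t \<otimes>\<^bsub>NF\<^esub> nash_partial T \<Omega> t \<xi>)"
proof -
  let ?h = "\<lambda>t. g t \<otimes>\<^bsub>NF\<^esub> nash_partial T \<Omega> t \<xi>"
  have c: "?h t \<in> carrier NF" if "t \<in> T" for t
    using g[OF that] differential_field.deriv_closed[OF differential_field_partial[OF that] \<xi>] by simp
  have z: "?h t = \<zero>\<^bsub>NF\<^esub>" if "t \<in> T - F" for t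
    using g[of t] that F(3) by simp
  have "gfinprod (add_monoid NF) ?h F = gfinprod (add_monoid NF) ?h T"
    by (rule comm_monoid.gfinprod_mono_neutral_cong_left[OF NF.a_comm_monoid]) (use F(2) z c in auto)
  moreover have "gfinprod (add_monoid NF) ?h F = finprod (add_monoid NF) ?h F"
    by (rule comm_monoid.gfinprod_eq_finprod[OF NF.a_comm_monoid F(1)]) (use F(2) c in auto)
  ultimately show ?thesis unfolding nash_derivation_def finsum_def by simp
qed

lemma differential_field_nash_derivation:
  assumes g: "\<And>t. t \<in> T \<Longrightarrow> g t \<in> carrier NF"
  shows "differential_field NF (nash_derivation T \<Omega> g)"
proof (intro differential_field.intro differential_field_axioms.intro field_NF char_zero_NF)
  let ?d = "nash_partial T \<Omega>"
  have dc: "?d t \<xi> \<in> carrier NF" if "t \<in> T" "\<xi> \<in> carrier NF" for t \<xi>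
    by (rule differential_field.deriv_closed[OF differential_field_partial[OF that(1)] that(2)])
  have add: "?d t (\<xi> \<oplus>\<^bsub>NF\<^esub> \<eta>) = ?d t \<xi> \<oplus>\<^bsub>NF\<^esub> ?d t \<eta>"
    if "t \<in> T" "\<xi> \<in> carrier NF" "\<eta> \<in> carrier NF" for t \<xi> \<eta>
    by (rule differential_field.deriv_add[OF differential_field_partial[OF that(1)] that(2,3)])
  have mult: "?d t (\<xi> \<otimes>\<^bsub>NF\<^esub> \<eta>) = ?d t \<xi> \<otimes>\<^bsub>NF\<^esub> \<eta> \<oplus>\<^bsub>NF\<^esub> \<xi> \<otimes>\<^bsub>NF\<^esub> ?d t \<eta>"
    if "t \<in> T" "\<xi> \<in> carrier NF" "\<eta> \<in> carrier NF" for t \<xi> \<eta>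
    by (rule differential_field.deriv_mult[OF differential_field_partial[OF that(1)] that(2,3)])
  have eq: "nash_derivation T \<Omega> g \<xi> = (\<Oplus>\<^bsub>NF\<^esub>t\<in>F. g t \<otimes>\<^bsub>NF\<^esub> ?d t \<xi>)"
    if "\<xi> \<in> carrier NF" "finite F" "F \<subseteq> T" "\<forall>t\<in>T - F. ?d t \<xi> = \<zero>\<^bsub>NF\<^esub>" for \<xi> F
    by (rule nash_derivation_eq_finsum[OF g that])
  {
    fix \<xi> assume x: "\<xi> \<in> carrier NF"
    obtain F where F: "finite F" "F \<subseteq> T" "\<forall>t\<in>T - F. ?d t \<xi> = \<zero>\<^bsub>NF\<^esub>"
      using nash_partial_support[OF x] by (elim exE conjE)
    show "nash_derivation T \<Omega> g \<xi> \<in> carrier NF"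
      unfolding eq[OF x F] by (rule NF.finsum_closed) (use F(2) g dc x in auto)
  next
    fix \<xi> \<eta> assume x: "\<xi> \<in> carrier NF" and y: "\<eta> \<in> carrier NF"
    obtain F1 where F1: "finite F1" "F1 \<subseteq> T" "\<forall>t\<in>T - F1. ?d t \<xi> = \<zero>\<^bsub>NF\<^esub>"
      using nash_partial_support[OF x] by (elim exE conjE)
    obtain F2 where F2: "finite F2" "F2 \<subseteq> T" "\<forall>t\<in>T - F2. ?d t \<eta> = \<zero>\<^bsub>NF\<^esub>"
      using nash_partial_support[OF y] by (elim exE conjE)
    define F where "F = F1 \<union> F2"
    have F: "finite F" "F \<subseteq> T" "\<forall>t\<in>T - F. ?d t \<xi> = \<zero>\<^bsub>NF\<^esub>" "\<forall>t\<in>T - F. ?d t \<eta> = \<zero>\<^bsub>NF\<^esub>"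
      using F1 F2 by (auto simp: F_def)
    have Fg: "g t \<in> carrier NF" "?d t \<xi> \<in> carrier NF" "?d t \<eta> \<in> carrier NF" "t \<in> T" if "t \<in> F" for t
      using that F(2) g dc x y by auto
    have Fa: "\<forall>t\<in>T - F. ?d t (\<xi> \<oplus>\<^bsub>NF\<^esub> \<eta>) = \<zero>\<^bsub>NF\<^esub>" using F(3,4) add[OF _ x y] by simp
    have Fm: "\<forall>t\<in>T - F. ?d t (\<xi> \<otimes>\<^bsub>NF\<^esub> \<eta>) = \<zero>\<^bsub>NF\<^esub>" using F(3,4) mult[OF _ x y] x y by simp
    note ex = eq[OF x F(1,2,3)] and ey = eq[OF y F(1,2,4)]
    note ea = eq[OF NF.a_closed[OF x y] F(1,2) Fa] and em = eq[OF NF.m_closed[OF x y] F(1,2) Fm]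
    show "nash_derivation T \<Omega> g (\<xi> \<oplus>\<^bsub>NF\<^esub> \<eta>) = nash_derivation T \<Omega> g \<xi> \<oplus>\<^bsub>NF\<^esub> nash_derivation T \<Omega> g \<eta>"
    proof -
      have "(\<Oplus>\<^bsub>NF\<^esub>t\<in>F. g t \<otimes>\<^bsub>NF\<^esub> ?d t (\<xi> \<oplus>\<^bsub>NF\<^esub> \<eta>)) =
          (\<Oplus>\<^bsub>NF\<^esub>t\<in>F. g t \<otimes>\<^bsub>NF\<^esub> ?d t \<xi> \<oplus>\<^bsub>NF\<^esub> g t \<otimes>\<^bsub>NF\<^esub> ?d t \<eta>)"
        by (rule NF.finsum_cong') (use Fg in \<open>auto simp: add[OF _ x y] NF.r_distr\<close>)
      also have "\<dots> = (\<Oplus>\<^bsub>NF\<^esub>t\<in>F. g t \<otimes>\<^bsub>NF\<^esub> ?d t \<xi>) \<oplus>\<^bsub>NF\<^esub> (\<Oplus>\<^bsub>NF\<^esub>t\<in>F. g t \<otimes>\<^bsub>NF\<^esub> ?d t \<eta>)"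
        by (rule NF.finsum_addf) (use Fg in auto)
      finally show ?thesis by (simp only: ex ey ea)
    qed
    show "nash_derivation T \<Omega> g (\<xi> \<otimes>\<^bsub>NF\<^esub> \<eta>) =
        nash_derivation T \<Omega> g \<xi> \<otimes>\<^bsub>NF\<^esub> \<eta> \<oplus>\<^bsub>NF\<^esub> \<xi> \<otimes>\<^bsub>NF\<^esub> nash_derivation T \<Omega> g \<eta>"
    proof -
      have "(\<Oplus>\<^bsub>NF\<^esub>t\<in>F. g t \<otimes>\<^bsub>NF\<^esub> ?d t (\<xi> \<otimes>\<^bsub>NF\<^esub> \<eta>)) =
          (\<Oplus>\<^bsub>NF\<^esub>t\<in>F. (g t \<otimes>\<^bsub>NF\<^esub> ?d t \<xi>) \<otimes>\<^bsub>NF\<^esub> \<eta> \<oplus>\<^bsub>NF\<^esub> \<xi> \<otimes>\<^bsub>NF\<^esub> (g t \<otimes>\<^bsub>NF\<^esub> ?d t \<eta>))"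
      proof (rule NF.finsum_cong'[OF refl])
        fix t assume "t \<in> F"
        note t = Fg[OF this]
        show "g t \<otimes>\<^bsub>NF\<^esub> ?d t (\<xi> \<otimes>\<^bsub>NF\<^esub> \<eta>) =
            (g t \<otimes>\<^bsub>NF\<^esub> ?d t \<xi>) \<otimes>\<^bsub>NF\<^esub> \<eta> \<oplus>\<^bsub>NF\<^esub> \<xi> \<otimes>\<^bsub>NF\<^esub> (g t \<otimes>\<^bsub>NF\<^esub> ?d t \<eta>)"
          unfolding mult[OF t(4) x y] using t x y by (simp add: NF.r_distr NF.m_ac)
      qed (use Fg x y in auto)
      also have "\<dots> = (\<Oplus>\<^bsub>NF\<^esub>t\<in>F. (g t \<otimes>\<^bsub>NF\<^esub> ?d t \<xi>) \<otimes>\<^bsub>NF\<^esub> \<eta>) \<oplus>\<^bsub>NF\<^esub>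
          (\<Oplus>\<^bsub>NF\<^esub>t\<in>F. \<xi> \<otimes>\<^bsub>NF\<^esub> (g t \<otimes>\<^bsub>NF\<^esub> ?d t \<eta>))"
        by (rule NF.finsum_addf) (use Fg x y in auto)
      also have "(\<Oplus>\<^bsub>NF\<^esub>t\<in>F. (g t \<otimes>\<^bsub>NF\<^esub> ?d t \<xi>) \<otimes>\<^bsub>NF\<^esub> \<eta>) = (\<Oplus>\<^bsub>NF\<^esub>t\<in>F. g t \<otimes>\<^bsub>NF\<^esub> ?d t \<xi>) \<otimes>\<^bsub>NF\<^esub> \<eta>"
        by (rule NF.finsum_ldistr[symmetric]) (use Fg F(1) y in auto)
      also have "(\<Oplus>\<^bsub>NF\<^esub>t\<in>F. \<xi> \<otimes>\<^bsub>NF\<^esub> (g t \<otimes>\<^bsub>NF\<^esub> ?d t \<eta>)) = \<xi> \<otimes>\<^bsub>NF\<^esub> (\<Oplus>\<^bsub>NF\<^esub>t\<in>F. g t \<otimes>\<^bsub>NF\<^esub> ?d t \<eta>)"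
        by (rule NF.finsum_rdistr[symmetric]) (use Fg F(1) x in auto)
      finally show ?thesis by (simp only: ex ey em)
    qed
  }
qed

lemma nash_derivation_Lam:
  assumes g: "\<And>t. t \<in> T \<Longrightarrow> g t \<in> carrier NF" and s: "s \<in> T"
  shows "nash_derivation T \<Omega> g (Lam s) = g s"
proof -
  have "\<forall>t\<in>T - {s}. nash_partial T \<Omega> t (Lam s) = \<zero>\<^bsub>NF\<^esub>" using nash_partial_Lam s by auto
  then have "nash_derivation T \<Omega> g (Lam s) = (\<Oplus>\<^bsub>NF\<^esub>t\<in>{s}. g t \<otimes>\<^bsub>NF\<^esub> nash_partial T \<Omega> t (Lam s))"
    using s by (intro nash_derivation_eq_finsum g) auto
  also have "\<dots> = g s" using g[OF s] nash_partial_Lam[OF s s] by simp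
  finally show ?thesis .
qed

end

section \<open>The isomorphism\<close>

context differentially_closed_field
begin

text \<open>The initial graph pairs the values of each polynomial at the basis \<open>T\<close> and
  at the coordinates. It is matched because both systems are independent, and both fields are
  algebraic over its projections.\<close>

lemma nash_ring_iso:
  assumes "nash_filter T \<Omega>" and ind: "alg_indep T"
    and alg: "\<And>a. a \<in> carrier R \<Longrightarrow> algebraic_over R {ring_poly_eval R coord P | P. ipoly_vars P \<subseteq> T} a"
  shows "\<exists>\<phi>\<in>ring_iso R (nash_field T \<Omega>). \<forall>t\<in>T. \<phi> t = nash_filter.Lam T \<Omega> t"
proof -
  interpret F: nash_filter T \<Omega> by fact
  let ?N = "nash_field T \<Omega>"
  let ?p = "\<lambda>P. (ring_poly_eval R coord P, ring_poly_eval ?N F.Lam P)"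
  define G0 where "G0 = {?p P | P. ipoly_vars P \<subseteq> T}"
  have G0I: "?p P \<in> G0" if "ipoly_vars P \<subseteq> T" for P using that unfolding G0_def by blast
  have G0E: "\<exists>P. ipoly_vars P \<subseteq> T \<and> z = ?p P" if "z \<in> G0" for z using that unfolding G0_def by blast
  interpret RN: ring "RDirProd R ?N" by (intro RDirProd_ring ring_axioms F.NF.ring_axioms)
  have carr: "?p P \<in> carrier (RDirProd R ?N)" for P
    by (simp add: RDirProd_carrier F.NF.ring_poly_eval_closed)
  have sub: "subring G0 (RDirProd R ?N)"
  proof (rule RN.subringI)
    show "G0 \<subseteq> carrier (RDirProd R ?N)" using G0E carr by fastforce
    have "?p 1 = \<one>\<^bsub>RDirProd R ?N\<^esub>"
      by (simp add: RDirProd_sel ring_poly_eval_one F.NF.ring_poly_eval_one)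
    then show "\<one>\<^bsub>RDirProd R ?N\<^esub> \<in> G0" using G0I[of 1] by (simp add: ipoly_vars_def)
  next
    fix h assume "h \<in> G0"
    then obtain P where P: "ipoly_vars P \<subseteq> T" "h = ?p P" using G0E by blast
    have "?p (- P) \<oplus>\<^bsub>RDirProd R ?N\<^esub> ?p P = \<zero>\<^bsub>RDirProd R ?N\<^esub>"
      by (simp add: RDirProd_sel ring_poly_eval_uminus F.NF.ring_poly_eval_uminus
          l_neg F.NF.l_neg F.NF.ring_poly_eval_closed)
    then have "\<ominus>\<^bsub>RDirProd R ?N\<^esub> h = ?p (- P)" unfolding P(2)
      by (rule RN.minus_equality[OF _ carr carr])
    then show "\<ominus>\<^bsub>RDirProd R ?N\<^esub> h \<in> G0" using G0I[of "- P"] P(1) by (simp add: ipoly_vars_def)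
  next
    fix h h' assume h: "h \<in> G0" "h' \<in> G0"
    obtain P P' where P: "ipoly_vars P \<subseteq> T" "h = ?p P" "ipoly_vars P' \<subseteq> T" "h' = ?p P'"
      using G0E[OF h(1)] G0E[OF h(2)] by (elim exE conjE)
    have "h \<otimes>\<^bsub>RDirProd R ?N\<^esub> h' = ?p (P * P')" "h \<oplus>\<^bsub>RDirProd R ?N\<^esub> h' = ?p (P + P')"
      by (simp_all add: P RDirProd_sel ring_poly_eval_mult F.NF.ring_poly_eval_mult
          ring_poly_eval_add F.NF.ring_poly_eval_add)
    moreover have "ipoly_vars (P * P') \<subseteq> T" "ipoly_vars (P + P') \<subseteq> T"
      using P(1,3) ipoly_vars_mult[of P P'] ipoly_vars_add[of P P'] by auto
    ultimately show "h \<otimes>\<^bsub>RDirProd R ?N\<^esub> h' \<in> G0" "h \<oplus>\<^bsub>RDirProd R ?N\<^esub> h' \<in> G0"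
      using G0I[of "P * P'"] G0I[of "P + P'"] by simp_all
  qed
  have G0: "matched R ?N G0"
    unfolding matched_def
  proof (intro conjI sub allI impI)
    fix x y assume "(x, y) \<in> G0"
    then obtain P where P: "ipoly_vars P \<subseteq> T" "x = ring_poly_eval R coord P" "y = ring_poly_eval ?N F.Lam P"
      using G0E by blast
    show "(x = \<zero>) = (y = \<zero>\<^bsub>?N\<^esub>)"
    proof
      assume "x = \<zero>"
      then have "P = 0" using ind P(1,2) unfolding alg_indep_def by simp
      then show "y = \<zero>\<^bsub>?N\<^esub>" by (simp add: P(3) F.NF.ring_poly_eval_zero)
    next
      assume "y = \<zero>\<^bsub>?N\<^esub>"
      then have "P = 0" using F.ring_poly_eval_Lam_eq_zero[OF P(1)] P(3) by simp
      then show "x = \<zero>" by (simp add: P(2))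
    qed
  qed
  have algK: "algebraic_over R (fst ` G0) a" if "a \<in> carrier R" for a
  proof -
    have "{ring_poly_eval R coord P | P. ipoly_vars P \<subseteq> T} = fst ` G0" by (force simp: G0_def)
    then show ?thesis using alg[OF that] by simp
  qed
  have algN: "algebraic_over ?N (snd ` G0) b" if b: "b \<in> carrier ?N" for b
  proof -
    obtain n :: nat and C where nC: "(\<forall>i. ipoly_vars (C i) \<subseteq> T) \<and> (\<exists>i\<le>n. C i \<noteq> 0) \<and>
      (\<Oplus>\<^bsub>?N\<^esub>i\<in>{..n}. ring_poly_eval ?N F.Lam (C i) \<otimes>\<^bsub>?N\<^esub> b [^]\<^bsub>?N\<^esub> i) = \<zero>\<^bsub>?N\<^esub>"
      using F.NF_algebraic[OF b] by (elim exE)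
    let ?c = "\<lambda>i. ring_poly_eval ?N F.Lam (C i)"
    have "?c \<in> {..n} \<rightarrow> snd ` G0"
    proof
      fix i
      have "?p (C i) \<in> G0" using nC by (intro G0I) simp
      then show "?c i \<in> snd ` G0" by (rule rev_image_eqI) simp
    qed
    moreover have "\<exists>i\<le>n. ?c i \<noteq> \<zero>\<^bsub>?N\<^esub>"
      using nC F.ring_poly_eval_Lam_eq_zero by blast
    ultimately have "?c \<in> {..n} \<rightarrow> snd ` G0 \<and> (\<exists>i\<le>n. ?c i \<noteq> \<zero>\<^bsub>?N\<^esub>) \<and>
        (\<Oplus>\<^bsub>?N\<^esub>i\<in>{..n}. ?c i \<otimes>\<^bsub>?N\<^esub> b [^]\<^bsub>?N\<^esub> i) = \<zero>\<^bsub>?N\<^esub>"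
      using nC[THEN conjunct2, THEN conjunct2] by (intro conjI)
    then show ?thesis unfolding algebraic_over_def by (intro exI)
  qed
  have "\<exists>\<phi>\<in>ring_iso R ?N. \<forall>(x, y)\<in>G0. \<phi> x = y"
    by (rule matched_ring_iso[OF field_axioms F.field_NF has_roots F.has_roots_NF G0 algK algN])
  then obtain \<phi> where \<phi>: "\<phi> \<in> ring_iso R ?N" "\<forall>(x, y)\<in>G0. \<phi> x = y" by (rule bexE)
  have "\<phi> t = F.Lam t" if t: "t \<in> T" for t
  proof -
    have tR: "t \<in> carrier R" using ind t by (auto simp: alg_indep_def)
    have "ipoly_vars (isingle {#t#} 1) \<subseteq> T" by (rule order_trans[OF ipoly_vars_single]) (simp add: t)
    from G0I[OF this] have "(t, F.Lam t) \<in> G0"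
      using tR by (simp add: ring_poly_eval_var F.NF.ring_poly_eval_var coord_def)
    then show ?thesis using \<phi>(2) by auto
  qed
  then show ?thesis using \<phi>(1) by blast
qed

end

theorem theorem3:
  fixes K :: "('a, 'm) ring_scheme" and \<delta> :: "'a \<Rightarrow> 'a"
  assumes "differentially_closed_field K \<delta>"
  shows "\<exists>T :: 'a set. infinite T \<and>
    (\<forall>\<Omega>. c_filter T \<Omega> \<longrightarrow>
      (\<exists>g. (\<forall>t\<in>T. g t \<in> carrier (nash_field T \<Omega>)) \<and>
        (\<exists>\<phi>. \<phi> \<in> differential_iso K \<delta> (nash_field T \<Omega>) (nash_derivation T \<Omega> g))))"
proof -
  interpret K: differentially_closed_field K \<delta> by fact
  obtain Y where Y: "infinite Y" "K.alg_indep Y" using K.infinite_alg_indep by (elim exE conjE)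
  obtain T where T: "Y \<subseteq> T" "K.alg_indep T"
    "\<forall>a\<in>carrier K. algebraic_over K {ring_poly_eval K K.coord P | P. ipoly_vars P \<subseteq> T} a"
    using K.alg_indep_extend[OF Y(2)] by (elim exE conjE)
  have Tc: "T \<subseteq> carrier K" using T(2) by (simp add: K.alg_indep_def)
  show ?thesis
  proof (intro exI[of _ T] conjI allI impI)
    show "infinite T" using Y(1) T(1) finite_subset by blast
    fix \<Omega> :: "('a \<Rightarrow> complex) set set" assume "c_filter T \<Omega>"
    then interpret F: nash_filter T \<Omega> by unfold_locales
    let ?N = "nash_field T \<Omega>"
    obtain \<phi> where \<phi>: "\<phi> \<in> ring_iso K ?N" "\<forall>t\<in>T. \<phi> t = F.Lam t"
      using K.nash_ring_iso[OF F.nash_filter_axioms T(2)] T(3) by blast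
    have bij: "bij_betw \<phi> (carrier K) (carrier ?N)" using \<phi>(1) by (simp add: ring_iso_def)
    define g where "g t = \<phi> (\<delta> t)" for t
    have g: "g t \<in> carrier ?N" if "t \<in> T" for t
      unfolding g_def using bij_betw_apply[OF bij] K.deriv_closed Tc that by blast
    have "\<phi> (\<delta> a) = nash_derivation T \<Omega> g (\<phi> a)" if a: "a \<in> carrier K" for a
    proof -
      let ?E = "\<lambda>b. \<phi> (\<delta> (inv_into (carrier K) \<phi> b))"
      have inv: "inv_into (carrier K) \<phi> (\<phi> b) = b" if "b \<in> carrier K" for b
        by (rule bij_betw_inv_into_left[OF bij that])
      have "?E (\<phi> a) = nash_derivation T \<Omega> g (\<phi> a)"
      proof (rule F.deriv_eqI[OF K.differential_field_transport[OF F.field_NF \<phi>(1)]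
            F.differential_field_nash_derivation[OF g]])
        show "\<phi> a \<in> carrier ?N" by (rule bij_betw_apply[OF bij a])
        fix t assume t: "t \<in> T"
        then have "?E (F.Lam t) = g t" using \<phi>(2) inv[of t] Tc by (auto simp: g_def)
        then show "?E (F.Lam t) = nash_derivation T \<Omega> g (F.Lam t)"
          using F.nash_derivation_Lam[OF g t] by simp
      qed simp_all
      then show ?thesis using inv[OF a] by simp
    qed
    then show "\<exists>g. (\<forall>t\<in>T. g t \<in> carrier ?N) \<and>
        (\<exists>\<phi>. \<phi> \<in> differential_iso K \<delta> ?N (nash_derivation T \<Omega> g))"
      using g \<phi>(1) unfolding differential_iso_def by blast
  qed
qed

end
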